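(* Let $d\ge0$ be an integer. There exist $\underline n=\underline n(d)$, a constant $c=c(d)>0$ and, for every $\delta>0$, a constant $C=C(d,\delta)>0$ such that for all $n\ge\underline n$, all $2\le k\le n$ and all $\sigma>0$ the following two statements hold. (i) For every $\theta_0\in\mathbb R^n$, if $Y=\theta_0+\varepsilon$ with $\varepsilon_1,\dots,\varepsilon_n$ i.i.d. $N(0,\sigma^2)$ and $\widehat\theta^*\in\arg\min_{\theta\in\Theta^*_n(d,k)}\|Y-\theta\|^2$, then $$\mathbb E_{\theta_0}\|\widehat\theta^*-\theta_0\|^2\le(1+\delta)\inf_{\theta^*\in\Theta_n^*(d,k)}\|\theta^*-\theta_0\|^2+C\sigma^2k\log\log(16n/k).$$ (ii) Moreover, $$\inf_{\widetilde\theta^*}\sup_{\theta^*\in\Theta_n^*(d,k)}\mathbb E_{\theta^*}\|\widetilde\theta^*-\theta^*\|^2\ge c\,\sigma^2\log\log(16n),$$ where the infimum is over all measurable functions $\widetilde\theta^*=\widetilde\theta^*(Y)\in\mathbb R^n$ of $Y=\theta^*+\varepsilon$, with $\varepsilon_1,\dots,\varepsilon_n$ i.i.d. $N(0,\sigma^2)$.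
   Context: $\|\cdot\|$ is the Euclidean norm. $\mathcal F_n^*(0,k)$ is the set of non-decreasing functions $f:[0,1]\to\mathbb R$ for which there exist integers $0=n_0\le n_1\le\cdots\le n_k=n$ such that $f$ is constant on each interval $(n_{i-1}/n,n_i/n]$. For a function $f$ on $[0,1]$, $\tau\in[0,1]$ and $c\in\mathbb R$ put $(I^1_{c;\tau}f)(x)=\int_\tau^xf(y)\,dy+c$, and for $m\ge2$ put $I^m_{c_0,\dots,c_{m-1};\tau}f=I^1_{c_0;\tau}\big(I^{m-1}_{c_1,\dots,c_{m-1};\tau}f\big)$. For $d\ge1$, $\mathcal F_n^*(d,k)$ ($d$-monotone splines) is the set of functions $f=I^d_{r_0,\dots,r_{d-1};0}f_\circ$ with $f_\circ\in\mathcal F^*_n(0,k)$ and $r_0,\dots,r_{d-1}\in\mathbb R$. Finally, $\Theta_n^*(d,k)=\{\theta^*\in\mathbb R^n:\theta^*_i=f^*(i/n),\ 1\le i\le n,\text{ for some }f^*\in\mathcal F_n^*(d,k)\}$. The least squares estimator $\widehat\theta^*$ is any (measurable) choice of minimizer. *)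

theory Defs
  imports "HOL-Probability.Probability"
begin

text \<open>
  Since \<open>n\<close> varies inside the statement, a vector of \<open>\<real>\<^sup>n\<close> is an extensional function on the
  index set \<open>{1..n}\<close>, that is, an element of \<^term>\<open>space (Rn n)\<close>.  Likewise a function on
  \<open>[0,1]\<close> is an extensional function on \<open>{0..1}\<close>.
\<close>

definition Rn :: "nat \<Rightarrow> (nat \<Rightarrow> real) measure" where
  "Rn n = Pi\<^sub>M {1..n} (\<lambda>_. borel)"

definition edist :: "nat \<Rightarrow> (nat \<Rightarrow> real) \<Rightarrow> (nat \<Rightarrow> real) \<Rightarrow> real" where
  "edist n x y = L2_set (\<lambda>i. x i - y i) {1..n}"

definition mono_step :: "nat \<Rightarrow> nat \<Rightarrow> (real \<Rightarrow> real) set" where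
  "mono_step n k =
     {f \<in> extensional {0..1}. mono_on {0..1} f \<and>
        (\<exists>m :: nat \<Rightarrow> nat. m 0 = 0 \<and> m k = n \<and>
           (\<forall>i\<in>{1..k}. m (i - 1) \<le> m i \<and>
              f constant_on {real (m (i - 1)) / real n <.. real (m i) / real n}))}"

definition prim :: "real \<Rightarrow> real \<Rightarrow> (real \<Rightarrow> real) \<Rightarrow> real \<Rightarrow> real" where
  "prim c \<tau> f = (\<lambda>x\<in>{0..1}. (LBINT y=\<tau>..x. f y) + c)"

primrec iter_prim :: "real list \<Rightarrow> real \<Rightarrow> (real \<Rightarrow> real) \<Rightarrow> real \<Rightarrow> real" where
  "iter_prim [] \<tau> f = f"
| "iter_prim (c # cs) \<tau> f = prim c \<tau> (iter_prim cs \<tau> f)"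

text \<open>For \<open>d = 0\<close> the list of constants is empty, so this is \<^term>\<open>mono_step n k\<close>.\<close>

definition mono_spline :: "nat \<Rightarrow> nat \<Rightarrow> nat \<Rightarrow> (real \<Rightarrow> real) set" where
  "mono_spline n d k = {iter_prim rs 0 f | rs f. length rs = d \<and> f \<in> mono_step n k}"

definition Theta :: "nat \<Rightarrow> nat \<Rightarrow> nat \<Rightarrow> (nat \<Rightarrow> real) set" where
  "Theta n d k =
     {\<theta> \<in> space (Rn n). \<exists>f\<in>mono_spline n d k. \<forall>i\<in>{1..n}. \<theta> i = f (real i / real n)}"

definition noise :: "nat \<Rightarrow> real \<Rightarrow> (nat \<Rightarrow> real) measure" where
  "noise n \<sigma> = Pi\<^sub>M {1..n} (\<lambda>_. density lborel (\<lambda>x. ennreal (normal_density 0 \<sigma> x)))"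

definition obs :: "nat \<Rightarrow> (nat \<Rightarrow> real) \<Rightarrow> (nat \<Rightarrow> real) \<Rightarrow> nat \<Rightarrow> real" where
  "obs n \<theta> \<epsilon> = (\<lambda>i\<in>{1..n}. \<theta> i + \<epsilon> i)"

text \<open>
  The risk is taken in \<^typ>\<open>ennreal\<close>: an estimator without finite second moment has
  risk \<open>\<infinity>\<close>, rather than the value \<open>0\<close> that the Bochner integral would give.
\<close>

definition risk ::
  "nat \<Rightarrow> real \<Rightarrow> (nat \<Rightarrow> real) \<Rightarrow> ((nat \<Rightarrow> real) \<Rightarrow> nat \<Rightarrow> real) \<Rightarrow> ennreal" where
  "risk n \<sigma> \<theta> T = (\<integral>\<^sup>+ \<epsilon>. ennreal ((edist n (T (obs n \<theta> \<epsilon>)) \<theta>)\<^sup>2) \<partial>noise n \<sigma>)"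

definition is_LSE :: "nat \<Rightarrow> nat \<Rightarrow> nat \<Rightarrow> ((nat \<Rightarrow> real) \<Rightarrow> nat \<Rightarrow> real) \<Rightarrow> bool" where
  "is_LSE n d k T \<longleftrightarrow> T \<in> Rn n \<rightarrow>\<^sub>M Rn n \<and>
     (\<forall>y\<in>space (Rn n). is_arg_min (\<lambda>\<theta>. (edist n y \<theta>)\<^sup>2) (\<lambda>\<theta>. \<theta> \<in> Theta n d k) (T y))"

end

theory Submission
  imports Defs "HOL-Library.Discrete_Functions"
begin

text \<open>
  Upper bound.  Let \<open>v\<close> be the difference of the estimator and a competitor.  The basic inequality
  reduces the claim to \<open>\<langle>\<epsilon>, v\<rangle>\<^sup>2 \<le> Q \<parallel>v\<parallel>\<^sup>2\<close> with \<open>E Q\<close> of order \<open>\<sigma>\<^sup>2 k log log (16 n / k)\<close>.  On each block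
  between knots of the competitor the differences of \<open>v\<close> of order \<open>d + 1\<close> are nonnegative.  Cut the block
  into dyadic (Whitney) intervals accumulating at its two ends.  Those that meet no knot of the
  estimator are merged into maximal runs, where \<open>v\<close> is a polynomial; on the others nonnegativity
  of divided differences bounds \<open>v\<close> pointwise by its norm on the neighbouring intervals.  As
  \<open>v\<close> has boundedly many monotone pieces, summation by parts leaves only the normalised maximal
  partial sums of the noise over these intervals.  Only \<open>O(k)\<close> intervals occur, out of a family, fixed
  by the competitor, of size \<open>O(k (log (16 n / k))\<^sup>2)\<close>, and the partial sums have Gaussian tails, whence the
  iterated logarithm.

  Lower bound.  About \<open>log n\<close> truncated powers with knots at distance \<open>2 ^ j\<close> from the right end, scaled to
  norm of order \<open>\<sigma> sqrt (log log n)\<close>, are well separated but cannot be identified from the data.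
\<close>

section \<open>Divided differences\<close>

text \<open>The sign of the differences of \<open>v\<close> is lost across knots of the competitor,
  so \<open>v\<close> is controlled at a point only at the scale of its distance to the ends of the
  block; this forces the dyadic decomposition. Which runs occur depends on the estimator, hence on
  the noise. To remove this dependence, each normalised squared partial sum is split into a fixed
  threshold \<open>w\<close> and an excess: the threshold is paid once per interval that occurs, the
  excess is summed over all intervals that could occur. With \<open>w = 8 ln (ln (16 n / k))\<close>
  one excess has mean of order \<open>exp (- w / 4)\<close>, which is \<open>ln (16 n / k)\<close>
  to the power -2 and balances the size of the family. The factor \<open>1 + \<delta>\<close> comes
  from splitting the cross term with a small parameter and absorbing part of it.

  For the lower bound each hypothesis is compared with pure noise through the second moment of its
  likelihood ratio, the exponential of the squared norm divided by \<open>\<sigma>^2\<close>. With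
  \<open>M\<close> of order \<open>log n\<close> hypotheses it may be as large as
  \<open>M / 4\<close>, so squared norms up to \<open>\<sigma>^2 ln (M / 4)\<close> stay hidden;
  this produces the second logarithm.\<close>

primrec fd :: "nat \<Rightarrow> (nat \<Rightarrow> real) \<Rightarrow> nat \<Rightarrow> real" where
  "fd 0 v i = v i"
| "fd (Suc m) v i = fd m v (Suc i) - fd m v i"

lemma fd_diff: "fd m (\<lambda>i. u i - v i) i = fd m u i - fd m v i"
  by (induction m arbitrary: i) auto

lemma fd_uminus: "fd m (\<lambda>i. - v i) i = - fd m v i"
  by (induction m arbitrary: i) auto

lemma fd_Suc_shift: "fd (Suc m) v i = fd m (\<lambda>i. v (Suc i) - v i) i"
  by (induction m arbitrary: i) auto

lemma fd_cong: "(\<And>j. i \<le> j \<Longrightarrow> j \<le> i + m \<Longrightarrow> u j = v j) \<Longrightarrow> fd m u i = fd m v i"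
proof (induction m arbitrary: i)
  case 0 then show ?case by simp
next
  case (Suc m)
  have "fd m u i = fd m v i" "fd m u (Suc i) = fd m v (Suc i)"
    by (rule Suc.IH; use Suc.prems in force)+
  then show ?case by simp
qed

text \<open>Lagrange's explicit form of the divided difference. The nodes form a set, so symmetry is
  built in and \<open>dd_nonneg\<close> can exchange an end node for an interior one without
  reordering.\<close>

definition dd :: "nat set \<Rightarrow> (nat \<Rightarrow> real) \<Rightarrow> real" where
  "dd A v = (\<Sum>a\<in>A. v a / (\<Prod>b\<in>A - {a}. real a - real b))"

lemma dd_insert_expand:
  assumes "finite A" "p \<notin> A"
  shows "dd (insert p A) v = v p / (\<Prod>b\<in>A. real p - real b) +
     (\<Sum>a\<in>A. v a / ((\<Prod>b\<in>A - {a}. real a - real b) * (real a - real p)))"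
proof -
  have "(\<Prod>b\<in>insert p A - {a}. real a - real b) = (\<Prod>b\<in>A - {a}. real a - real b) * (real a - real p)"
    if "a \<in> A" for a
  proof -
    have "insert p A - {a} = insert p (A - {a})" using assms that by auto
    then show ?thesis using assms by (simp add: mult.commute)
  qed
  moreover have "insert p A - {p} = A" using assms by auto
  ultimately show ?thesis unfolding dd_def using assms by simp
qed

text \<open>Newton's recurrence, checked coefficient by coefficient: at a common node
  \<open>a\<close> it is the partial fraction identity
  \<open>(q - p) / ((a - q) (a - p)) = 1 / (a - q) - 1 / (a - p)\<close>.\<close>

lemma dd_rec:
  assumes "finite A" "p \<notin> A" "q \<notin> A" "p \<noteq> q"
  shows "(real q - real p) * dd (insert p (insert q A)) v = dd (insert q A) v - dd (insert p A) v"
proof -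
  define P where "P a = (\<Prod>b\<in>A - {a}. real a - real b)" for a
  have 1: "dd (insert q A) v = v q / (\<Prod>b\<in>A. real q - real b) +
     (\<Sum>a\<in>A. v a / (P a * (real a - real q)))"
    unfolding P_def using assms by (intro dd_insert_expand) auto
  have 2: "dd (insert p A) v = v p / (\<Prod>b\<in>A. real p - real b) +
     (\<Sum>a\<in>A. v a / (P a * (real a - real p)))"
    unfolding P_def using assms by (intro dd_insert_expand) auto
  have 3: "dd (insert p (insert q A)) v = v p / (\<Prod>b\<in>insert q A. real p - real b) +
     (\<Sum>a\<in>insert q A. v a / ((\<Prod>b\<in>insert q A - {a}. real a - real b) * (real a - real p)))"
    using assms by (intro dd_insert_expand) auto
  have 4: "(\<Prod>b\<in>insert q A - {a}. real a - real b) = P a * (real a - real q)" if "a \<in> A" for a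
  proof -
    have "insert q A - {a} = insert q (A - {a})" using assms that by auto
    then show ?thesis using assms by (simp add: mult.commute P_def)
  qed
  have 5: "insert q A - {q} = A" using assms by auto
  have nz: "(\<Prod>b\<in>A. real p - real b) \<noteq> 0" "(\<Prod>b\<in>A. real q - real b) \<noteq> 0" using assms by auto
  have 6: "(\<Sum>a\<in>insert q A. v a / ((\<Prod>b\<in>insert q A - {a}. real a - real b) * (real a - real p)))
    = v q / ((\<Prod>b\<in>A. real q - real b) * (real q - real p)) +
      (\<Sum>a\<in>A. v a / (P a * (real a - real q) * (real a - real p)))"
    using assms by (simp add: 4 5)
  have 7: "(real q - real p) * (v a / (P a * (real a - real q) * (real a - real p))) =
      v a / (P a * (real a - real q)) - v a / (P a * (real a - real p))" if "a \<in> A" for a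
  proof -
    have "real a \<noteq> real q" "real a \<noteq> real p" "P a \<noteq> 0" using that assms by (auto simp: P_def)
    then show ?thesis by (simp add: divide_simps) (simp add: algebra_simps)
  qed
  have "(real q - real p) * (v p / ((\<Prod>b\<in>A. real p - real b) * (real p - real q))) =
     - (v p / (\<Prod>b\<in>A. real p - real b))"
    using assms nz by (simp add: divide_simps) (simp add: algebra_simps)
  moreover have "(real q - real p) * (v q / ((\<Prod>b\<in>A. real q - real b) * (real q - real p))) =
     (v q / (\<Prod>b\<in>A. real q - real b))"
    using assms nz by (simp add: divide_simps)
  moreover have "(real q - real p) * (\<Sum>a\<in>A. v a / (P a * (real a - real q) * (real a - real p)))
     = (\<Sum>a\<in>A. v a / (P a * (real a - real q))) - (\<Sum>a\<in>A. v a / (P a * (real a - real p)))"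
    unfolding sum_distrib_left sum_subtractf[symmetric] by (intro sum.cong refl 7)
  ultimately show ?thesis
    unfolding 1 2 3 6 using assms by (simp add: algebra_simps)
qed

lemma dd_consecutive: "dd {x..x+m} v = fd m v x / fact m"
proof (induction m arbitrary: x)
  case 0 then show ?case by (simp add: dd_def)
next
  case (Suc m)
  define A where "A = {Suc x..x+m}"
  have s: "{x..x+Suc m} = insert x (insert (x + Suc m) A)" "{Suc x..Suc x+m} = insert (x+Suc m) A"
     "{x..x+m} = insert x A"
    by (auto simp: A_def)
  have "(real (x + Suc m) - real x) * dd {x..x+Suc m} v = dd {Suc x..Suc x + m} v - dd {x..x+m} v"
    unfolding s by (intro dd_rec) (auto simp: A_def)
  also have "\<dots> = fd (Suc m) v x / fact m"
    unfolding Suc.IH by (simp add: diff_divide_distrib)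
  finally have "(1 + real m) * dd {x..x+Suc m} v = fd (Suc m) v x / fact m" by simp
  then have "dd {x..x+Suc m} v = (fd (Suc m) v x / fact m) / (1 + real m)"
    by (metis nonzero_mult_div_cancel_left of_nat_Suc of_nat_neq_0)
  then show ?case by (simp add: field_simps)
qed

text \<open>If the nodes leave a gap at \<open>z\<close> between the extreme nodes \<open>p\<close>
  and \<open>q\<close>, the recurrence gives
  \<open>(q - p) dd A = (z - p) dd A1 + (q - z) dd A2\<close>, where \<open>z\<close> replaces
  \<open>q\<close> in \<open>A1\<close> and \<open>p\<close> in \<open>A2\<close>. Both spreads are
  smaller, and a set without gaps consists of consecutive nodes, where the divided difference is
  \<open>fd m v p / fact m\<close>.\<close>

lemma dd_nonneg:
  assumes "finite A" "card A = Suc m"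
    and "\<And>i. Min A \<le> i \<Longrightarrow> i + m \<le> Max A \<Longrightarrow> fd m v i \<ge> 0"
  shows "dd A v \<ge> 0"
  using assms
proof (induction "Max A - Min A" arbitrary: A rule: less_induct)
  case less
  define p q where "p = Min A" and "q = Max A"
  have ne: "A \<noteq> {}" using less.prems by auto
  have pq: "p \<in> A" "q \<in> A" and bnd: "\<And>a. a \<in> A \<Longrightarrow> p \<le> a \<and> a \<le> q"
    using less.prems ne by (auto simp: p_def q_def)
  show ?case
  proof (cases "A = {p..q}")
    case True
    have "card {p..q} = Suc m" using less.prems(2) True by metis
    moreover have "p \<le> q" using bnd pq by blast
    ultimately have "q = p + m" by simp
    then have "dd A v = fd m v p / fact m" using True dd_consecutive[of p m v] by simp
    moreover have "fd m v p \<ge> 0" using less.prems(3)[of p] \<open>q = p+m\<close> by (simp add: p_def q_def)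
    ultimately show ?thesis by simp
  next
    case False
    moreover have "A \<subseteq> {p..q}" using bnd by auto
    ultimately obtain z where "z \<notin> A" "z \<in> {p..q}" by blast
    then have z: "z \<notin> A" "p \<le> z" "z \<le> q" by auto
    then have zz: "p < z" "z < q" using pq by (metis le_neq_implies_less)+
    define B where "B = A - {p,q}"
    have A: "A = insert p (insert q B)" "p \<notin> B" "q \<notin> B" "z \<notin> B" "finite B" "p \<noteq> q"
      using pq z zz less.prems by (auto simp: B_def)
    define A1 A2 where "A1 = insert p (insert z B)" and "A2 = insert z (insert q B)"
    have c: "card A1 = Suc m" "card A2 = Suc m"
      using less.prems(2) A zz by (auto simp: A1_def A2_def)
    have f: "finite A1" "finite A2" "A1 \<noteq> {}" "A2 \<noteq> {}" using A by (auto simp: A1_def A2_def)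
    have Bb: "p < b \<and> b < q" if "b \<in> B" for b
      using bnd[of b] that unfolding B_def by auto
    have b1: "p \<le> a \<and> a < q" if "a \<in> A1" for a using that Bb zz by (auto simp: A1_def less_imp_le)
    have b2: "p < a \<and> a \<le> q" if "a \<in> A2" for a using that Bb zz by (auto simp: A2_def less_imp_le)
    have m1: "Min A1 \<ge> p" "Max A1 < q" "Min A2 > p" "Max A2 \<le> q"
      using f b1 b2 by (auto)
    have "Min A1 \<le> Max A1" "Min A2 \<le> Max A2"
      using f Min_in Max_ge by metis+
    then have lt: "Max A1 - Min A1 < Max A - Min A" "Max A2 - Min A2 < Max A - Min A"
      using m1 by (fold p_def q_def) linarith+
    have d1: "dd A1 v \<ge> 0"
    proof (rule less.hyps[OF lt(1) f(1) c(1)])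
      fix i assume "Min A1 \<le> i" "i + m \<le> Max A1"
      then show "0 \<le> fd m v i" using m1 less.prems(3)[of i] by (simp add: p_def q_def)
    qed
    have d2: "dd A2 v \<ge> 0"
    proof (rule less.hyps[OF lt(2) f(2) c(2)])
      fix i assume "Min A2 \<le> i" "i + m \<le> Max A2"
      then show "0 \<le> fd m v i" using m1 less.prems(3)[of i] by (simp add: p_def q_def)
    qed
    have "(real q - real p) * dd A v = dd (insert q B) v - dd (insert p B) v"
      unfolding A(1) using A by (intro dd_rec) auto
    also have "\<dots> = (dd (insert z B) v - dd (insert p B) v) + (dd (insert q B) v - dd (insert z B) v)"
      by simp
    also have "dd (insert z B) v - dd (insert p B) v = (real z - real p) * dd A1 v"
      unfolding A1_def using A zz by (intro dd_rec[symmetric]) auto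
    also have "dd (insert q B) v - dd (insert z B) v = (real q - real z) * dd A2 v"
      unfolding A2_def using A zz by (intro dd_rec[symmetric]) auto
    finally have "(real q - real p) * dd A v \<ge> 0" using d1 d2 zz by simp
    then show ?thesis using zz by (simp add: zero_le_mult_iff)
  qed
qed

lemma prod_sign:
  assumes "finite Y" "x \<notin> Y"
  shows "(\<Prod>y\<in>Y. real x - real y) = (-1) ^ card {y\<in>Y. y > x} * (\<Prod>y\<in>Y. \<bar>real x - real y\<bar>)"
  using assms
proof (induction Y rule: finite_induct)
  case empty then show ?case by simp
next
  case (insert y Y)
  have "{z \<in> insert y Y. x < z} = (if x < y then insert y {z\<in>Y. x<z} else {z\<in>Y. x < z})" by auto
  then show ?case using insert by (auto simp: algebra_simps)
qed

text \<open>
  The divided difference on \<open>insert x Y\<close> is nonnegative, and the sign with which \<open>v x\<close> enters is the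
  parity of the number of nodes to the right of \<open>x\<close>.
\<close>

lemma interpolation_bound:
  assumes Y: "finite Y" "card Y = m" "x \<notin> Y" "q > 0"
    and sep: "\<And>y z. y \<in> Y \<Longrightarrow> z \<in> Y \<Longrightarrow> y \<noteq> z \<Longrightarrow> q \<le> \<bar>real y - real z\<bar>"
    and dst: "\<And>y. y \<in> Y \<Longrightarrow> \<bar>real x - real y\<bar> \<le> 4 * real m * q"
    and V: "\<And>y. y \<in> Y \<Longrightarrow> \<bar>v y\<bar> \<le> V"
    and hull: "\<And>y. y \<in> insert x Y \<Longrightarrow> lo \<le> y \<and> y \<le> hi"
    and pos: "\<And>i. lo \<le> i \<Longrightarrow> i + m \<le> hi \<Longrightarrow> fd m v i \<ge> 0"
  shows "(-1) ^ card {y\<in>Y. y > x} * v x \<ge> - (real m * (4 * real m) ^ (m - 1) * V)"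
proof -
  define s :: real where "s = (-1) ^ card {y\<in>Y. y > x}"
  define P where "P = (\<Prod>y\<in>Y. \<bar>real x - real y\<bar>)"
  have P: "P > 0" unfolding P_def using Y by (intro prod_pos) auto
  have ne: "insert x Y \<noteq> {}" "finite (insert x Y)" using Y by auto
  have "dd (insert x Y) v \<ge> 0"
  proof (rule dd_nonneg)
    show "card (insert x Y) = Suc m" using Y by simp
    fix i assume "Min (insert x Y) \<le> i" "i + m \<le> Max (insert x Y)"
    moreover have "lo \<le> Min (insert x Y)" "Max (insert x Y) \<le> hi"
      using hull Min_in[OF ne(2,1)] Max_in[OF ne(2,1)] by blast+
    ultimately show "fd m v i \<ge> 0" by (intro pos) linarith+
  qed (use ne in auto)
  then have "0 \<le> v x / (s * P) + (\<Sum>y\<in>Y. v y / ((\<Prod>b\<in>Y - {y}. real y - real b) * (real y - real x)))"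
    unfolding dd_insert_expand[OF Y(1,3)] prod_sign[OF Y(1,3)] s_def P_def .
  then have "0 \<le> P * (v x / (s * P) + (\<Sum>y\<in>Y. v y / ((\<Prod>b\<in>Y - {y}. real y - real b) * (real y - real x))))"
    using P by simp
  also have "\<dots> = s * v x + (\<Sum>y\<in>Y. P * (v y / ((\<Prod>b\<in>Y - {y}. real y - real b) * (real y - real x))))"
  proof -
    have "P * (v x / (s * P)) = s * v x" using P by (cases "even (card {y\<in>Y. y > x})") (auto simp: s_def)
    then show ?thesis by (simp add: distrib_left sum_distrib_left)
  qed
  \<comment> \<open>Multiplied by \<open>P\<close>, the weight of the node \<open>y\<close> loses
    its factor \<open>|y - x|\<close> and becomes a product of \<open>m - 1\<close> ratios
    \<open>|x - b| / |y - b|\<close>, each at most \<open>4 m q / q\<close>: the scale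
    \<open>q\<close> drops out.\<close>
  also have "(\<Sum>y\<in>Y. P * (v y / ((\<Prod>b\<in>Y - {y}. real y - real b) * (real y - real x))))
      \<le> (\<Sum>y\<in>Y. (4 * real m) ^ (m - 1) * V)"
  proof (rule sum_mono)
    fix y assume y: "y \<in> Y"
    define D where "D = (\<Prod>b\<in>Y - {y}. \<bar>real y - real b\<bar>)"
    have D: "D > 0" unfolding D_def using Y by (intro prod_pos) auto
    have xy: "\<bar>real y - real x\<bar> > 0" using y Y by auto
    have "V \<ge> 0" using V[OF y] by linarith
    have Psplit: "P = \<bar>real y - real x\<bar> * (\<Prod>b\<in>Y - {y}. \<bar>real x - real b\<bar>)"
      unfolding P_def using Y y by (subst prod.remove[of Y y]) (auto simp: abs_minus_commute)
    have "P * (v y / ((\<Prod>b\<in>Y - {y}. real y - real b) * (real y - real x))) \<le>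
       \<bar>P * (v y / ((\<Prod>b\<in>Y - {y}. real y - real b) * (real y - real x)))\<bar>" by (rule abs_ge_self)
    also have "\<dots> = P * \<bar>v y\<bar> / (D * \<bar>real y - real x\<bar>)"
      using P by (simp add: abs_mult D_def abs_prod)
    also have "\<dots> = ((\<Prod>b\<in>Y - {y}. \<bar>real x - real b\<bar>) / D) * \<bar>v y\<bar>"
      using xy D unfolding Psplit by (simp add: field_simps)
    also have "(\<Prod>b\<in>Y - {y}. \<bar>real x - real b\<bar>) / D = (\<Prod>b\<in>Y - {y}. \<bar>real x - real b\<bar> / \<bar>real y - real b\<bar>)"
      unfolding D_def by (simp add: prod_dividef)
    also have "(\<Prod>b\<in>Y - {y}. \<bar>real x - real b\<bar> / \<bar>real y - real b\<bar>) * \<bar>v y\<bar> \<le> (4 * real m) ^ (m - 1) * V"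
    proof (rule mult_mono)
      have "(\<Prod>b\<in>Y - {y}. \<bar>real x - real b\<bar> / \<bar>real y - real b\<bar>) \<le> (\<Prod>b\<in>Y - {y}. 4 * real m)"
      proof (rule prod_mono, intro conjI)
        fix b assume b: "b \<in> Y - {y}"
        have "\<bar>real x - real b\<bar> \<le> 4 * real m * q" "q \<le> \<bar>real y - real b\<bar>"
          using b dst sep[of y b] y by auto
        moreover have "4 * real m * q \<le> 4 * real m * \<bar>real y - real b\<bar>"
          using calculation by (intro mult_left_mono) auto
        ultimately show "\<bar>real x - real b\<bar> / \<bar>real y - real b\<bar> \<le> 4 * real m"
          using Y by (simp add: divide_simps)
      qed auto
      also have "\<dots> = (4 * real m) ^ (m - 1)" using Y y by simp
      finally show "(\<Prod>b\<in>Y - {y}. \<bar>real x - real b\<bar> / \<bar>real y - real b\<bar>) \<le> (4 * real m) ^ (m - 1)" .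
    qed (use V[OF y] in auto)
    finally show "P * (v y / ((\<Prod>b\<in>Y - {y}. real y - real b) * (real y - real x))) \<le> (4 * real m) ^ (m - 1) * V" .
  qed
  finally show ?thesis using Y by (simp add: s_def algebra_simps)
qed

section \<open>Local bounds for sequences with a signed difference\<close>

text \<open>The smallest square is at most the mean. Nodes picked in this way turn control of the
  norm into control of values, at the price of not knowing where in its cell a node lies.\<close>

lemma exists_small_value:
  fixes v :: "nat \<Rightarrow> real"
  assumes "a \<le> b" "real q \<le> real (b - a) + 1"
  shows "\<exists>y\<in>{a..b}. real q * (v y)\<^sup>2 \<le> (\<Sum>i=a..b. (v i)\<^sup>2)"
proof -
  define y where "y = arg_min_on (\<lambda>i. (v i)\<^sup>2) {a..b}"
  have y: "y \<in> {a..b}" "\<And>i. i \<in> {a..b} \<Longrightarrow> (v y)\<^sup>2 \<le> (v i)\<^sup>2"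
    unfolding y_def using assms(1) arg_min_if_finite(1)[of "{a..b}" "\<lambda>i. (v i)\<^sup>2"]
    by (auto intro!: arg_min_least)
  have "real (card {a..b}) * (v y)\<^sup>2 \<le> (\<Sum>i=a..b. (v i)\<^sup>2)"
    using sum_bounded_below[of "{a..b}" "(v y)\<^sup>2" "\<lambda>i. (v i)\<^sup>2"] y by simp
  moreover have "real q * (v y)\<^sup>2 \<le> real (card {a..b}) * (v y)\<^sup>2"
    using assms by (intro mult_right_mono) (auto simp: of_nat_diff)
  ultimately show ?thesis using y by force
qed

text \<open>The first summand comes from interpolation, with \<open>r <= 8 m q\<close> and the
  square of the interpolation constant; the second covers windows too short for interpolation, where
  the length is at most \<open>4 m\<close> and a single value is bounded by the norm.\<close>

definition Cloc :: "nat \<Rightarrow> real" where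
  "Cloc m = 8 * real m * (real m * (4 * real m) ^ (m - 1))\<^sup>2 + 4 * real m"

lemma Cloc_nonneg: "Cloc m \<ge> 0" by (simp add: Cloc_def)

text \<open>\<open>interpolation_bound\<close> with the values controlled through their squares at
  scale \<open>q\<close>. The nodes are indexed, so that different subfamilies of one family can be
  inserted; \<open>local_max_bound\<close> does this to obtain both signs.\<close>

lemma separated_interpolation:
  fixes y :: "nat \<Rightarrow> nat"
  assumes S: "finite S" "card S = m" and q: "q \<ge> 1" and B: "B \<ge> 0"
    and sep: "\<And>s t. s \<in> S \<Longrightarrow> t \<in> S \<Longrightarrow> s < t \<Longrightarrow> real q \<le> \<bar>real (y s) - real (y t)\<bar>"
    and dst: "\<And>s. s \<in> S \<Longrightarrow> \<bar>real x - real (y s)\<bar> \<le> 4 * real m * real q"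
    and val: "\<And>s. s \<in> S \<Longrightarrow> real q * (v (y s))\<^sup>2 \<le> B"
    and x: "x \<notin> y ` S" and hull: "\<And>z. z \<in> insert x (y ` S) \<Longrightarrow> lo \<le> z \<and> z \<le> hi"
    and pos: "\<And>i. lo \<le> i \<Longrightarrow> i + m \<le> hi \<Longrightarrow> fd m v i \<ge> 0"
  shows "(-1) ^ card {z\<in>y ` S. z > x} * v x \<ge> - (real m * (4 * real m) ^ (m - 1) * sqrt (B / real q))"
proof (rule interpolation_bound[OF _ _ x, where q = "real q" and lo = lo and hi = hi])
  have "inj_on y S"
  proof (rule linorder_inj_onI')
    fix s t assume "s \<in> S" "t \<in> S" "s < t"
    then show "y s \<noteq> y t" using sep[of s t] q by auto
  qed
  then show "card (y ` S) = m" using S(2) by (simp add: card_image)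
next
  fix a assume "a \<in> y ` S"
  then obtain s where s: "s \<in> S" "a = y s" by auto
  show "\<bar>real x - real a\<bar> \<le> 4 * real m * real q" using dst s by simp
  have "(v a)\<^sup>2 \<le> B / real q" using val[OF s(1)] q s(2) by (simp add: field_simps)
  then show "\<bar>v a\<bar> \<le> sqrt (B / real q)" by (metis real_sqrt_abs real_sqrt_le_iff)
  fix b assume "b \<in> y ` S" "a \<noteq> b"
  then obtain t where "t \<in> S" "b = y t" by auto
  then show "real q \<le> \<bar>real a - real b\<bar>" using sep[of s t] sep[of t s] s \<open>a \<noteq> b\<close>
    by (cases "s < t"; cases "t < s") auto
qed (use S q hull pos in auto)

lemma Cloc_bound:
  assumes q: "q \<ge> 1" and B: "B \<ge> 0" and c: "\<bar>u\<bar> \<le> real m * (4 * real m) ^ (m - 1) * sqrt (B / real q)"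
    and r: "real r \<le> 8 * real m * real q"
  shows "real r * u\<^sup>2 \<le> Cloc m * B"
proof -
  have "u\<^sup>2 \<le> (real m * (4 * real m) ^ (m - 1) * sqrt (B / real q))\<^sup>2"
    using c by (metis abs_ge_zero power2_abs power_mono)
  also have "\<dots> = (real m * (4 * real m) ^ (m - 1))\<^sup>2 * (B / real q)"
    using B by (simp add: power_mult_distrib)
  finally have "real q * u\<^sup>2 \<le> (real m * (4 * real m) ^ (m - 1))\<^sup>2 * B"
    using q by (simp add: field_simps)
  then have 1: "(8 * real m) * (real q * u\<^sup>2) \<le> (8 * real m) * ((real m * (4 * real m) ^ (m - 1))\<^sup>2 * B)"
    by (rule mult_left_mono) simp
  have "real r * u\<^sup>2 \<le> (8 * real m * real q) * u\<^sup>2" using r by (intro mult_right_mono) auto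
  also have "\<dots> \<le> 8 * real m * (real m * (4 * real m) ^ (m - 1))\<^sup>2 * B" using 1 by (simp add: mult.assoc)
  also have "\<dots> \<le> Cloc m * B" using B unfolding Cloc_def by (intro mult_right_mono) auto
  finally show ?thesis .
qed

text \<open>One sign condition yields both bounds on \<open>v x\<close> because the parity of the
  nodes to the right can be chosen. Of \<open>m + 1\<close> candidate nodes, \<open>y 0\<close> lies
  to the right of \<open>x\<close> and the others to the left. The \<open>m\<close> left nodes bound
  \<open>v x\<close> from below; replacing \<open>y m\<close> by \<open>y 0\<close> leaves exactly
  one node to the right and bounds \<open>v x\<close> from above. This is why there must be room on
  both sides.\<close>

lemma local_max_bound:
  fixes v :: "nat \<Rightarrow> real"
  assumes m: "m \<ge> 1" and r: "r \<le> x"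
    and pos: "\<And>i. x - r \<le> i \<Longrightarrow> i + m \<le> x + r \<Longrightarrow> fd m v i \<ge> 0"
  shows "real r * (v x)\<^sup>2 \<le> Cloc m * (\<Sum>i=x - r..x + r. (v i)\<^sup>2)"
proof -
  define B where "B = (\<Sum>i=x - r..x + r. (v i)\<^sup>2)"
  \<comment> \<open>Cells of length \<open>q\<close> separated by gaps of length at least
    \<open>q\<close>: \<open>m\<close> of them to the left of \<open>x\<close> use
    \<open>2 m q <= r\<close>. The value 0 means \<open>r < 2 m\<close>.\<close>
  define q where "q = r div (2 * m)"
  have B0: "B \<ge> 0" unfolding B_def by (intro sum_nonneg) auto
  have qr: "2 * m * q \<le> r" unfolding q_def by simp
  have rq: "r < 2 * m * q + 2 * m"
  proof -
    have "r = 2 * m * q + r mod (2*m)" by (simp add: q_def)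
    moreover have "r mod (2*m) < 2 * m" using m by simp
    ultimately show ?thesis by linarith
  qed
  show ?thesis
  proof (cases "q = 0")
    case True
    have "(v x)\<^sup>2 \<le> B" unfolding B_def by (intro member_le_sum) auto
    moreover have "real r \<le> 4 * real m" using rq True by simp
    ultimately have "real r * (v x)\<^sup>2 \<le> 4 * real m * B" by (intro mult_mono) auto
    also have "\<dots> \<le> Cloc m * B" using B0 unfolding Cloc_def by (intro mult_right_mono) auto
    finally show ?thesis unfolding B_def .
  next
    case False
    then have q: "q \<ge> 1" by simp
    have cell: "\<exists>y\<in>{a..a+q}. real q * (v y)\<^sup>2 \<le> B" if "x - r \<le> a" "a + q \<le> x + r" for a
    proof -
      obtain y where "y \<in> {a..a+q}" "real q * (v y)\<^sup>2 \<le> (\<Sum>i=a..a+q. (v i)\<^sup>2)"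
        using exists_small_value[of a "a+q" q v] by auto
      moreover have "(\<Sum>i=a..a+q. (v i)\<^sup>2) \<le> B" unfolding B_def
        using that by (intro sum_mono2) auto
      ultimately show ?thesis by force
    qed
    have msq: "2 * s * q \<le> r" if "s \<le> m" for s
    proof -
      have "2 * s * q \<le> 2 * m * q" using that by (intro mult_right_mono mult_left_mono) auto
      then show ?thesis using qr by linarith
    qed
    have "q + q \<le> r" using msq[of 1] m by simp
    then have "\<exists>y\<in>{x - 2 * s * q..x - 2 * s * q+q}. real q * (v y)\<^sup>2 \<le> B" if "s \<in> {1..m}" for s
      using msq[of s] that q r by (intro cell) auto
    then obtain yl where yl: "\<And>s. s \<in> {1..m} \<Longrightarrow> yl s \<in> {x - 2 * s * q..x - 2 * s * q+q}"
      "\<And>s. s \<in> {1..m} \<Longrightarrow> real q * (v (yl s))\<^sup>2 \<le> B"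
      by metis
    have "q + q \<le> r" using msq[of 1] m by simp
    then have "x - r \<le> x + q" "x + q + q \<le> x + r" by linarith+
    from cell[OF this] obtain y0 where y0: "y0 \<in> {x+q..x+q+q}" "real q * (v y0)\<^sup>2 \<le> B"
      by blast
    define y where "y s = (if s = 0 then y0 else yl s)" for s
    have yv: "real q * (v (y s))\<^sup>2 \<le> B" if "s \<le> m" for s
      using that y0 yl by (auto simp: y_def)
    have yp: "real (y s) \<ge> real x - 2 * real s * real q" "real (y s) \<le> real x - 2 * real s * real q + real q"
      if "s \<in> {1..m}" for s
    proof -
      have "real (x - 2 * s * q) = real x - 2 * real s * real q"
        using msq[of s] that r by (subst of_nat_diff) auto
      moreover have "x - 2 * s * q \<le> y s" "y s \<le> x - 2 * s * q+q" using yl(1)[OF that] that by (auto simp: y_def)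
      ultimately show "real (y s) \<ge> real x - 2 * real s * real q" "real (y s) \<le> real x - 2 * real s * real q + real q"
        by (metis of_nat_le_iff, metis of_nat_add of_nat_le_iff)
    qed
    have yp0: "real (y 0) \<ge> real x + real q" "real (y 0) \<le> real x + 2 * real q"
      using y0 by (auto simp: y_def)
    have sep: "real q \<le> real (y s) - real (y t)" if "s < t" "t \<le> m" for s t
    proof (cases "s = 0")
      case True
      have "2 * real t * real q \<ge> 2 * 1 * real q" using that by (intro mult_right_mono mult_left_mono) auto
      then show ?thesis using yp(2)[of t] yp0 that True by auto
    next
      case False
      have "2 * real t * real q \<ge> 2 * (real s + 1) * real q" using that by (intro mult_right_mono mult_left_mono) auto
      then show ?thesis using yp(2)[of t] yp(1)[of s] that False by (auto simp: algebra_simps)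
    qed
    have left: "y s < x" if "s \<in> {1..m}" for s
    proof -
      have "2 * real s * real q \<ge> 2 * 1 * real q" using that by (intro mult_right_mono mult_left_mono) auto
      moreover have "real q \<ge> 1" using q by simp
      ultimately have "real (y s) < real x" using yp(2)[OF that] by linarith
      then show ?thesis by simp
    qed
    have right: "y 0 > x" using yp0 q by simp
    have dst: "\<bar>real x - real (y s)\<bar> \<le> 2 * real m * real q" if "s \<le> m" for s
    proof (cases "s = 0")
      case True
      have "2 * 1 * real q \<le> 2 * real m * real q" using m by (intro mult_right_mono mult_left_mono) auto
      then show ?thesis using True yp0 by auto
    next
      case False
      have "2 * real s * real q \<le> 2 * real m * real q" using that by (intro mult_right_mono mult_left_mono) auto
      then show ?thesis using yp(1)[of s] left[of s] that False by auto
    qed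
    have hull: "x - r \<le> z \<and> z \<le> x + r" if zS: "z \<in> insert x (y ` S)" "S \<subseteq> {0..m}" for z S
    proof (cases "z = x")
      case False
      then obtain s where s: "s \<le> m" "z = y s" using zS by auto
      have "\<bar>real x - real z\<bar> \<le> real r" using dst[OF s(1)] qr s(2)
        by (metis (no_types, lifting) of_nat_le_iff of_nat_mult of_nat_numeral order_trans)
      then show ?thesis by linarith
    qed auto
    define K where "K = real m * (4 * real m) ^ (m - 1) * sqrt (B / real q)"
    have main: "(-1) ^ card {z\<in>y ` S. z > x} * v x \<ge> - K" if S: "S \<subseteq> {0..m}" "card S = m" for S
      unfolding K_def
    proof (rule separated_interpolation[OF finite_subset[OF S(1)] S(2) q B0, where lo = "x - r" and hi = "x + r"])
      show "x \<notin> y ` S"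
      proof
        assume "x \<in> y ` S"
        then obtain s where "s \<le> m" "x = y s" using S by auto
        then show False using left[of s] right by (cases "s = 0") auto
      qed
    next
      fix s assume "s \<in> S"
      then have sm: "s \<le> m" using S by auto
      have "2 * real m * real q \<le> 4 * real m * real q" by (intro mult_right_mono) auto
      then show "\<bar>real x - real (y s)\<bar> \<le> 4 * real m * real q" using dst[OF sm] by simp
      show "real q * (v (y s))\<^sup>2 \<le> B" by (rule yv[OF sm])
      fix t assume "t \<in> S" "s < t"
      then show "real q \<le> \<bar>real (y s) - real (y t)\<bar>" using sep[of s t] S by auto
    next
      fix i assume "x - r \<le> i" "i + m \<le> x + r" then show "fd m v i \<ge> 0" by (rule pos)
    qed (use hull[OF _ S(1)] in auto)
    have e1: "{z\<in>y ` {1..m}. z > x} = {}" using left by force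
    have e2: "{z\<in>y ` {0..<m}. z > x} = {y 0}"
    proof -
      have "z = y 0" if zS: "z \<in> y ` {0..<m}" "z > x" for z
      proof -
        obtain s where "s < m" "z = y s" using zS by auto
        then show ?thesis using left[of s] that by (cases "s = 0") auto
      qed
      then show ?thesis using right m by force
    qed
    have "(-1) ^ card {z\<in>y ` {1..m}. z > x} * v x \<ge> - K" by (rule main) auto
    then have "v x \<ge> - K" unfolding e1 by simp
    moreover have "(-1) ^ card {z\<in>y ` {0..<m}. z > x} * v x \<ge> - K" by (rule main) auto
    then have "- v x \<ge> - K" unfolding e2 by simp
    ultimately have vx: "\<bar>v x\<bar> \<le> K" by linarith
    have "2 * m * 1 \<le> 2 * m * q" using q by (intro mult_left_mono) auto
    then have "r \<le> 8 * m * q" using rq by linarith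
    then have "real r \<le> 8 * real m * real q" by (metis of_nat_le_iff of_nat_mult of_nat_numeral)
    then show ?thesis unfolding B_def[symmetric] by (rule Cloc_bound[OF q B0 vx[unfolded K_def]])
  qed
qed

text \<open>With vanishing differences the sign argument applies to \<open>v\<close> and to
  \<open>- v\<close>, so any parity serves: the nodes are spread over the whole interval wherever
  \<open>x\<close> lies, and nothing outside the interval enters.\<close>

lemma polynomial_max_bound:
  fixes v :: "nat \<Rightarrow> real"
  assumes m: "m \<ge> 1" and x: "x \<in> {a..<a+N}"
    and zero: "\<And>i. a \<le> i \<Longrightarrow> i + m < a + N \<Longrightarrow> fd m v i = 0"
  shows "real N * (v x)\<^sup>2 \<le> Cloc m * (\<Sum>i=a..<a+N. (v i)\<^sup>2)"
proof -
  define B where "B = (\<Sum>i=a..<a+N. (v i)\<^sup>2)"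
  define q where "q = (N - 1) div (2 * m)"
  have B0: "B \<ge> 0" unfolding B_def by (intro sum_nonneg) auto
  have N: "N \<ge> 1" using x by auto
  have qr: "2 * m * q \<le> N - 1" unfolding q_def by simp
  have rq: "N - 1 < 2 * m * q + 2 * m"
  proof -
    have "N - 1 = 2 * m * q + (N - 1) mod (2*m)" by (simp add: q_def)
    moreover have "(N - 1) mod (2*m) < 2 * m" using m by simp
    ultimately show ?thesis by linarith
  qed
  show ?thesis
  proof (cases "q = 0")
    case True
    have "(v x)\<^sup>2 \<le> B" unfolding B_def using x by (intro member_le_sum) auto
    moreover have "real N \<le> 4 * real m" using rq True m by simp
    ultimately have "real N * (v x)\<^sup>2 \<le> 4 * real m * B" by (intro mult_mono) auto
    also have "\<dots> \<le> Cloc m * B" using B0 unfolding Cloc_def by (intro mult_right_mono) auto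
    finally show ?thesis unfolding B_def .
  next
    case False
    then have q: "q \<ge> 1" by simp
    have msq: "2 * s * q + 2 * q \<le> N - 1" if "s < m" for s
    proof -
      have "2 * (s + 1) * q \<le> 2 * m * q" using that by (intro mult_right_mono mult_left_mono) auto
      then show ?thesis using qr by (simp add: algebra_simps)
    qed
    have "\<exists>y\<in>{a + 2 * s * q..a + 2 * s * q+q}. real q * (v y)\<^sup>2 \<le> B" if "s < m" for s
    proof -
      obtain y where "y \<in> {a + 2 * s * q..a + 2 * s * q+q}" "real q * (v y)\<^sup>2 \<le> (\<Sum>i=a + 2 * s * q..a + 2 * s * q+q. (v i)\<^sup>2)"
        using exists_small_value[of "a + 2 * s * q" "a + 2 * s * q+q" q v] by auto
      moreover have "(\<Sum>i=a + 2 * s * q..a + 2 * s * q+q. (v i)\<^sup>2) \<le> B" unfolding B_def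
      proof (rule sum_mono2)
        show "{a + 2 * s * q..a + 2 * s * q+q} \<subseteq> {a..<a+N}" using msq[OF that] q N by auto
      qed auto
      ultimately show ?thesis by force
    qed
    then obtain y where y: "\<And>s. s < m \<Longrightarrow> y s \<in> {a + 2 * s * q..a + 2 * s * q+q}"
      "\<And>s. s < m \<Longrightarrow> real q * (v (y s))\<^sup>2 \<le> B"
      by metis
    have yI: "y s \<in> {a..<a+N}" if "s < m" for s using y(1)[OF that] msq[OF that] q N by auto
    have sep: "real q \<le> real (y t) - real (y s)" if "s < t" "t < m" for s t
    proof -
      have "2 * t * q \<ge> 2 * (s + 1) * q" using that by (intro mult_right_mono mult_left_mono) auto
      then have "y t \<ge> y s + q" using y(1)[of t] y(1)[of s] that by (auto simp: algebra_simps)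
      then show ?thesis by linarith
    qed
    define K where "K = real m * (4 * real m) ^ (m - 1) * sqrt (B / real q)"
    have NN: "N - 1 \<le> 4 * m * q"
    proof -
      have "2 * m * 1 \<le> 2 * m * q" using q by (intro mult_left_mono) auto
      then show ?thesis using rq by linarith
    qed
    then have NR: "real N - 1 \<le> 4 * real m * real q"
      by (metis (no_types, opaque_lifting) N of_nat_1 of_nat_diff of_nat_le_iff of_nat_mult of_nat_numeral)
    have "\<bar>v x\<bar> \<le> K"
    \<comment> \<open>A point that is itself a node has a small value by choice; interpolation is
      for points off the nodes.\<close>
    proof (cases "x \<in> y ` {0..<m}")
      case True
      then have "(v x)\<^sup>2 \<le> B / real q" using y(2) q by (auto simp: field_simps)
      then have "\<bar>v x\<bar> \<le> 1 * 1 * sqrt (B / real q)" by (metis mult_1 real_sqrt_abs real_sqrt_le_iff)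
      also have "\<dots> \<le> K" unfolding K_def
      proof (intro mult_mono)
        show "1 \<le> (4 * real m) ^ (m - 1)" using m by (intro one_le_power) simp
      qed (use m B0 in simp_all)
      finally show ?thesis .
    next
      case False
      have main: "(-1) ^ card {z\<in>y ` {0..<m}. z > x} * w x \<ge> - K"
        if w: "\<And>i. \<bar>w i\<bar> = \<bar>v i\<bar>" "\<And>i. a \<le> i \<Longrightarrow> i + m \<le> a + N - 1 \<Longrightarrow> fd m w i \<ge> 0" for w
        unfolding K_def
      proof (rule separated_interpolation[OF _ _ q B0, where lo = a and hi = "a + N - 1"])
        fix s assume s: "s \<in> {0..<m}"
        then have "\<bar>real x - real (y s)\<bar> \<le> real N - 1" using yI[of s] x N by auto
        then show "\<bar>real x - real (y s)\<bar> \<le> 4 * real m * real q" using NR by simp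
        have "(w (y s))\<^sup>2 = (v (y s))\<^sup>2" using w(1)[of "y s"] by (metis power2_abs)
        then show "real q * (w (y s))\<^sup>2 \<le> B" using y(2)[of s] s by simp
        fix t assume "t \<in> {0..<m}" "s < t"
        then show "real q \<le> \<bar>real (y s) - real (y t)\<bar>" using sep[of s t] by auto
      next
        fix z assume "z \<in> insert x (y ` {0..<m})"
        then show "a \<le> z \<and> z \<le> a + N - 1" using yI x N by fastforce
      qed (use False w in auto)
      have 1: "(-1) ^ card {z\<in>y ` {0..<m}. z > x} * v x \<ge> - K"
        using N zero by (intro main) auto
      have 2: "(-1) ^ card {z\<in>y ` {0..<m}. z > x} * (- v x) \<ge> - K"
        using N zero by (intro main[of "\<lambda>i. - v i"]) (auto simp: fd_uminus)
      show ?thesis using 1 2 by (cases "even (card {z\<in>y ` {0..<m}. z > x})") auto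
    qed
    moreover have "1 * 1 \<le> real m * real q" using m q by (intro mult_mono) auto
    then have "real N \<le> 8 * real m * real q" using NR by linarith
    ultimately show ?thesis unfolding B_def[symmetric] K_def by (rule Cloc_bound[OF q B0])
  qed
qed

section \<open>Sign changes, summation by parts and dyadic prefix sums\<close>

text \<open>\<open>psign N a b w\<close>: \<open>w\<close> changes sign fewer than \<open>2 ^ N\<close> times on \<open>{a..<b}\<close>.\<close>

primrec psign :: "nat \<Rightarrow> nat \<Rightarrow> nat \<Rightarrow> (nat \<Rightarrow> real) \<Rightarrow> bool" where
  "psign 0 a b w \<longleftrightarrow> (\<forall>i\<in>{a..<b}. w i \<ge> 0) \<or> (\<forall>i\<in>{a..<b}. w i \<le> 0)"
| "psign (Suc N) a b w \<longleftrightarrow> (\<exists>c. a \<le> c \<and> c \<le> b \<and> psign N a c w \<and> psign N c b w)"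

lemma psign_restrict:
  "psign N a b w \<Longrightarrow> a \<le> a' \<Longrightarrow> a' \<le> b' \<Longrightarrow> b' \<le> b \<Longrightarrow> psign N a' b' w"
proof (induction N arbitrary: a b a' b')
  case 0
  then show ?case by auto
next
  case (Suc N)
  then obtain c where c: "a \<le> c" "c \<le> b" "psign N a c w" "psign N c b w" by auto
  \<comment> \<open>The old cut, clamped to the smaller interval.\<close>
  define c' where "c' = max a' (min b' c)"
  have c': "a' \<le> c'" "c' \<le> b'" using Suc.prems by (auto simp: c'_def)
  have "psign N a' c' w"
  proof (cases "a' \<le> c")
    case True then show ?thesis using Suc.IH[OF c(3), of a' c'] Suc.prems c' by (auto simp: c'_def)
  next
    case False
    then have "c' = a'" using Suc.prems by (auto simp: c'_def)
    then show ?thesis using Suc.IH[OF c(4), of a' a'] Suc.prems False by auto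
  qed
  moreover have "psign N c' b' w"
  proof (cases "c \<le> b'")
    case True then show ?thesis using Suc.IH[OF c(4), of c' b'] Suc.prems c' by (auto simp: c'_def)
  next
    case False
    then have "c' = b'" using Suc.prems by (auto simp: c'_def)
    then show ?thesis using Suc.IH[OF c(3), of b' b'] Suc.prems False by auto
  qed
  ultimately show ?case using c' by auto
qed

lemma psign_empty: "psign N a a w"
  by (induction N) auto

lemma psign_uminus: "psign N a b (\<lambda>i. - w i) \<longleftrightarrow> psign N a b w"
  by (induction N arbitrary: a b) auto

text \<open>A nondecreasing sequence is nonpositive before its first nonnegative entry and
  nonnegative from there on, hence one cut. Increments on \<open>a..<b\<close> govern the values on
  \<open>a..b\<close>, which explains the right end \<open>Suc b\<close>.\<close>

lemma psign_monotone:
  assumes "a \<le> b" "\<And>i. a \<le> i \<Longrightarrow> i < b \<Longrightarrow> w (Suc i) - w i \<ge> 0"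
  shows "psign (Suc 0) a (Suc b) w"
proof -
  have mono: "w i \<le> w j" if "a \<le> i" "i \<le> j" "j \<le> b" for i j
    using that(2,1,3)
  proof (induction j rule: dec_induct)
    case (step k) then show ?case using assms(2)[of k] by simp
  qed simp
  define c where "c = (if \<exists>i. a \<le> i \<and> i \<le> b \<and> w i \<ge> 0 then (LEAST i. a \<le> i \<and> i \<le> b \<and> w i \<ge> 0) else Suc b)"
  show ?thesis
  proof (cases "\<exists>i. a \<le> i \<and> i \<le> b \<and> w i \<ge> 0")
    case True
    then obtain i0 where "a \<le> i0 \<and> i0 \<le> b \<and> w i0 \<ge> 0" by blast
    from LeastI[of "\<lambda>i. a \<le> i \<and> i \<le> b \<and> w i \<ge> 0", OF this]
    have c: "a \<le> c" "c \<le> b" "w c \<ge> 0" using True by (auto simp: c_def)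
    have "w i \<le> 0" if "a \<le> i" "i < c" for i
    proof (rule ccontr)
      assume "\<not> w i \<le> 0"
      then have "a \<le> i \<and> i \<le> b \<and> w i \<ge> 0" using that c by auto
      then have "c \<le> i" using True unfolding c_def by (simp add: Least_le)
      then show False using that by simp
    qed
    moreover have "w i \<ge> 0" if "c \<le> i" "i < Suc b" for i
      using mono[of c i] c that by auto
    ultimately show ?thesis using c by (intro psign.simps(2)[THEN iffD2] exI[of _ c]) auto
  next
    case False
    then have "\<forall>i\<in>{a..<Suc b}. w i \<le> 0" by (meson atLeastLessThan_iff less_Suc_eq_le linear)
    then have "psign 0 a (Suc b) w" "psign 0 (Suc b) (Suc b) w" by auto
    then show ?thesis using assms(1) by (intro psign.simps(2)[THEN iffD2] exI[of _ "Suc b"]) (simp only: le_Suc_eq, simp)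
  qed
qed

text \<open>Where the increments keep their sign the sequence is monotone and one cut suffices, so
  every summation doubles the number of pieces: a discrete form of Rolle's theorem.\<close>

lemma psign_integrate:
  "a \<le> b \<Longrightarrow> psign N a b (\<lambda>i. w (Suc i) - w i) \<Longrightarrow> psign (Suc N) a (Suc b) w"
proof (induction N arbitrary: a b)
  case 0
  then consider "\<forall>i\<in>{a..<b}. w (Suc i) - w i \<ge> 0" | "\<forall>i\<in>{a..<b}. w (Suc i) - w i \<le> 0" by auto
  then show ?case
  proof cases
    case 1 then show ?thesis using 0 by (intro psign_monotone) auto
  next
    case 2
    then have "psign (Suc 0) a (Suc b) (\<lambda>i. - w i)" using 0 by (intro psign_monotone) auto
    then show ?thesis by (simp only: psign_uminus)
  qed
next
  case (Suc N)
  then obtain c where c: "a \<le> c" "c \<le> b" "psign N a c (\<lambda>i. w (Suc i) - w i)" "psign N c b (\<lambda>i. w (Suc i) - w i)" by auto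
  have "psign (Suc N) a c w" using Suc.IH[OF c(1,3)] by (rule psign_restrict) (use c in auto)
  moreover have "psign (Suc N) c (Suc b) w" using Suc.IH[OF c(2,4)] .
  ultimately show ?case using c by (subst psign.simps(2)) (intro exI[of _ c], auto)
qed

lemma psign_fd:
  assumes "a \<le> Suc b" "\<And>i. a \<le> i \<Longrightarrow> i + m \<le> b \<Longrightarrow> fd m w i \<ge> 0"
  shows "psign m a (Suc b) w"
  using assms
proof (induction m arbitrary: w b)
  case 0
  then show ?case by auto
next
  case (Suc m)
  show ?case
  proof (cases "a \<le> b")
    case True
    have "psign m a b (\<lambda>i. w (Suc i) - w i)"
    proof (cases "a = b")
      case True
      show ?thesis unfolding True by (rule psign_empty)
    next
      case False
      then obtain b' where b: "b = Suc b'" "a \<le> Suc b'" using \<open>a \<le> b\<close> by (cases b) auto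
      have "psign m a (Suc b') (\<lambda>i. w (Suc i) - w i)"
      proof (rule Suc.IH[OF b(2)])
        fix i assume "a \<le> i" "i + m \<le> b'"
        then have "fd (Suc m) w i \<ge> 0" using b by (intro Suc.prems(2)) auto
        then show "fd m (\<lambda>i. w (Suc i) - w i) i \<ge> 0" by (simp only: fd_Suc_shift)
      qed
      then show ?thesis using b by simp
    qed
    then show ?thesis by (rule psign_integrate[OF True])
  next
    case False
    then have "a = Suc b" using Suc.prems by simp
    then show ?thesis by (simp only: psign_empty)
  qed
qed

section \<open>Total variation, partial summation and dyadic prefixes\<close>

lemma psign_total_variation:
  assumes "psign N a b (\<lambda>i. v (Suc i) - v i)" "a \<le> b" "\<And>i. a \<le> i \<Longrightarrow> i \<le> b \<Longrightarrow> \<bar>v i\<bar> \<le> V"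
  shows "(\<Sum>i=a..<b. \<bar>v (Suc i) - v i\<bar>) \<le> 2 ^ N * (2 * V)"
  using assms
proof (induction N arbitrary: a b)
  case 0
  have tel: "(\<Sum>i=a..<b. v (Suc i) - v i) = v b - v a"
    using 0 by (simp add: sum_Suc_diff')
  have "(\<Sum>i=a..<b. \<bar>v (Suc i) - v i\<bar>) = \<bar>v b - v a\<bar>"
  proof -
    from 0 consider "\<forall>i\<in>{a..<b}. v (Suc i) - v i \<ge> 0" | "\<forall>i\<in>{a..<b}. v (Suc i) - v i \<le> 0" by auto
    then show ?thesis
    proof cases
      case 1
      then have "(\<Sum>i=a..<b. \<bar>v (Suc i) - v i\<bar>) = (\<Sum>i=a..<b. v (Suc i) - v i)"
        by (intro sum.cong) auto
      moreover have "(\<Sum>i=a..<b. v (Suc i) - v i) \<ge> 0" using 1 by (intro sum_nonneg) auto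
      ultimately show ?thesis using tel by simp
    next
      case 2
      then have "(\<Sum>i=a..<b. \<bar>v (Suc i) - v i\<bar>) = (\<Sum>i=a..<b. - (v (Suc i) - v i))"
        by (intro sum.cong) auto
      also have "\<dots> = - (v b - v a)" unfolding sum_negf tel ..
      finally have e: "(\<Sum>i=a..<b. \<bar>v (Suc i) - v i\<bar>) = - (v b - v a)" .
      have "(\<Sum>i=a..<b. \<bar>v (Suc i) - v i\<bar>) \<ge> 0" by (intro sum_nonneg) auto
      then show ?thesis using e by linarith
    qed
  qed
  also have "\<dots> \<le> 2 * V" using 0(3)[of a] 0(3)[of b] 0(2) by linarith
  finally show ?case by simp
next
  case (Suc N)
  then obtain c where c: "a \<le> c" "c \<le> b" "psign N a c (\<lambda>i. v (Suc i) - v i)" "psign N c b (\<lambda>i. v (Suc i) - v i)" by auto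
  have "(\<Sum>i=a..<b. \<bar>v (Suc i) - v i\<bar>) = (\<Sum>i=a..<c. \<bar>v (Suc i) - v i\<bar>) + (\<Sum>i=c..<b. \<bar>v (Suc i) - v i\<bar>)"
    using c by (simp add: sum.atLeastLessThan_concat)
  also have "\<dots> \<le> 2 ^ N * (2 * V) + 2 ^ N * (2 * V)"
  proof (intro add_mono)
    show "(\<Sum>i=a..<c. \<bar>v (Suc i) - v i\<bar>) \<le> 2 ^ N * (2 * V)"
      using c Suc.prems(3) by (intro Suc.IH) auto
    show "(\<Sum>i=c..<b. \<bar>v (Suc i) - v i\<bar>) \<le> 2 ^ N * (2 * V)"
      using c Suc.prems(3) by (intro Suc.IH) auto
  qed
  finally show ?case by (simp add: algebra_simps)
qed

lemma summation_by_parts: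
  fixes x v :: "nat \<Rightarrow> real"
  shows "(\<Sum>i<Suc N. x i * v i) = (\<Sum>i<Suc N. x i) * v N - (\<Sum>t<N. (\<Sum>i<Suc t. x i) * (v (Suc t) - v t))"
  by (induction N) (auto simp: algebra_simps)

text \<open>Partial summation leaves only partial sums of the noise. The boundary term costs
  \<open>M V\<close>. The increments of \<open>v\<close> have signed differences of order
  \<open>m - 1\<close>, hence at most \<open>2 ^ (m - 1)\<close> sign pieces, each of variation at
  most \<open>2 V\<close>; this gives the other \<open>2 ^ m M V\<close>.\<close>

lemma abel_bound:
  assumes m: "m \<ge> 1" and pos: "\<And>i. a \<le> i \<Longrightarrow> i + m < a + N \<Longrightarrow> fd m v i \<ge> 0"
    and V: "\<And>i. a \<le> i \<Longrightarrow> i < a + N \<Longrightarrow> \<bar>v i\<bar> \<le> V"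
    and M: "\<And>t. t \<le> N \<Longrightarrow> \<bar>\<Sum>i=a..<a+t. x i\<bar> \<le> M"
    and "N > 0"
  shows "\<bar>\<Sum>i=a..<a+N. x i * v i\<bar> \<le> (1 + 2 ^ m) * M * V"
proof -
  obtain N' where N: "N = Suc N'" using \<open>N > 0\<close> by (cases N) auto
  obtain m' where m': "m = Suc m'" using m by (cases m) auto
  have M0: "M \<ge> 0" using M[of 0] by simp
  define y w where "y i = x (a + i)" and "w i = v (a + i)" for i
  have sh: "(\<Sum>i=a..<a+t. f i) = (\<Sum>i<t. f (a + i))" for t and f :: "nat \<Rightarrow> real"
    by (rule sum.reindex_bij_witness[of _ "\<lambda>i. a + i" "\<lambda>i. i - a"]) auto
  have S: "\<bar>\<Sum>i<t. y i\<bar> \<le> M" if "t \<le> N" for t using M[OF that] by (simp add: sh y_def)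
  have "psign m' a (a + N') (\<lambda>i. v (Suc i) - v i)"
  proof (cases N')
    case 0
    then show ?thesis by (simp add: psign_empty)
  next
    case (Suc N'')
    have "psign m' a (Suc (a + N'')) (\<lambda>i. v (Suc i) - v i)"
    proof (rule psign_fd)
      fix i assume "a \<le> i" "i + m' \<le> a + N''"
      then show "0 \<le> fd m' (\<lambda>i. v (Suc i) - v i) i"
        using pos[of i] N m' Suc by (simp only: fd_Suc_shift[symmetric])
    qed simp
    then show ?thesis using Suc by simp
  qed
  then have "(\<Sum>i=a..<a+N'. \<bar>v (Suc i) - v i\<bar>) \<le> 2 ^ m' * (2 * V)"
    by (rule psign_total_variation) (use V N in auto)
  then have TV: "(\<Sum>i<N'. \<bar>w (Suc i) - w i\<bar>) \<le> 2 ^ m * V" by (simp add: sh w_def m' mult.assoc mult.commute)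
  have "\<bar>\<Sum>i=a..<a+N. x i * v i\<bar> = \<bar>\<Sum>i<Suc N'. y i * w i\<bar>" by (simp add: sh N y_def w_def)
  also have "\<dots> \<le> \<bar>(\<Sum>i<Suc N'. y i) * w N'\<bar> + \<bar>\<Sum>t<N'. (\<Sum>i<Suc t. y i) * (w (Suc t) - w t)\<bar>"
    unfolding summation_by_parts by (rule abs_triangle_ineq4)
  also have "\<bar>(\<Sum>i<Suc N'. y i) * w N'\<bar> \<le> M * V"
    unfolding abs_mult using S[of N] V[of "a + N'"] N M0 by (intro mult_mono) (auto simp: w_def)
  also have "\<bar>\<Sum>t<N'. (\<Sum>i<Suc t. y i) * (w (Suc t) - w t)\<bar> \<le> (\<Sum>t<N'. M * \<bar>w (Suc t) - w t\<bar>)"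
  proof (rule order_trans[OF sum_abs], rule sum_mono)
    fix t assume "t \<in> {..<N'}"
    then show "\<bar>(\<Sum>i<Suc t. y i) * (w (Suc t) - w t)\<bar> \<le> M * \<bar>w (Suc t) - w t\<bar>"
      unfolding abs_mult using S[of "Suc t"] N by (intro mult_right_mono) auto
  qed
  also have "\<dots> \<le> M * (2 ^ m * V)" unfolding sum_distrib_left[symmetric] using TV M0 by (rule mult_left_mono)
  finally show ?thesis by (simp add: algebra_simps)
qed

text \<open>The binary expansion of \<open>t\<close> writes the prefix as a union of dyadic blocks,
  at most one per level, so one bound per level suffices.\<close>

lemma dyadic_prefix_bound:
  fixes x :: "nat \<Rightarrow> real"
  assumes "t < 2 ^ r" "\<And>h j. h < r \<Longrightarrow> j < 2 ^ (r - h) \<Longrightarrow> \<bar>\<Sum>i=j * 2 ^ h..<Suc j * 2 ^ h. x i\<bar> \<le> Y h"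
  shows "\<bar>\<Sum>i<t. x i\<bar> \<le> (\<Sum>h<r. Y h)"
  using assms
proof (induction r arbitrary: t x)
  case 0
  then show ?case by simp
next
  case (Suc r)
  have Y: "0 \<le> Y r" using Suc.prems(2)[of r 0] by simp
  have le: "j < 2 ^ (Suc r - h)" if "j < 2 ^ (r - h)" for j h :: nat
  proof -
    have "(2::nat) ^ (r - h) \<le> 2 ^ (Suc r - h)" by (intro power_increasing) auto
    then show ?thesis using that by linarith
  qed
  show ?case
  proof (cases "t < 2 ^ r")
    case True
    have "\<bar>\<Sum>i<t. x i\<bar> \<le> (\<Sum>h<r. Y h)"
    proof (rule Suc.IH[OF True])
      fix h j :: nat assume "h < r" "j < 2 ^ (r - h)"
      then show "\<bar>\<Sum>i=j * 2 ^ h..<Suc j * 2 ^ h. x i\<bar> \<le> Y h"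
        using le[of j h] by (intro Suc.prems(2)) auto
    qed
    then show ?thesis using Y by simp
  next
    case False
    \<comment> \<open>Once the top block is removed, the remainder is a prefix of the sequence
      shifted by \<open>2 ^ r\<close>; block \<open>j\<close> at level \<open>h\<close> of the
      shifted sequence is block \<open>j + 2 ^ (r - h)\<close> of the original.\<close>
    define t' where "t' = t - 2 ^ r"
    have t: "t = 2 ^ r + t'" "t' < 2 ^ r" using False Suc.prems(1) by (auto simp: t'_def)
    have split: "(\<Sum>i<t. x i) = (\<Sum>i=0 * 2 ^ r..<Suc 0 * 2 ^ r. x i) + (\<Sum>i<t'. x (i + 2 ^ r))"
    proof -
      have "(\<Sum>i<t. x i) = (\<Sum>i=0..<2^r. x i) + (\<Sum>i=2^r..<2^r+t'. x i)"
        unfolding t(1) by (simp add: lessThan_atLeast0 sum.atLeastLessThan_concat)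
      also have "(\<Sum>i=2^r..<2^r+t'. x i) = (\<Sum>i<t'. x (i + 2 ^ r))"
        using sum.shift_bounds_nat_ivl[of x 0 "2^r" t'] by (simp add: lessThan_atLeast0 add.commute)
      finally show ?thesis by simp
    qed
    have "\<bar>\<Sum>i<t'. x (i + 2 ^ r)\<bar> \<le> (\<Sum>h<r. Y h)"
    proof (rule Suc.IH[OF t(2)])
      fix h j :: nat assume h: "h < r" and j: "j < 2 ^ (r - h)"
      have pw: "2 ^ r = 2 ^ (r - h) * (2 ^ h :: nat)" using h by (simp flip: power_add)
      have "(\<Sum>i=j * 2 ^ h..<Suc j * 2 ^ h. x (i + 2 ^ r)) =
         (\<Sum>i=(j + 2 ^ (r - h)) * 2 ^ h..<Suc (j + 2 ^ (r - h)) * 2 ^ h. x i)"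
        using sum.shift_bounds_nat_ivl[of x "j * 2 ^ h" "2 ^ r" "Suc j * 2 ^ h"]
        by (simp add: pw algebra_simps)
      moreover have "j + 2 ^ (r - h) < 2 ^ (Suc r - h)" using j h by (simp add: Suc_diff_le)
      ultimately show "\<bar>\<Sum>i=j * 2 ^ h..<Suc j * 2 ^ h. x (i + 2 ^ r)\<bar> \<le> Y h"
        using Suc.prems(2)[of h "j + 2 ^ (r - h)"] h by simp
    qed
    moreover have "\<bar>\<Sum>i=0 * 2 ^ r..<Suc 0 * 2 ^ r. x i\<bar> \<le> Y r"
      using Suc.prems(2)[of r 0] by simp
    ultimately show ?thesis unfolding split by simp
  qed
qed

section \<open>Whitney decomposition of a block\<close>

text \<open>A scan from left to right: each element of \<open>H\<close> becomes a singleton and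
  closes the run before it, so it contributes at most two pairs, and one last run may remain open.
  That \<open>R\<close> partitions the levels is expressed by the identity for all \<open>g\<close>,
  the form in which it is applied.\<close>

lemma runs_and_hits_decomposition:
  assumes "finite H"
  shows "\<exists>R. finite R \<and> card R \<le> 2 * card H + 1 \<and>
     (\<forall>(p,q)\<in>R. p < q \<and> q \<le> W \<and> (q = Suc p \<or> {p..<q} \<inter> H = {})) \<and>
     (\<forall>g :: nat \<Rightarrow> real. (\<Sum>t<W. g t) = (\<Sum>(p,q)\<in>R. \<Sum>t=p..<q. g t))"
proof -
  \<comment> \<open>\<open>p0\<close> is the start of the run that is still open; the pairs in
    \<open>R\<close> account for the levels below it.\<close>
  define Q where "Q W R p0 \<longleftrightarrow> p0 \<le> W \<and> finite R \<and> card R \<le> 2 * card (H \<inter> {..<W}) \<and> {p0..<W} \<inter> H = {} \<and>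
     (\<forall>(p,q)\<in>R. p < q \<and> q \<le> p0 \<and> (q = Suc p \<or> {p..<q} \<inter> H = {})) \<and>
     (\<forall>g :: nat \<Rightarrow> real. (\<Sum>t<p0. g t) = (\<Sum>(p,q)\<in>R. \<Sum>t=p..<q. g t))"
    for W :: nat and R :: "(nat \<times> nat) set" and p0 :: nat
  have QD: "p0 \<le> W" "finite R" "card R \<le> 2 * card (H \<inter> {..<W})" "{p0..<W} \<inter> H = {}"
      "\<And>p q. (p,q) \<in> R \<Longrightarrow> p < q \<and> q \<le> p0 \<and> (q = Suc p \<or> {p..<q} \<inter> H = {})"
      "\<And>g :: nat \<Rightarrow> real. (\<Sum>t<p0. g t) = (\<Sum>(p,q)\<in>R. \<Sum>t=p..<q. g t)"
    if "Q W R p0" for W R p0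
    using that unfolding Q_def by (blast, blast, blast, blast, force, metis)
  have "\<exists>R p0. Q W R p0"
  proof (induction W)
    case 0
    show ?case unfolding Q_def by (intro exI[of _ "{}"] exI[of _ 0]) auto
  next
    case (Suc W)
    then obtain R p0 where Q: "Q W R p0" by blast
    note R = QD[OF Q]
    show ?case
    proof (cases "W \<in> H")
      case False
      have "H \<inter> {..<Suc W} = H \<inter> {..<W}" using False by (auto simp: less_Suc_eq)
      moreover have "{p0..<Suc W} \<inter> H = {}" using R(4) False by (auto simp: less_Suc_eq)
      ultimately have "Q (Suc W) R p0" using Q unfolding Q_def by simp
      then show ?thesis by blast
    next
      case True
      have cH: "card (H \<inter> {..<Suc W}) = Suc (card (H \<inter> {..<W}))"
      proof -
        have "H \<inter> {..<Suc W} = insert W (H \<inter> {..<W})" using True by (auto simp: less_Suc_eq)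
        then show ?thesis by simp
      qed
      define P where "P = (if p0 < W then {(p0,W)} else {})"
      define R' where "R' = insert (W, Suc W) (R \<union> P)"
      have fP: "finite P" "card P \<le> 1" by (auto simp: P_def)
      have W: "(W, Suc W) \<notin> R \<union> P" using R(1) R(5)[of W "Suc W"] by (auto simp: P_def)
      have disj: "R \<inter> P = {}" using R(5)[of p0 W] by (auto simp: P_def)
      have "card R' = Suc (card R + card P)"
        unfolding R'_def using W R(2) fP disj by (simp add: card_Un_disjoint)
      then have "card R' \<le> 2 * card (H \<inter> {..<Suc W})" using R(3) fP(2) cH by simp
      moreover have "(\<Sum>t<Suc W. g t) = (\<Sum>(p,q)\<in>R'. \<Sum>t=p..<q. g t)" for g :: "nat \<Rightarrow> real"
      proof -
        have "(\<Sum>(p,q)\<in>R'. \<Sum>t=p..<q. g t) = g W + ((\<Sum>t<p0. g t) + (\<Sum>(p,q)\<in>P. \<Sum>t=p..<q. g t))"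
          unfolding R'_def using W R(2) fP disj by (simp add: sum.union_disjoint R(6))
        also have "(\<Sum>(p,q)\<in>P. \<Sum>t=p..<q. g t) = (\<Sum>t=p0..<W. g t)"
          using R(1) by (auto simp: P_def)
        also have "(\<Sum>t<p0. g t) + (\<Sum>t=p0..<W. g t) = (\<Sum>t<W. g t)"
          using R(1) by (simp add: lessThan_atLeast0 sum.atLeastLessThan_concat)
        finally show ?thesis by simp
      qed
      moreover have "\<forall>(p,q)\<in>R'. p < q \<and> q \<le> Suc W \<and> (q = Suc p \<or> {p..<q} \<inter> H = {})"
        using R(1,4) R(5) by (fastforce simp: R'_def P_def split: if_splits)
      moreover have "finite R'" using R(2) fP by (simp add: R'_def)
      ultimately have "Q (Suc W) R' (Suc W)" unfolding Q_def by simp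
      then show ?thesis by blast
    qed
  qed
  then obtain R p0 where Q: "Q W R p0" by blast
  note R = QD[OF Q]
  define P where "P = (if p0 < W then {(p0,W)} else {})"
  have fP: "finite P" "card P \<le> 1" by (auto simp: P_def)
  have disj: "R \<inter> P = {}" using R(5)[of p0 W] by (auto simp: P_def)
  have "card (H \<inter> {..<W}) \<le> card H" using assms by (intro card_mono) auto
  then have "card (R \<union> P) \<le> 2 * card H + 1" using card_Un_le[of R P] R(3) fP by linarith
  moreover have "(\<Sum>t<W. g t) = (\<Sum>(p,q)\<in>R \<union> P. \<Sum>t=p..<q. g t)" for g :: "nat \<Rightarrow> real"
  proof -
    have "(\<Sum>(p,q)\<in>R \<union> P. \<Sum>t=p..<q. g t) = (\<Sum>t<p0. g t) + (\<Sum>(p,q)\<in>P. \<Sum>t=p..<q. g t)"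
      using R(2) fP disj by (simp add: sum.union_disjoint R(6))
    also have "(\<Sum>(p,q)\<in>P. \<Sum>t=p..<q. g t) = (\<Sum>t=p0..<W. g t)"
      using R(1) by (auto simp: P_def)
    also have "(\<Sum>t<p0. g t) + (\<Sum>t=p0..<W. g t) = (\<Sum>t<W. g t)"
      using R(1) by (simp add: lessThan_atLeast0 sum.atLeastLessThan_concat)
    finally show ?thesis by simp
  qed
  moreover have "\<forall>(p,q)\<in>R \<union> P. p < q \<and> q \<le> W \<and> (q = Suc p \<or> {p..<q} \<inter> H = {})"
    using R(1,4) R(5) by (fastforce simp: P_def split: if_splits)
  moreover have "finite (R \<union> P)" using R(2) fP by simp
  ultimately show ?thesis by (intro exI[of _ "R \<union> P"]) simp
qed

text \<open>Cauchy-Schwarz in the form that assembles local bounds over pieces, blocks and dyadic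
  levels.\<close>

lemma sum_square_le:
  fixes y c e :: "'a \<Rightarrow> real"
  assumes "\<And>i. i \<in> I \<Longrightarrow> (y i)\<^sup>2 \<le> c i * e i" "\<And>i. i \<in> I \<Longrightarrow> c i \<ge> 0" "\<And>i. i \<in> I \<Longrightarrow> e i \<ge> 0"
  shows "(\<Sum>i\<in>I. y i)\<^sup>2 \<le> (\<Sum>i\<in>I. c i) * (\<Sum>i\<in>I. e i)"
proof -
  have "\<bar>\<Sum>i\<in>I. y i\<bar> \<le> (\<Sum>i\<in>I. sqrt (c i) * sqrt (e i))"
    by (rule order_trans[OF sum_abs], rule sum_mono) (use assms in \<open>metis real_le_rsqrt real_sqrt_abs real_sqrt_le_iff real_sqrt_mult\<close>)
  then have "(\<Sum>i\<in>I. y i)\<^sup>2 \<le> (\<Sum>i\<in>I. sqrt (c i) * sqrt (e i))\<^sup>2"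
    by (metis abs_ge_zero power2_abs power_mono)
  also have "\<dots> \<le> (\<Sum>i\<in>I. (sqrt (c i))\<^sup>2) * (\<Sum>i\<in>I. (sqrt (e i))\<^sup>2)" by (rule Cauchy_Schwarz_ineq_sum)
  also have "\<dots> = (\<Sum>i\<in>I. c i) * (\<Sum>i\<in>I. e i)" using assms(2,3) by simp
  finally show ?thesis .
qed

text \<open>
  \<open>wscale a b i\<close> is the dyadic scale of the distance from \<open>i\<close> to the complement of \<open>{a<..b}\<close>.
  \<open>wlevel a b\<close> numbers the scale classes from left to right, so that it is monotone and separates
  the two halves of the block; \<open>wfold\<close> recovers the scale from the level.
\<close>

definition wscale :: "nat \<Rightarrow> nat \<Rightarrow> nat \<Rightarrow> nat" where
  "wscale a b i = floor_log (min (i - a) (Suc b - i))"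

definition wlevel :: "nat \<Rightarrow> nat \<Rightarrow> nat \<Rightarrow> nat" where
  "wlevel a b i = (if i - a \<le> Suc b - i then wscale a b i else 2 * floor_log (b - a) + 1 - wscale a b i)"

definition wfold :: "nat \<Rightarrow> nat \<Rightarrow> nat \<Rightarrow> nat" where
  "wfold a b t = (if t \<le> floor_log (b - a) then t else 2 * floor_log (b - a) + 1 - t)"

lemma wscale_le: "a < i \<Longrightarrow> i \<le> b \<Longrightarrow> wscale a b i \<le> floor_log (b - a)"
  unfolding wscale_def by (intro floor_log_le_iff) auto

lemma wlevel_less: "a < i \<Longrightarrow> i \<le> b \<Longrightarrow> wlevel a b i < 2 * floor_log (b - a) + 2"
  using wscale_le[of a i b] by (auto simp: wlevel_def)

lemma wfold_wlevel: "a < i \<Longrightarrow> i \<le> b \<Longrightarrow> wfold a b (wlevel a b i) = wscale a b i"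
  using wscale_le[of a i b] by (auto simp: wlevel_def wfold_def)

lemma wlevel_mono:
  assumes "a < i" "i \<le> j" "j \<le> b"
  shows "wlevel a b i \<le> wlevel a b j"
proof -
  have s: "wscale a b i \<le> floor_log (b - a)" "wscale a b j \<le> floor_log (b - a)"
    using assms by (auto intro!: wscale_le)
  consider "j - a \<le> Suc b - j" | "\<not> j - a \<le> Suc b - j" "i - a \<le> Suc b - i" | "\<not> i - a \<le> Suc b - i" by blast
  then show ?thesis
  proof cases
    case 1
    then have "wscale a b i \<le> wscale a b j" unfolding wscale_def using assms by (intro floor_log_le_iff) auto
    moreover have "i - a \<le> Suc b - i" using 1 assms by linarith
    ultimately show ?thesis using 1 by (simp add: wlevel_def)
  next
    case 2 then show ?thesis using s by (simp add: wlevel_def)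
  next
    case 3
    then have "wscale a b j \<le> wscale a b i" unfolding wscale_def using assms by (intro floor_log_le_iff) auto
    moreover have "\<not> j - a \<le> Suc b - j" using 3 assms by linarith
    ultimately show ?thesis using 3 by (simp add: wlevel_def)
  qed
qed

section \<open>Sizes, neighbourhoods and overlaps of the Whitney levels\<close>

lemma floor_log_bounds:
  assumes "n > 0"
  shows "2 ^ floor_log n \<le> n" "n < 2 * 2 ^ floor_log n"
  using floor_log_exp2_le[OF assms] floor_log_exp2_gt[of n] by auto

text \<open>A level lies in one half of the block, and there the distance to the near end ranges
  over \<open>2 ^ s ..< 2 * 2 ^ s\<close>, with \<open>s\<close> the scale of the level.\<close>

lemma wlevel_card:
  "card {i\<in>{a<..b}. wlevel a b i = t} \<le> 2 ^ wfold a b t"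
proof -
  define S where "S = floor_log (b - a)"
  define s where "s = wfold a b t"
  have bd: "2 ^ s \<le> min (i - a) (Suc b - i) \<and> min (i - a) (Suc b - i) < 2 * 2 ^ s"
    if "i \<in> {a<..b}" "wlevel a b i = t" for i
  proof -
    have "wscale a b i = s" unfolding s_def using that wfold_wlevel[of a i b] by auto
    moreover have "min (i - a) (Suc b - i) > 0" using that by auto
    ultimately show ?thesis using floor_log_bounds[of "min (i - a) (Suc b - i)"] unfolding wscale_def by auto
  qed
  show ?thesis
  proof (cases "t \<le> S")
    case True
    have "i - a \<le> Suc b - i" if "i \<in> {a<..b}" "wlevel a b i = t" for i
    proof (rule ccontr)
      assume "\<not> i - a \<le> Suc b - i"
      then have "t = 2 * S + 1 - wscale a b i" using that by (simp add: wlevel_def S_def)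
      then show False using True wscale_le[of a i b] that by (auto simp: S_def)
    qed
    then have "{i\<in>{a<..b}. wlevel a b i = t} \<subseteq> {a + 2 ^ s..<a + 2 * 2 ^ s}"
      using bd by fastforce
    from card_mono[OF _ this] show ?thesis unfolding s_def by simp
  next
    case False
    have "\<not> i - a \<le> Suc b - i" if "i \<in> {a<..b}" "wlevel a b i = t" for i
    proof
      assume "i - a \<le> Suc b - i"
      then have "t = wscale a b i" using that by (simp add: wlevel_def)
      then show False using False wscale_le[of a i b] that by (auto simp: S_def)
    qed
    then have "{i\<in>{a<..b}. wlevel a b i = t} \<subseteq> {Suc b - 2 * 2 ^ s<..Suc b - 2 ^ s}"
      using bd by fastforce
    from card_mono[OF _ this] show ?thesis unfolding s_def by simp
  qed
qed

text \<open>Scales are compared instead of levels, so the set is symmetric: a window around a point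
  near the middle may cross into the other half, where the level numbers can jump.\<close>

definition wnbhd :: "nat \<Rightarrow> nat \<Rightarrow> nat \<Rightarrow> nat set" where
  "wnbhd a b t = {i\<in>{a<..b}. wscale a b i \<le> wfold a b t + 1 \<and> wfold a b t \<le> wscale a b i + 1}"

text \<open>The distance to the ends is 1-Lipschitz and the radius is at most half of
  \<open>2 ^ s\<close>. On the window the distance is at least \<open>2 ^ s / 2\<close> and less
  than \<open>4 * 2 ^ s\<close>, so the scale moves by at most one. For \<open>s = 0\<close> the
  radius is 0.\<close>

lemma wnbhd_interval:
  assumes x: "a < x" "x \<le> b" and r: "r = 2 ^ wscale a b x div 2"
  shows "a < x - r" "x + r \<le> b" "{x - r..x + r} \<subseteq> wnbhd a b (wlevel a b x)"
proof -
  define s where "s = wscale a b x"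
  define \<rho> where "\<rho> i = min (i - a) (Suc b - i)" for i
  have b1: "2 ^ s \<le> \<rho> x" "\<rho> x < 2 * 2 ^ s"
    using floor_log_bounds[of "\<rho> x"] x by (auto simp: s_def wscale_def \<rho>_def)
  have r1: "r < 2 ^ s" "2 * r \<le> 2 ^ s" by (auto simp: r s_def)
  show ax: "a < x - r" and xb: "x + r \<le> b" using b1(1) r1(1) unfolding \<rho>_def by linarith+
  show "{x - r..x + r} \<subseteq> wnbhd a b (wlevel a b x)"
  proof
    fix y assume y: "y \<in> {x - r..x + r}"
    have yb: "a < y" "y \<le> b" using y ax xb by auto
    have "\<rho> y \<le> \<rho> x + r" "\<rho> x \<le> \<rho> y + r" using y x unfolding \<rho>_def by auto
    then have y1: "\<rho> y < 2 ^ Suc (Suc s)" "2 ^ s \<le> 2 * \<rho> y" using b1 r1 by auto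
    have y2: "2 ^ wscale a b y \<le> \<rho> y" "\<rho> y < 2 ^ Suc (wscale a b y)"
      using floor_log_bounds[of "\<rho> y"] yb by (auto simp: wscale_def \<rho>_def)
    have "(2::nat) ^ wscale a b y < 2 ^ Suc (Suc s)" using y1 y2 by linarith
    then have "wscale a b y < Suc (Suc s)" by (rule power_less_imp_less_exp[rotated]) simp
    moreover have "(2::nat) ^ s < 2 ^ Suc (Suc (wscale a b y))" using y1 y2 by simp
    then have "s < Suc (Suc (wscale a b y))" by (rule power_less_imp_less_exp[rotated]) simp
    ultimately show "y \<in> wnbhd a b (wlevel a b x)"
      using yb x by (auto simp: wnbhd_def wfold_wlevel s_def)
  qed
qed

text \<open>Three admissible scales in each of the two halves.\<close>

lemma wnbhd_overlap: "card {t. t < 2 * floor_log (b - a) + 2 \<and> i \<in> wnbhd a b t} \<le> 6"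
proof -
  define S l where "S = floor_log (b - a)" and "l = wscale a b i"
  have "t \<in> {l-1..l+1} \<union> (\<lambda>s. 2 * S + 1 - s) ` {l-1..l+1}"
    if "t < 2 * S + 2" "i \<in> wnbhd a b t" for t
  proof (cases "t \<le> S")
    case True then show ?thesis using that by (auto simp: wnbhd_def wfold_def S_def l_def)
  next
    case False
    then have "t = 2 * S + 1 - (2 * S + 1 - t)" "2 * S + 1 - t \<in> {l-1..l+1}"
      using that by (auto simp: wnbhd_def wfold_def S_def l_def)
    then show ?thesis by blast
  qed
  then have "{t. t < 2 * S + 2 \<and> i \<in> wnbhd a b t} \<subseteq> {l-1..l+1} \<union> (\<lambda>s. 2 * S + 1 - s) ` {l-1..l+1}" by blast
  then have "card {t. t < 2 * S + 2 \<and> i \<in> wnbhd a b t} \<le> card ({l-1..l+1} \<union> (\<lambda>s. 2 * S + 1 - s) ` {l-1..l+1})"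
    by (intro card_mono) auto
  also have "\<dots> \<le> card {l-1..l+1} + card ((\<lambda>s. 2 * S + 1 - s) ` {l-1..l+1})" by (rule card_Un_le)
  also have "\<dots> \<le> card {l-1..l+1} + card {l-1..l+1}" by (intro add_left_mono card_image_le) simp
  also have "\<dots> \<le> 6" by simp
  finally show ?thesis by (simp add: S_def)
qed

lemma wnbhd_sum_le:
  fixes f :: "nat \<Rightarrow> real"
  assumes "\<And>i. f i \<ge> 0"
  shows "(\<Sum>t<2 * floor_log (b - a) + 2. \<Sum>i\<in>wnbhd a b t. f i) \<le> 6 * (\<Sum>i\<in>{a<..b}. f i)"
proof -
  define W where "W = 2 * floor_log (b - a) + 2"
  have "(\<Sum>i\<in>wnbhd a b t. f i) = (\<Sum>i\<in>{a<..b}. if i \<in> wnbhd a b t then f i else 0)" for t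
    by (subst sum.inter_filter[symmetric]) (auto intro!: sum.cong simp: wnbhd_def)
  then have "(\<Sum>t<W. \<Sum>i\<in>wnbhd a b t. f i) = (\<Sum>i\<in>{a<..b}. \<Sum>t<W. if i \<in> wnbhd a b t then f i else 0)"
    by (simp add: sum.swap[of _ "{a<..b}"])
  also have "\<dots> = (\<Sum>i\<in>{a<..b}. real (card {t. t < W \<and> i \<in> wnbhd a b t}) * f i)"
    by (subst sum.inter_filter[symmetric]) auto
  also have "\<dots> \<le> (\<Sum>i\<in>{a<..b}. 6 * f i)"
  proof (rule sum_mono)
    fix i
    have "real (card {t. t < W \<and> i \<in> wnbhd a b t}) \<le> 6" using wnbhd_overlap[of b a i] unfolding W_def by linarith
    then show "real (card {t. t < W \<and> i \<in> wnbhd a b t}) * f i \<le> 6 * f i" using assms by (rule mult_right_mono)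
  qed
  finally show ?thesis unfolding W_def sum_distrib_left .
qed

lemma wlevel_interval:
  "\<exists>\<alpha> N. {i\<in>{a<..b}. p \<le> wlevel a b i \<and> wlevel a b i < q} = {\<alpha>..<\<alpha> + N}"
proof -
  define L where "L = {i\<in>{a<..b}. p \<le> wlevel a b i \<and> wlevel a b i < q}"
  have fin: "finite L" by (simp add: L_def)
  show ?thesis
  proof (cases "L = {}")
    case True then show ?thesis unfolding L_def[symmetric] by (intro exI[of _ 0]) auto
  next
    case False
    have m: "Min L \<in> L" "Max L \<in> L" using fin False by auto
    have "L = {Min L..Max L}"
    proof
      show "L \<subseteq> {Min L..Max L}" using fin by auto
      show "{Min L..Max L} \<subseteq> L"
      proof
        fix i assume i: "i \<in> {Min L..Max L}"
        have "a < Min L" "Max L \<le> b" "p \<le> wlevel a b (Min L)" "wlevel a b (Max L) < q"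
          using m by (auto simp: L_def)
        moreover have "wlevel a b (Min L) \<le> wlevel a b i" "wlevel a b i \<le> wlevel a b (Max L)"
          using i calculation by (auto intro!: wlevel_mono)
        ultimately show "i \<in> L" using i by (auto simp: L_def)
      qed
    qed
    also have "\<dots> = {Min L..<Min L + (Suc (Max L) - Min L)}"
      using m fin by (auto simp: )
    finally show ?thesis unfolding L_def[symmetric] by blast
  qed
qed

text \<open>The losses on a block multiply: 6 for the overlap of the neighbourhoods,
  \<open>(1 + 2 ^ m)^2\<close> for partial summation, \<open>2 * Cloc m + 1\<close> for the
  pointwise bound.\<close>

definition Cblk :: "nat \<Rightarrow> real" where "Cblk m = 6 * ((1 + 2 ^ m)\<^sup>2 * (2 * Cloc m + 1))"

lemma Cblk_nonneg: "Cblk m \<ge> 0" using Cloc_nonneg[of m] by (simp add: Cblk_def)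

definition wpiece :: "nat \<Rightarrow> nat \<Rightarrow> nat \<Rightarrow> nat \<Rightarrow> nat set" where
  "wpiece a b p q = {i\<in>{a<..b}. p \<le> wlevel a b i \<and> wlevel a b i < q}"

lemma wpiece_eq: "wpiece a b p q = {Min (wpiece a b p q)..<Min (wpiece a b p q) + card (wpiece a b p q)}"
proof -
  obtain \<alpha> N where e: "wpiece a b p q = {\<alpha>..<\<alpha> + N}"
    using wlevel_interval[of a b p q] unfolding wpiece_def by auto
  show ?thesis
  proof (cases "N = 0")
    case True then show ?thesis using e by simp
  next
    case False
    have "Min {\<alpha>..<\<alpha> + N} = \<alpha>" using False by (intro Min_eqI) auto
    then show ?thesis unfolding e by simp
  qed
qed

lemma wpiece_sum:
  fixes f :: "nat \<Rightarrow> real"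
  shows "(\<Sum>t=p..<q. \<Sum>i\<in>{i\<in>{a<..b}. wlevel a b i = t}. f i) = (\<Sum>i\<in>wpiece a b p q. f i)"
proof -
  have "(\<Sum>t=p..<q. sum f {i \<in> wpiece a b p q. wlevel a b i = t}) = sum f (wpiece a b p q)"
    by (rule sum.group) (auto simp: wpiece_def)
  moreover have "{i \<in> wpiece a b p q. wlevel a b i = t} = {i\<in>{a<..b}. wlevel a b i = t}" if "t \<in> {p..<q}" for t
    using that by (auto simp: wpiece_def)
  ultimately show ?thesis by (metis (no_types, lifting) sum.cong)
qed

text \<open>
  On a level that may contain knots, \<open>v\<close> is bounded through its values on both sides, where the
  block still has room of the same scale; on a run of levels without knots \<open>v\<close> is a polynomial
  and needs no room.
\<close>

lemma block_piece_max:
  fixes v :: "nat \<Rightarrow> real"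
  assumes m: "m \<ge> 1"
    and pos: "\<And>i. a < i \<Longrightarrow> i + m \<le> b \<Longrightarrow> fd m v i \<ge> 0"
    and pq: "p < q" "q = Suc p \<or> (\<forall>i\<in>wpiece a b p q. i + m \<le> b \<longrightarrow> fd m v i = 0)"
    and x: "x \<in> wpiece a b p q"
  shows "real (card (wpiece a b p q)) * (v x)\<^sup>2 \<le> (2 * Cloc m + 1) * (\<Sum>t=p..<q. \<Sum>i\<in>wnbhd a b t. (v i)\<^sup>2)"
proof -
  define G where "G = (\<Sum>t=p..<q. \<Sum>i\<in>wnbhd a b t. (v i)\<^sup>2)"
  define N where "N = card (wpiece a b p q)"
  have xab: "a < x" "x \<le> b" "p \<le> wlevel a b x" "wlevel a b x < q" using x by (auto simp: wpiece_def)
  have G0: "G \<ge> 0" unfolding G_def by (intro sum_nonneg) auto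
  have wsub: "(\<Sum>i\<in>wnbhd a b t. (v i)\<^sup>2) \<le> G" if "t \<in> {p..<q}" for t
    unfolding G_def using that by (intro member_le_sum) (auto intro: sum_nonneg)
  have finw: "finite (wnbhd a b t)" for t by (simp add: wnbhd_def)
  from pq(2) show ?thesis
  proof
    assume q: "q = Suc p"
    define t where "t = wlevel a b x"
    have t: "t = p" using xab q by (simp add: t_def)
    define s where "s = wscale a b x"
    have s: "wfold a b p = s" using wfold_wlevel[OF xab(1,2)] t by (simp add: s_def t_def)
    define r :: nat where "r = 2 ^ s div 2"
    have "wpiece a b p q = {i\<in>{a<..b}. wlevel a b i = p}" using q by (auto simp: wpiece_def)
    then have N: "N \<le> 2 ^ s" unfolding N_def using wlevel_card[of a b p] s by simp
    note nb = wnbhd_interval[OF xab(1,2) r_def[unfolded s_def], folded t_def, unfolded t]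
    have "real r * (v x)\<^sup>2 \<le> Cloc m * (\<Sum>i=x - r..x + r. (v i)\<^sup>2)"
      using nb(1,2) by (intro local_max_bound[OF m] pos) auto
    also have "\<dots> \<le> Cloc m * G"
    proof (rule mult_left_mono[OF _ Cloc_nonneg])
      have "(\<Sum>i=x - r..x + r. (v i)\<^sup>2) \<le> (\<Sum>i\<in>wnbhd a b p. (v i)\<^sup>2)"
        using nb(3) finw by (intro sum_mono2) auto
      then show "(\<Sum>i=x - r..x + r. (v i)\<^sup>2) \<le> G" using wsub[of p] q by simp
    qed
    finally have 1: "real r * (v x)\<^sup>2 \<le> Cloc m * G" .
    \<comment> \<open>At scale 0 the radius is 0 and the local bound is void. This trivial bound
      covers that case and accounts for the summand 1 in \<open>2 * Cloc m + 1\<close>.\<close>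
    have 2: "(v x)\<^sup>2 \<le> G"
    proof -
      have "x \<in> wnbhd a b p" using nb(3) by auto
      then have "(v x)\<^sup>2 \<le> (\<Sum>i\<in>wnbhd a b p. (v i)\<^sup>2)" using finw by (intro member_le_sum) auto
      then show ?thesis using wsub[of p] q by simp
    qed
    have "2 ^ s \<le> 2 * r + 1" unfolding r_def by simp
    then have "real N \<le> 2 * real r + 1" using N by linarith
    then have "real N * (v x)\<^sup>2 \<le> (2 * real r + 1) * (v x)\<^sup>2" by (rule mult_right_mono) simp
    also have "\<dots> \<le> (2 * Cloc m + 1) * G" using 1 2 by (simp add: algebra_simps)
    finally show ?thesis by (simp add: N_def G_def)
  next
    assume z: "\<forall>i\<in>wpiece a b p q. i + m \<le> b \<longrightarrow> fd m v i = 0"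
    define \<alpha> where "\<alpha> = Min (wpiece a b p q)"
    have e: "wpiece a b p q = {\<alpha>..<\<alpha> + N}" unfolding \<alpha>_def N_def by (rule wpiece_eq)
    have "x \<in> {\<alpha>..<\<alpha> + N}" using x e by simp
    then have "\<alpha> + N - 1 \<in> {\<alpha>..<\<alpha> + N}" by auto
    then have "\<alpha> + N - 1 \<in> wpiece a b p q" unfolding e .
    then have "\<alpha> + N - 1 \<le> b" unfolding wpiece_def mem_Collect_eq greaterThanAtMost_iff by (elim conjE)
    then have "\<alpha> + N \<le> Suc b" by linarith
    have "real N * (v x)\<^sup>2 \<le> Cloc m * (\<Sum>i\<in>{\<alpha>..<\<alpha> + N}. (v i)\<^sup>2)"
    proof (rule polynomial_max_bound[OF m])
      show "x \<in> {\<alpha>..<\<alpha> + N}" using x e by simp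
      fix i assume i: "\<alpha> \<le> i" "i + m < \<alpha> + N"
      then have "i \<in> wpiece a b p q" unfolding e by simp
      moreover have "i + m \<le> b" using i \<open>\<alpha> + N \<le> Suc b\<close> by linarith
      ultimately show "fd m v i = 0" using z by blast
    qed
    also have "(\<Sum>i\<in>{\<alpha>..<\<alpha> + N}. (v i)\<^sup>2) \<le> G"
      unfolding e[symmetric] wpiece_sum[symmetric] G_def
      by (intro sum_mono sum_mono2) (auto simp: wnbhd_def wfold_wlevel)
    then have "Cloc m * (\<Sum>i\<in>{\<alpha>..<\<alpha> + N}. (v i)\<^sup>2) \<le> Cloc m * G" by (rule mult_left_mono[OF _ Cloc_nonneg])
    also have "\<dots> \<le> (2 * Cloc m + 1) * G" using G0 Cloc_nonneg by (intro mult_right_mono) (auto simp: add_increasing2)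
    finally show ?thesis by (simp add: N_def G_def)
  qed
qed

text \<open>Which pieces occur depends on \<open>v\<close>. The threshold \<open>A\<close> is paid
  for each of them, and a position with nonzero difference creates at most two pieces. The
  nonnegative excess \<open>\<beta>\<close> is instead summed over all pairs of levels, a quantity
  that does not involve \<open>v\<close>. Cauchy-Schwarz over the pieces and the bounded overlap of
  the neighbourhoods give the rest.\<close>

lemma block_bound:
  fixes v x :: "nat \<Rightarrow> real"
  assumes m: "m \<ge> 1" and A: "A \<ge> 0" and \<beta>: "\<And>p q. \<beta> p q \<ge> 0"
    and pos: "\<And>i. a < i \<Longrightarrow> i + m \<le> b \<Longrightarrow> fd m v i \<ge> 0"
    and part: "\<And>p q t. t \<le> card (wpiece a b p q) \<Longrightarrow>
      (\<Sum>i=Min (wpiece a b p q)..<Min (wpiece a b p q) + t. x i)\<^sup>2 \<le> real (card (wpiece a b p q)) * (A + \<beta> p q)"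
  defines "W \<equiv> 2 * floor_log (b - a) + 2"
  shows "(\<Sum>i\<in>{a<..b}. x i * v i)\<^sup>2 \<le> Cblk m * (real (2 * card {i. a < i \<and> i + m \<le> b \<and> fd m v i \<noteq> 0} + 1) * A
      + (\<Sum>(p,q)\<in>{..W}\<times>{..W}. \<beta> p q)) * (\<Sum>i\<in>{a<..b}. (v i)\<^sup>2)"
proof -
  define H where "H = {i. a < i \<and> i + m \<le> b \<and> fd m v i \<noteq> 0}"
  have fH: "finite H" by (rule finite_subset[of _ "{..b}"]) (auto simp: H_def)
  obtain R where R: "finite R" "card R \<le> 2 * card (wlevel a b ` H) + 1"
     "\<forall>(p,q)\<in>R. p < q \<and> q \<le> W \<and> (q = Suc p \<or> {p..<q} \<inter> wlevel a b ` H = {})"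
     and Rsum: "\<forall>g :: nat \<Rightarrow> real. (\<Sum>t<W. g t) = (\<Sum>(p,q)\<in>R. \<Sum>t=p..<q. g t)"
    using runs_and_hits_decomposition[OF finite_imageI[OF fH], of "wlevel a b" W] by (elim exE conjE) (rule that)
  have cR: "card R \<le> 2 * card H + 1" using R(2) card_image_le[OF fH, of "wlevel a b"] by linarith
  have tot: "(\<Sum>i\<in>{a<..b}. f i) = (\<Sum>(p,q)\<in>R. \<Sum>i\<in>wpiece a b p q. f i)" for f :: "nat \<Rightarrow> real"
  proof -
    have "wpiece a b 0 W = {a<..b}" using wlevel_less by (auto simp: wpiece_def W_def)
    then have "(\<Sum>i\<in>{a<..b}. f i) = (\<Sum>t<W. \<Sum>i\<in>{i\<in>{a<..b}. wlevel a b i = t}. f i)"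
      using wpiece_sum[where a = a and b = b and f = f and p = 0 and q = W] by (simp add: lessThan_atLeast0)
    also have "\<dots> = (\<Sum>(p,q)\<in>R. \<Sum>t=p..<q. \<Sum>i\<in>{i\<in>{a<..b}. wlevel a b i = t}. f i)"
      using Rsum by blast
    finally show ?thesis by (simp only: wpiece_sum)
  qed
  define G where "G p q = (\<Sum>t=p..<q. \<Sum>i\<in>wnbhd a b t. (v i)\<^sup>2)" for p q
  have G0: "G p q \<ge> 0" for p q unfolding G_def by (intro sum_nonneg) auto
  define K where "K = (1 + 2 ^ m)\<^sup>2 * (2 * Cloc m + 1)"
  have K0: "K \<ge> 0" using Cloc_nonneg[of m] by (simp add: K_def)
  have piece: "(\<Sum>i\<in>wpiece a b p q. x i * v i)\<^sup>2 \<le> (K * (A + \<beta> p q)) * G p q" if pq: "(p,q) \<in> R" for p q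
  proof -
    define N \<alpha> where "N = card (wpiece a b p q)" and "\<alpha> = Min (wpiece a b p q)"
    have e: "wpiece a b p q = {\<alpha>..<\<alpha> + N}" unfolding \<alpha>_def N_def by (rule wpiece_eq)
    have "p < q \<and> q \<le> W \<and> (q = Suc p \<or> {p..<q} \<inter> wlevel a b ` H = {})"
      using bspec[OF R(3) pq] by (simp only: prod.case)
    then have pq': "p < q" "q = Suc p \<or> {p..<q} \<inter> wlevel a b ` H = {}" by (simp_all only: simp_thms)
    have Ab: "A + \<beta> p q \<ge> 0" using A \<beta>[of p q] by simp
    show ?thesis
    proof (cases "N = 0")
      case True
      then have "wpiece a b p q = {}" using e by simp
      then show ?thesis using K0 Ab G0[of p q] by simp
    next
      case False
      have hit: "q = Suc p \<or> (\<forall>i\<in>wpiece a b p q. i + m \<le> b \<longrightarrow> fd m v i = 0)"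
      proof (cases "q = Suc p")
        case False
        then have *: "{p..<q} \<inter> wlevel a b ` H = {}" using pq' by simp
        have "fd m v i = 0" if i: "i \<in> wpiece a b p q" "i + m \<le> b" for i
        proof (rule ccontr)
          assume "fd m v i \<noteq> 0"
          then have "i \<in> H" using i by (auto simp: H_def wpiece_def)
          then show False using * i by (auto simp: wpiece_def)
        qed
        then show ?thesis by blast
      qed simp
      \<comment> \<open>\<open>M\<close> carries a factor \<open>sqrt N\<close> and \<open>V\<close>
        a factor \<open>1 / sqrt N\<close>: the length of the piece cancels in the product.\<close>
      define V where "V = sqrt ((2 * Cloc m + 1) * G p q / real N)"
      define M where "M = sqrt (real N * (A + \<beta> p q))"
      have xin: "i \<in> wpiece a b p q" if "\<alpha> \<le> i" "i < \<alpha> + N" for i using that e by simp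
      have ab: "a < i \<and> i \<le> b" if "\<alpha> \<le> i" "i < \<alpha> + N" for i using xin[OF that] by (simp add: wpiece_def)
      have top: "\<alpha> + N - 1 \<le> b" using ab[of "\<alpha> + N - 1"] False by simp
      have "\<bar>\<Sum>i\<in>{\<alpha>..<\<alpha>+N}. x i * v i\<bar> \<le> (1 + 2 ^ m) * M * V"
      proof (rule abel_bound[OF m])
        fix i assume "\<alpha> \<le> i" "i + m < \<alpha> + N"
        then show "fd m v i \<ge> 0" using ab[of i] top by (intro pos) auto
      next
        fix i assume i: "\<alpha> \<le> i" "i < \<alpha> + N"
        have "real N * (v i)\<^sup>2 \<le> (2 * Cloc m + 1) * G p q"
          unfolding G_def N_def by (rule block_piece_max[OF m pos pq'(1) hit xin[OF i]])
        then have "(v i)\<^sup>2 \<le> (2 * Cloc m + 1) * G p q / real N" using False by (simp add: field_simps)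
        then show "\<bar>v i\<bar> \<le> V" unfolding V_def by (metis real_sqrt_abs real_sqrt_le_iff)
      next
        fix t assume "t \<le> N"
        then have "(\<Sum>i\<in>{\<alpha>..<\<alpha>+t}. x i)\<^sup>2 \<le> real N * (A + \<beta> p q)"
          unfolding N_def \<alpha>_def by (rule part)
        then show "\<bar>\<Sum>i\<in>{\<alpha>..<\<alpha>+t}. x i\<bar> \<le> M" unfolding M_def by (metis real_sqrt_abs real_sqrt_le_iff)
      qed (use False in simp)
      then have "(\<Sum>i\<in>{\<alpha>..<\<alpha>+N}. x i * v i)\<^sup>2 \<le> ((1 + 2 ^ m) * M * V)\<^sup>2"
        by (metis abs_ge_zero power2_abs power_mono)
      also have "\<dots> = (1 + 2 ^ m)\<^sup>2 * (real N * (A + \<beta> p q)) * ((2 * Cloc m + 1) * G p q / real N)"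
        unfolding power_mult_distrib M_def V_def using Ab G0[of p q] Cloc_nonneg[of m] by simp
      also have "\<dots> = (K * (A + \<beta> p q)) * G p q" using False by (simp add: K_def)
      finally show ?thesis unfolding e .
    qed
  qed
  have "(\<Sum>i\<in>{a<..b}. x i * v i)\<^sup>2 = (\<Sum>(p,q)\<in>R. \<Sum>i\<in>wpiece a b p q. x i * v i)\<^sup>2" by (simp only: tot)
  also have "\<dots> \<le> (\<Sum>(p,q)\<in>R. K * (A + \<beta> p q)) * (\<Sum>(p,q)\<in>R. G p q)"
    by (rule sum_square_le) (use piece K0 A \<beta> G0 in \<open>auto split: prod.splits\<close>)
  also have "(\<Sum>(p,q)\<in>R. G p q) = (\<Sum>t<W. \<Sum>i\<in>wnbhd a b t. (v i)\<^sup>2)"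
    unfolding G_def using Rsum by simp
  also have "(\<Sum>(p,q)\<in>R. K * (A + \<beta> p q)) * (\<Sum>t<W. \<Sum>i\<in>wnbhd a b t. (v i)\<^sup>2) \<le>
     (K * (real (2 * card H + 1) * A + (\<Sum>(p,q)\<in>{..W}\<times>{..W}. \<beta> p q))) * (6 * (\<Sum>i\<in>{a<..b}. (v i)\<^sup>2))"
  proof (rule mult_mono)
    have "(\<Sum>(p,q)\<in>R. K * (A + \<beta> p q)) = K * (real (card R) * A + (\<Sum>(p,q)\<in>R. \<beta> p q))"
      by (simp add: case_prod_unfold sum_distrib_left[symmetric] sum.distrib)
    also have "\<dots> \<le> K * (real (2 * card H + 1) * A + (\<Sum>(p,q)\<in>{..W}\<times>{..W}. \<beta> p q))"
    proof (intro mult_left_mono add_mono K0 mult_right_mono A)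
      show "real (card R) \<le> real (2 * card H + 1)" using cR by linarith
      show "(\<Sum>(p,q)\<in>R. \<beta> p q) \<le> (\<Sum>(p,q)\<in>{..W}\<times>{..W}. \<beta> p q)"
        using R(3) \<beta> by (intro sum_mono2) fastforce+
    qed
    finally show "(\<Sum>(p,q)\<in>R. K * (A + \<beta> p q)) \<le> K * (real (2 * card H + 1) * A + (\<Sum>(p,q)\<in>{..W}\<times>{..W}. \<beta> p q))" .
    show "(\<Sum>t<W. \<Sum>i\<in>wnbhd a b t. (v i)\<^sup>2) \<le> 6 * (\<Sum>i\<in>{a<..b}. (v i)\<^sup>2)"
      unfolding W_def by (rule wnbhd_sum_le) simp
    show "0 \<le> (\<Sum>t<W. \<Sum>i\<in>wnbhd a b t. (v i)\<^sup>2)" by (intro sum_nonneg) auto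
    have "(\<Sum>(p,q)\<in>{..W}\<times>{..W}. \<beta> p q) \<ge> 0" using \<beta> by (intro sum_nonneg) auto
    then show "0 \<le> K * (real (2 * card H + 1) * A + (\<Sum>(p,q)\<in>{..W}\<times>{..W}. \<beta> p q))" using K0 A by simp
  qed
  finally show ?thesis unfolding Cblk_def K_def H_def by (simp add: algebra_simps)
qed

section \<open>Finite differences of monotone splines\<close>

text \<open>Step and argument are real because differences of primitives are integrals of
  differences over whole intervals; the grid enters only through \<open>fd_eq_hfd\<close>.\<close>

primrec hfd :: "nat \<Rightarrow> real \<Rightarrow> (real \<Rightarrow> real) \<Rightarrow> real \<Rightarrow> real" where
  "hfd 0 h g x = g x"
| "hfd (Suc m) h g x = hfd m h g (x + h) - hfd m h g x"

lemma fd_eq_hfd: "fd m (\<lambda>i. g (real i / real n)) i = hfd m (1 / real n) g (real i / real n)"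
  by (induction m arbitrary: i) (auto simp: add_divide_distrib add.commute)

section \<open>Integrability of the iterated primitives\<close>

lemma prim_eq_integral:
  assumes "set_integrable lborel {0..1} g" "x \<in> {0..1}"
  shows "prim c 0 g x = integral {0..x} g + c"
proof -
  have "set_integrable lborel {0..x} g" using assms by (intro set_integrable_subset[OF assms(1)]) auto
  then have "(LBINT y=ereal 0..ereal x. g y) = integral {0..x} g"
    using assms by (intro interval_integral_eq_integral) auto
  then show ?thesis using assms by (simp add: prim_def zero_ereal_def)
qed

lemma prim_set_integrable:
  assumes "set_integrable lborel {0..1} g"
  shows "set_integrable lborel {0..1} (prim c 0 g)"
proof (rule borel_integrable_atLeastAtMost')
  have "g integrable_on {0..1}" using set_borel_integral_eq_integral(1)[OF assms] .
  then have "continuous_on {0..1} (\<lambda>x. integral {0..x} g + c)"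
    by (intro continuous_intros indefinite_integral_continuous_1)
  then show "continuous_on {0..1} (prim c 0 g)"
    by (rule continuous_on_eq) (simp add: prim_eq_integral[OF assms])
qed

lemma mono_on_set_integrable:
  fixes f :: "real \<Rightarrow> real"
  assumes "mono_on {0..1} f"
  shows "set_integrable lborel {0..1} f"
proof -
  have "f \<in> borel_measurable (restrict_space borel {0..1})" by (rule borel_measurable_mono_on_fnc[OF assms])
  then have meas: "(\<lambda>x. indicator {0..1} x *\<^sub>R f x) \<in> borel_measurable lborel"
    by (subst (asm) borel_measurable_restrict_space_iff) auto
  have "integrable lborel (\<lambda>x. indicator {0..1::real} x *\<^sub>R (indicator {0..1} x *\<^sub>R f x))"
  proof (rule integrableI_bounded_set_indicator[where B = "\<bar>f 0\<bar> + \<bar>f 1\<bar>"])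
    have "\<bar>f x\<bar> \<le> \<bar>f 0\<bar> + \<bar>f 1\<bar>" if "x \<in> {0..1}" for x
    proof -
      have "f 0 \<le> f x" "f x \<le> f 1" using that assms by (auto intro: mono_onD)
      then show ?thesis by linarith
    qed
    then show "AE x in lborel. x \<in> {0..1} \<longrightarrow> norm (indicator {0..1} x *\<^sub>R f x) \<le> \<bar>f 0\<bar> + \<bar>f 1\<bar>"
      by (intro AE_I2) auto
  qed (use meas in \<open>auto simp: ennreal_less_top\<close>)
  moreover have "(\<lambda>x. indicator {0..1::real} x *\<^sub>R (indicator {0..1} x *\<^sub>R f x)) = (\<lambda>x. indicator {0..1} x *\<^sub>R f x)"
    by (rule ext) (simp add: indicator_def)
  ultimately show ?thesis unfolding set_integrable_def by metis
qed

lemma iter_prim_set_integrable: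
  fixes f :: "real \<Rightarrow> real"
  assumes "mono_on {0..1} f"
  shows "set_integrable lborel {0..1} (iter_prim rs 0 f)"
  by (induction rs) (auto intro: prim_set_integrable mono_on_set_integrable[OF assms])

text \<open>The first difference of a primitive is an integral over \<open>x..x + h\<close>, in
  which the additive constant has cancelled; further differences pass under the integral by
  translation.\<close>

lemma hfd_prim:
  assumes g: "g integrable_on {0..1}" and G: "\<And>x. x \<in> {0..1} \<Longrightarrow> G x = integral {0..x} g + c"
    and h: "h \<ge> 0" "0 \<le> x" "x + real (Suc m) * h \<le> 1"
  shows "hfd m h g integrable_on {x..x+h} \<and> hfd (Suc m) h G x = integral {x..x+h} (hfd m h g)"
  using h(2,3)
proof (induction m arbitrary: x)
  case 0
  have "g integrable_on {0..x+h}" using 0 h by (intro integrable_on_subinterval[OF g]) auto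
  then have "integral {0..x} g + integral {x..x+h} g = integral {0..x+h} g"
    using 0 h by (intro Henstock_Kurzweil_Integration.integral_combine) auto
  moreover have "g integrable_on {x..x+h}" using 0 h by (intro integrable_on_subinterval[OF g]) auto
  moreover have "hfd 0 h g = g" by (rule ext) simp
  ultimately show ?case using G[of x] G[of "x+h"] 0 h by simp
next
  case (Suc m)
  have 1: "hfd m h g integrable_on {x..x+h}" "hfd (Suc m) h G x = integral {x..x+h} (hfd m h g)"
    using Suc.IH[of x] Suc.prems h by (auto simp: algebra_simps)
  have 2: "hfd m h g integrable_on {x+h..x+h+h}" "hfd (Suc m) h G (x+h) = integral {x+h..x+h+h} (hfd m h g)"
    using Suc.IH[of "x+h"] Suc.prems h by (auto simp: algebra_simps)
  have 3: "(\<lambda>y. hfd m h g (y + h)) integrable_on {x..x+h}"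
    using 2(1) integrable_on_shift_Icc_real[of "hfd m h g" h x "x+h"] by (simp add: o_def add.commute)
  have 4: "integral {x+h..x+h+h} (hfd m h g) = integral {x..x+h} (\<lambda>y. hfd m h g (y + h))"
    using integral_shift_Icc_real[of x "x+h" "hfd m h g" h] by (simp add: o_def add.commute)
  have e: "hfd (Suc m) h g = (\<lambda>y. hfd m h g (y + h) - hfd m h g y)" by (rule ext) simp
  have "hfd (Suc (Suc m)) h G x = hfd (Suc m) h G (x + h) - hfd (Suc m) h G x"
    by (rule hfd.simps(2))
  also have "\<dots> = integral {x..x+h} (hfd (Suc m) h g)"
    unfolding 1(2) 2(2) 4 e using 1(1) 3 by (rule Henstock_Kurzweil_Integration.integral_diff[symmetric, rotated])
  finally show ?case using 1(1) 3 unfolding e by (auto intro: integrable_diff)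
qed

lemma iter_prim_hfd_step:
  fixes f :: "real \<Rightarrow> real"
  assumes f: "mono_on {0..1} f" and h: "h \<ge> 0" "0 \<le> x" "x + real (Suc m) * h \<le> 1"
  shows "hfd m h (iter_prim rs 0 f) integrable_on {x..x+h}"
    "hfd (Suc m) h (iter_prim (c # rs) 0 f) x = integral {x..x+h} (hfd m h (iter_prim rs 0 f))"
proof -
  note si = iter_prim_set_integrable[OF f, where rs = rs]
  have "hfd m h (iter_prim rs 0 f) integrable_on {x..x+h} \<and>
     hfd (Suc m) h (iter_prim (c # rs) 0 f) x = integral {x..x+h} (hfd m h (iter_prim rs 0 f))"
    unfolding iter_prim.simps
    by (rule hfd_prim[OF set_borel_integral_eq_integral(1)[OF si] prim_eq_integral[OF si] h])
  then show "hfd m h (iter_prim rs 0 f) integrable_on {x..x+h}"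
    "hfd (Suc m) h (iter_prim (c # rs) 0 f) x = integral {x..x+h} (hfd m h (iter_prim rs 0 f))" by blast+
qed

text \<open>Each integration absorbs one difference, until the first difference of the monotone
  function is left.\<close>

lemma iter_prim_hfd:
  fixes f :: "real \<Rightarrow> real"
  assumes f: "mono_on {0..1} f" and h: "h \<ge> 0"
  shows "0 \<le> x \<Longrightarrow> x + real (Suc (length rs)) * h \<le> 1 \<Longrightarrow> 0 \<le> hfd (Suc (length rs)) h (iter_prim rs 0 f) x"
proof (induction rs arbitrary: x)
  case Nil
  then show ?case using mono_onD[OF f, of x "x+h"] h by auto
next
  case (Cons c rs)
  note step = iter_prim_hfd_step[OF f h Cons.prems[unfolded length_Cons], where rs = rs]
  have "0 \<le> integral {x..x+h} (hfd (Suc (length rs)) h (iter_prim rs 0 f))"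
    by (intro integral_nonneg step(1) Cons.IH) (use Cons.prems in \<open>auto simp: algebra_simps\<close>)
  then show ?case unfolding length_Cons step(2) .
qed

text \<open>The same descent. All points sampled lie to the right of \<open>a\<close> and up to
  \<open>b\<close>, matching the left-open intervals of constancy in
  \<open>mono_step\<close>.\<close>

lemma iter_prim_hfd_zero:
  fixes f :: "real \<Rightarrow> real"
  assumes f: "mono_on {0..1} f" and h: "h \<ge> 0" and ab: "0 \<le> a" "b \<le> 1" and const: "\<And>y. a < y \<Longrightarrow> y \<le> b \<Longrightarrow> f y = z"
  shows "a < x \<Longrightarrow> x + real (Suc (length rs)) * h \<le> b \<Longrightarrow> hfd (Suc (length rs)) h (iter_prim rs 0 f) x = 0"
proof (induction rs arbitrary: x)
  case Nil
  then show ?case using const[of x] const[of "x+h"] h by auto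
next
  case (Cons c rs)
  have x: "0 \<le> x" "x + real (Suc (Suc (length rs))) * h \<le> 1" using Cons.prems ab by auto
  have "integral {x..x+h} (hfd (Suc (length rs)) h (iter_prim rs 0 f)) = integral {x..x+h} (\<lambda>y. 0)"
    by (intro Henstock_Kurzweil_Integration.integral_cong Cons.IH) (use Cons.prems in \<open>auto simp: algebra_simps\<close>)
  then show ?case unfolding length_Cons iter_prim_hfd_step(2)[OF f h x] by simp
qed

text \<open>Everything that the upper bound uses about splines: the differences of order
  \<open>d + 1\<close> are nonnegative throughout and vanish when their window stays between
  consecutive knots. Indices start at 1, where the sample starts.\<close>

lemma Theta_structure:
  assumes "\<theta> \<in> Theta n d k" "n > 0"
  obtains \<mu> :: "nat \<Rightarrow> nat" where "\<mu> 0 = 0" "\<mu> k = n" "\<And>i. i < k \<Longrightarrow> \<mu> i \<le> \<mu> (Suc i)"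
    "\<And>i. 1 \<le> i \<Longrightarrow> i + Suc d \<le> n \<Longrightarrow> fd (Suc d) \<theta> i \<ge> 0"
    "\<And>i j. j < k \<Longrightarrow> \<mu> j < i \<Longrightarrow> i + Suc d \<le> \<mu> (Suc j) \<Longrightarrow> fd (Suc d) \<theta> i = 0"
proof -
  obtain rs f where f: "length rs = d" "f \<in> mono_step n k" "\<And>i. i \<in> {1..n} \<Longrightarrow> \<theta> i = iter_prim rs 0 f (real i / real n)"
    using assms unfolding Theta_def mono_spline_def by auto
  then obtain \<mu> where m: "mono_on {0..1} f" "\<mu> 0 = (0::nat)" "\<mu> k = n"
     "\<And>i. i \<in> {1..k} \<Longrightarrow> \<mu> (i - 1) \<le> \<mu> i \<and> f constant_on {real (\<mu> (i - 1)) / real n <.. real (\<mu> i) / real n}"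
    unfolding mono_step_def by auto
  define g where "g = iter_prim rs 0 f"
  have fde: "fd (Suc d) \<theta> i = hfd (Suc d) (1 / real n) g (real i / real n)" if "1 \<le> i" "i + Suc d \<le> n" for i
    unfolding fd_eq_hfd[symmetric] by (rule fd_cong) (use f(3) that in \<open>auto simp: g_def\<close>)
  have mono: "\<mu> i \<le> \<mu> (Suc i)" if "i < k" for i using m(4)[of "Suc i"] that by auto
  have mn: "\<mu> j \<le> n" if "j \<le> k" for j
    using that m(3) by (induction j rule: inc_induct) (use mono in \<open>auto intro: le_trans\<close>)
  show ?thesis
  proof (rule that[of \<mu>])
    fix i assume i: "1 \<le> i" "i + Suc d \<le> n"
    have "real i / real n + real (Suc d) * (1 / real n) = real (i + Suc d) / real n"
      by (simp add: add_divide_distrib)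
    also have "\<dots> \<le> 1" using i(2) assms(2) by (simp only: divide_le_eq_1 of_nat_le_iff) simp
    finally show "fd (Suc d) \<theta> i \<ge> 0"
      unfolding fde[OF i] g_def using iter_prim_hfd[OF m(1), of "1 / real n" "real i / real n" rs] f(1) by simp
  next
    fix i j assume ij: "j < k" "\<mu> j < i" "i + Suc d \<le> \<mu> (Suc j)"
    have le: "\<mu> (Suc j) \<le> n" using mn[of "Suc j"] ij by simp
    have i: "1 \<le> i" "i + Suc d \<le> n" using ij le by auto
    obtain z where z: "\<And>y. real (\<mu> j) / real n < y \<Longrightarrow> y \<le> real (\<mu> (Suc j)) / real n \<Longrightarrow> f y = z"
      using m(4)[of "Suc j"] ij(1) unfolding constant_on_def by auto
    have "real i / real n + real (Suc d) * (1 / real n) = real (i + Suc d) / real n"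
      by (simp add: add_divide_distrib)
    also have "\<dots> \<le> real (\<mu> (Suc j)) / real n" using ij(3) by (intro divide_right_mono) (simp_all only: of_nat_le_iff of_nat_0_le_iff)
    finally have e: "real i / real n + real (Suc d) * (1 / real n) \<le> real (\<mu> (Suc j)) / real n" .
    have "hfd (Suc (length rs)) (1 / real n) (iter_prim rs 0 f) (real i / real n) = 0"
    proof (rule iter_prim_hfd_zero[OF m(1)])
      show "real (\<mu> j) / real n < real i / real n" using ij(2) assms(2) by (simp add: divide_strict_right_mono)
      show "real (\<mu> (Suc j)) / real n \<le> 1" using le assms(2) by simp
    qed (use z e f(1) in auto)
    then show "fd (Suc d) \<theta> i = 0" unfolding fde[OF i] g_def using f(1) by simp
  qed (use m mono in auto)
qed

section \<open>Gaussian noise\<close>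

lemma space_noise: "space (noise n \<sigma>) = space (Rn n)"
  by (simp add: noise_def Rn_def space_PiM)

lemma sets_noise: "sets (noise n \<sigma>) = sets (Rn n)"
  unfolding noise_def Rn_def by (rule sets_PiM_cong) auto

lemma measurable_noise: "measurable (noise n \<sigma>) M = measurable (Rn n) M"
  by (rule measurable_cong_sets) (auto simp: sets_noise)

lemma Rn_component: "i \<in> {1..n} \<Longrightarrow> (\<lambda>\<epsilon>. \<epsilon> i) \<in> borel_measurable (Rn n)"
  unfolding Rn_def by (rule measurable_component_singleton)

lemma Rn_linear: "(\<lambda>\<epsilon>. \<Sum>i=1..n. c i * \<epsilon> i) \<in> borel_measurable (Rn n)"
  by (intro borel_measurable_sum borel_measurable_times borel_measurable_const Rn_component)

lemma prob_space_noise: "\<sigma> > 0 \<Longrightarrow> prob_space (noise n \<sigma>)"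
  unfolding noise_def by (intro prob_space_PiM prob_space_normal_density) auto

lemma normal_mgf:
  assumes "\<sigma> > 0"
  shows "(\<integral>\<^sup>+x. ennreal (exp (c * x)) \<partial>density lborel (\<lambda>x. ennreal (normal_density 0 \<sigma> x))) = ennreal (exp (\<sigma>\<^sup>2 * c\<^sup>2 / 2))"
proof -
  have e: "normal_density 0 \<sigma> x * exp (c * x) = exp (\<sigma>\<^sup>2 * c\<^sup>2 / 2) * normal_density (\<sigma>\<^sup>2 * c) \<sigma> x" for x
  proof -
    have "- (x\<^sup>2 / (2 * \<sigma>\<^sup>2)) + c * x = \<sigma>\<^sup>2 * c\<^sup>2 / 2 + - ((x - \<sigma>\<^sup>2 * c)\<^sup>2 / (2 * \<sigma>\<^sup>2))"
      using assms by (simp add: field_simps power2_eq_square)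
    then have "exp (- (x\<^sup>2 / (2 * \<sigma>\<^sup>2))) * exp (c * x) = exp (\<sigma>\<^sup>2 * c\<^sup>2 / 2) * exp (- ((x - \<sigma>\<^sup>2 * c)\<^sup>2 / (2 * \<sigma>\<^sup>2)))"
      by (simp flip: exp_add)
    then show ?thesis by (simp add: normal_density_def field_simps)
  qed
  have "(\<integral>\<^sup>+x. ennreal (exp (c * x)) \<partial>density lborel (\<lambda>x. ennreal (normal_density 0 \<sigma> x)))
     = (\<integral>\<^sup>+x. ennreal (normal_density 0 \<sigma> x) * ennreal (exp (c * x)) \<partial>lborel)"
    by (rule nn_integral_density) auto
  also have "\<dots> = (\<integral>\<^sup>+x. ennreal (exp (\<sigma>\<^sup>2 * c\<^sup>2 / 2)) * ennreal (normal_density (\<sigma>\<^sup>2 * c) \<sigma> x) \<partial>lborel)"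
    by (simp add: ennreal_mult[symmetric] e)
  also have "\<dots> = ennreal (exp (\<sigma>\<^sup>2 * c\<^sup>2 / 2)) * (\<integral>\<^sup>+x. ennreal (normal_density (\<sigma>\<^sup>2 * c) \<sigma> x) \<partial>lborel)"
    by (rule nn_integral_cmult) auto
  also have "(\<integral>\<^sup>+x. ennreal (normal_density (\<sigma>\<^sup>2 * c) \<sigma> x) \<partial>lborel) = 1"
    using prob_space.emeasure_space_1[OF prob_space_normal_density[OF assms, of "\<sigma>\<^sup>2 * c"]]
    by (simp add: emeasure_density)
  finally show ?thesis by simp
qed

lemma product_sigma_finite_normal:
  assumes "\<sigma> > 0"
  shows "product_sigma_finite (\<lambda>_. density lborel (\<lambda>x. ennreal (normal_density 0 \<sigma> x)))"
  by (simp add: product_sigma_finite_def prob_space_imp_sigma_finite prob_space_normal_density assms)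

lemma noise_mgf:
  assumes "\<sigma> > 0"
  shows "(\<integral>\<^sup>+\<epsilon>. ennreal (exp (\<Sum>i=1..n. c i * \<epsilon> i)) \<partial>noise n \<sigma>) = ennreal (exp (\<sigma>\<^sup>2 * (\<Sum>i=1..n. (c i)\<^sup>2) / 2))"
proof -
  interpret product_sigma_finite "\<lambda>_::nat. density lborel (\<lambda>x. ennreal (normal_density 0 \<sigma> x))"
    by (rule product_sigma_finite_normal[OF assms])
  have "(\<integral>\<^sup>+\<epsilon>. ennreal (exp (\<Sum>i=1..n. c i * \<epsilon> i)) \<partial>noise n \<sigma>) =
      (\<integral>\<^sup>+\<epsilon>. (\<Prod>i=1..n. ennreal (exp (c i * \<epsilon> i))) \<partial>noise n \<sigma>)"
    by (simp add: exp_sum prod_ennreal)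
  also have "\<dots> = (\<Prod>i=1..n. \<integral>\<^sup>+x. ennreal (exp (c i * x)) \<partial>density lborel (\<lambda>x. ennreal (normal_density 0 \<sigma> x)))"
    unfolding noise_def by (rule product_nn_integral_prod) auto
  also have "\<dots> = ennreal (exp (\<sigma>\<^sup>2 * (\<Sum>i=1..n. (c i)\<^sup>2) / 2))"
    unfolding normal_mgf[OF assms] by (simp add: prod_ennreal exp_sum[symmetric] sum_distrib_left sum_divide_distrib)
  finally show ?thesis .
qed

text \<open>A Chernoff bound for the excess with slope \<open>sqrt w\<close>, adapted to the
  threshold. With \<open>r = |g| / sqrt w >= 1\<close> it reduces to
  \<open>r^2 <= exp (2 (r - 1)) <= exp (w (r - 1))\<close>; the last step uses
  \<open>w >= 2\<close>.\<close>

lemma excess_le_exp: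
  fixes g w :: real
  assumes "w \<ge> 2"
  shows "max 0 (g\<^sup>2 - w) \<le> w * exp (- w) * (exp (sqrt w * g) + exp (- sqrt w * g))"
proof -
  define r where "r = \<bar>g\<bar> / sqrt w"
  have w: "sqrt w > 0" using assms by simp
  have abs: "exp (sqrt w * \<bar>g\<bar>) \<le> exp (sqrt w * g) + exp (- sqrt w * g)"
    by (cases "g \<ge> 0") auto
  have g: "\<bar>g\<bar> = r * sqrt w" using w by (simp add: r_def)
  show ?thesis
  proof (cases "g\<^sup>2 \<le> w")
    case True
    then have "max 0 (g\<^sup>2 - w) = 0" by simp
    also have "0 \<le> w * exp (- w) * (exp (sqrt w * g) + exp (- sqrt w * g))"
      using assms by (intro mult_nonneg_nonneg add_nonneg_nonneg) auto
    finally show ?thesis .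
  next
    case False
    then have "sqrt w \<le> \<bar>g\<bar>" by (metis less_eq_real_def not_le real_sqrt_abs real_sqrt_less_iff)
    then have r1: "r \<ge> 1" using w by (simp add: r_def)
    have gs: "g\<^sup>2 = r\<^sup>2 * w" using g w assms by (metis power2_abs power_mult_distrib real_sqrt_pow2 less_eq_real_def zero_less_numeral le_less_trans not_le)
    have "r \<le> exp (r - 1)" using exp_ge_add_one_self[of "r - 1"] by simp
    then have "r\<^sup>2 \<le> (exp (r - 1))\<^sup>2" using r1 by (intro power_mono) auto
    also have "\<dots> = exp (2 * (r - 1))" by (simp add: power2_eq_square flip: exp_add)
    also have "\<dots> \<le> exp (w * (r - 1))" unfolding exp_le_cancel_iff using assms r1 by (intro mult_right_mono) auto
    also have "\<dots> = exp (- w) * exp (sqrt w * \<bar>g\<bar>)"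
      unfolding g using assms by (simp flip: exp_add) (simp add: algebra_simps)
    finally have "r\<^sup>2 \<le> exp (- w) * exp (sqrt w * \<bar>g\<bar>)" .
    then have "w * r\<^sup>2 \<le> w * (exp (- w) * exp (sqrt w * \<bar>g\<bar>))" using assms by (intro mult_left_mono) auto
    also have "\<dots> \<le> w * (exp (- w) * (exp (sqrt w * g) + exp (- sqrt w * g)))"
      using assms abs by (intro mult_left_mono) auto
    finally have "g\<^sup>2 \<le> w * exp (- w) * (exp (sqrt w * g) + exp (- sqrt w * g))" using gs by (simp add: mult_ac)
    moreover have "max 0 (g\<^sup>2 - w) \<le> g\<^sup>2" using assms by simp
    ultimately show ?thesis by linarith
  qed
qed

lemma noise_linear_excess:
  assumes s: "\<sigma> > 0" and w: "w \<ge> 2" and c: "\<sigma>\<^sup>2 * (\<Sum>i=1..n. (c i)\<^sup>2) \<le> 1"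
  shows "(\<integral>\<^sup>+\<epsilon>. ennreal (max 0 ((\<Sum>i=1..n. c i * \<epsilon> i)\<^sup>2 - w)) \<partial>noise n \<sigma>) \<le> ennreal (8 * exp (- w / 4))"
proof -
  define E where "E s \<epsilon> = exp (\<Sum>i=1..n. (s * c i) * \<epsilon> i)" for s and \<epsilon> :: "nat \<Rightarrow> real"
  have Em: "(\<lambda>\<epsilon>. ennreal (E s \<epsilon>)) \<in> borel_measurable (noise n \<sigma>)" for s
    unfolding measurable_noise E_def using Rn_linear[where n = n and c = "\<lambda>i. s * c i"] by measurable
  have EE: "(\<integral>\<^sup>+\<epsilon>. ennreal (E s \<epsilon>) \<partial>noise n \<sigma>) \<le> ennreal (exp (w / 2))" if "s\<^sup>2 = w" for s
  proof -
    have "\<sigma>\<^sup>2 * (\<Sum>i=1..n. (s * c i)\<^sup>2) = w * (\<sigma>\<^sup>2 * (\<Sum>i=1..n. (c i)\<^sup>2))"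
      using that by (simp add: power_mult_distrib sum_distrib_left[symmetric] mult_ac)
    also have "\<dots> \<le> w * 1" using c w by (intro mult_left_mono) auto
    finally show ?thesis unfolding E_def noise_mgf[OF s] by (intro ennreal_leI) simp
  qed
  have "(\<integral>\<^sup>+\<epsilon>. ennreal (max 0 ((\<Sum>i=1..n. c i * \<epsilon> i)\<^sup>2 - w)) \<partial>noise n \<sigma>) \<le>
     (\<integral>\<^sup>+\<epsilon>. ennreal (w * exp (- w)) * (ennreal (E (sqrt w) \<epsilon>) + ennreal (E (- sqrt w) \<epsilon>)) \<partial>noise n \<sigma>)"
  proof (rule nn_integral_mono)
    fix \<epsilon>
    have "max 0 ((\<Sum>i=1..n. c i * \<epsilon> i)\<^sup>2 - w) \<le> w * exp (- w) * (E (sqrt w) \<epsilon> + E (- sqrt w) \<epsilon>)"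
      unfolding E_def using excess_le_exp[OF w, of "\<Sum>i=1..n. c i * \<epsilon> i"]
      by (simp add: sum_distrib_left sum_negf mult.assoc)
    also have "ennreal \<dots> = ennreal (w * exp (- w)) * (ennreal (E (sqrt w) \<epsilon>) + ennreal (E (- sqrt w) \<epsilon>))"
      using w by (simp add: ennreal_mult' ennreal_plus E_def)
    finally show "ennreal (max 0 ((\<Sum>i=1..n. c i * \<epsilon> i)\<^sup>2 - w)) \<le>
       ennreal (w * exp (- w)) * (ennreal (E (sqrt w) \<epsilon>) + ennreal (E (- sqrt w) \<epsilon>))"
      by (simp add: ennreal_leI)
  qed
  also have "\<dots> = ennreal (w * exp (- w)) * ((\<integral>\<^sup>+\<epsilon>. ennreal (E (sqrt w) \<epsilon>) \<partial>noise n \<sigma>) + (\<integral>\<^sup>+\<epsilon>. ennreal (E (- sqrt w) \<epsilon>) \<partial>noise n \<sigma>))"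
    using Em by (subst nn_integral_cmult) (auto simp: nn_integral_add)
  also have "\<dots> \<le> ennreal (w * exp (- w)) * (ennreal (exp (w / 2)) + ennreal (exp (w / 2)))"
    using w by (intro mult_left_mono add_mono EE) auto
  also have "\<dots> = ennreal (w * exp (- w) * (exp (w / 2) + exp (w / 2)))"
    unfolding ennreal_plus[symmetric, OF exp_ge_zero exp_ge_zero] using w by (intro ennreal_mult'[symmetric]) auto
  also have "\<dots> \<le> ennreal (8 * exp (- w / 4))"
  proof (rule ennreal_leI)
    \<comment> \<open>What has to be bounded is \<open>2 w exp (- w / 2)\<close>; the factor
      \<open>w\<close> is traded for half of the exponent.\<close>
    have "w / 4 \<le> exp (w / 4)" using exp_ge_add_one_self[of "w / 4"] by linarith
    then have "2 * w * exp (- (w / 2)) \<le> 2 * (4 * exp (w / 4)) * exp (- (w / 2))" by (intro mult_right_mono mult_left_mono) auto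
    also have "\<dots> = 8 * exp (- w / 4)" by (simp flip: exp_add)
    finally show "w * exp (- w) * (exp (w / 2) + exp (w / 2)) \<le> 8 * exp (- w / 4)"
      by (simp add: algebra_simps flip: exp_add)
  qed
  finally show ?thesis .
qed

text \<open>Positions are relative to \<open>\<alpha>\<close>, and the noise is continued by 0
  beyond \<open>N\<close>, so that the dyadic tree can be taken over \<open>2 ^ r > N\<close>
  positions.\<close>

definition dyadic_sum :: "nat \<Rightarrow> nat \<Rightarrow> nat \<Rightarrow> nat \<Rightarrow> (nat \<Rightarrow> real) \<Rightarrow> real" where
  "dyadic_sum \<alpha> N h j \<epsilon> = (\<Sum>i=j * 2 ^ h..<Suc j * 2 ^ h. if i < N then \<epsilon> (\<alpha> + i) else 0)"

text \<open>
  Dyadic chaining in place of a maximal inequality.  The weight \<open>3/4\<close> exceeds \<open>1 / sqrt 2\<close>, the loss of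
  standard deviation per level; the threshold grows by 8 per level because the number of
  blocks doubles.
\<close>

definition excess :: "real \<Rightarrow> real \<Rightarrow> nat \<Rightarrow> nat \<Rightarrow> (nat \<Rightarrow> real) \<Rightarrow> real" where
  "excess \<sigma> w \<alpha> N \<epsilon> = (\<Sum>h<Suc (floor_log N). (3/4) ^ (Suc (floor_log N) - h) *
     (\<Sum>j<2 ^ (Suc (floor_log N) - h). max 0 ((dyadic_sum \<alpha> N h j \<epsilon>)\<^sup>2 / (2 ^ h * \<sigma>\<^sup>2) - (w + 8 * real (Suc (floor_log N) - h)))))"

lemma excess_nonneg: "excess \<sigma> w \<alpha> N \<epsilon> \<ge> 0"
  unfolding excess_def by (intro sum_nonneg mult_nonneg_nonneg) auto

lemma dyadic_sum_linear:
  assumes "{\<alpha>..<\<alpha> + N} \<subseteq> {1..n}"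
  obtains J where "J \<subseteq> {1..n}" "card J \<le> 2 ^ h" "\<And>\<epsilon>. dyadic_sum \<alpha> N h j \<epsilon> = (\<Sum>i\<in>J. \<epsilon> i)"
proof
  define I where "I = {j * 2 ^ h..<Suc j * 2 ^ h} \<inter> {..<N}"
  show "(+) \<alpha> ` I \<subseteq> {1..n}" using assms by (auto simp: I_def)
  have "card ((+) \<alpha> ` I) \<le> card I" by (rule card_image_le) (simp add: I_def)
  also have "\<dots> \<le> card {j * 2 ^ h..<Suc j * 2 ^ h}" by (rule card_mono) (auto simp: I_def)
  finally show "card ((+) \<alpha> ` I) \<le> 2 ^ h" by simp
  show "dyadic_sum \<alpha> N h j \<epsilon> = (\<Sum>i\<in>(+) \<alpha> ` I. \<epsilon> i)" for \<epsilon>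
  proof -
    have "dyadic_sum \<alpha> N h j \<epsilon> = (\<Sum>i\<in>I. \<epsilon> (\<alpha> + i))"
      unfolding dyadic_sum_def I_def by (subst sum.inter_filter[symmetric]) (auto intro!: sum.cong)
    also have "\<dots> = (\<Sum>i\<in>(+) \<alpha> ` I. \<epsilon> i)" by (subst sum.reindex) (auto simp: o_def)
    finally show ?thesis .
  qed
qed

text \<open>A block cut off at \<open>N\<close> may have fewer than \<open>2 ^ h\<close> terms;
  normalisation by \<open>2 ^ h\<close> still makes the variance at most 1, as the tail bound
  asks.\<close>

lemma dyadic_sum_excess:
  assumes s: "\<sigma> > 0" and w: "w \<ge> 2" and sub: "{\<alpha>..<\<alpha> + N} \<subseteq> {1..n}"
  shows "(\<lambda>\<epsilon>. ennreal (max 0 ((dyadic_sum \<alpha> N h j \<epsilon>)\<^sup>2 / (2 ^ h * \<sigma>\<^sup>2) - w))) \<in> borel_measurable (noise n \<sigma>)"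
    "(\<integral>\<^sup>+\<epsilon>. ennreal (max 0 ((dyadic_sum \<alpha> N h j \<epsilon>)\<^sup>2 / (2 ^ h * \<sigma>\<^sup>2) - w)) \<partial>noise n \<sigma>) \<le> ennreal (8 * exp (- w / 4))"
proof -
  obtain J where J: "J \<subseteq> {1..n}" "card J \<le> 2 ^ h" "\<And>\<epsilon>. dyadic_sum \<alpha> N h j \<epsilon> = (\<Sum>i\<in>J. \<epsilon> i)"
    using dyadic_sum_linear[OF sub] by metis
  define q where "q = sqrt (2 ^ h * \<sigma>\<^sup>2)"
  have q: "q > 0" "q\<^sup>2 = 2 ^ h * \<sigma>\<^sup>2" using s by (auto simp: q_def)
  define c where "c i = (if i \<in> J then 1 / q else 0)" for i
  have lin: "(\<Sum>i=1..n. c i * \<epsilon> i) = dyadic_sum \<alpha> N h j \<epsilon> / q" for \<epsilon>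
  proof -
    have "(\<Sum>i=1..n. c i * \<epsilon> i) = (\<Sum>i\<in>J. \<epsilon> i / q)"
      using J(1) by (intro sum.mono_neutral_cong_right) (auto simp: c_def)
    then show ?thesis by (simp add: J(3) sum_divide_distrib)
  qed
  have e: "(dyadic_sum \<alpha> N h j \<epsilon>)\<^sup>2 / (2 ^ h * \<sigma>\<^sup>2) = (\<Sum>i=1..n. c i * \<epsilon> i)\<^sup>2" for \<epsilon>
    unfolding lin by (simp add: power_divide q(2))
  show "(\<lambda>\<epsilon>. ennreal (max 0 ((dyadic_sum \<alpha> N h j \<epsilon>)\<^sup>2 / (2 ^ h * \<sigma>\<^sup>2) - w))) \<in> borel_measurable (noise n \<sigma>)"
    unfolding e measurable_noise using Rn_linear[where n = n and c = c] by measurable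
  have "(\<Sum>i=1..n. (c i)\<^sup>2) = (\<Sum>i\<in>J. 1 / q\<^sup>2)"
    using J(1) by (intro sum.mono_neutral_cong_right) (auto simp: c_def power_divide)
  also have "\<dots> = real (card J) / (2 ^ h * \<sigma>\<^sup>2)" by (simp add: q(2))
  finally have "\<sigma>\<^sup>2 * (\<Sum>i=1..n. (c i)\<^sup>2) = real (card J) / 2 ^ h" using s by (simp add: field_simps)
  also have "\<dots> \<le> 1" using J(2) by (simp add: divide_le_eq_1 of_nat_le_iff[of _ "2^h", simplified, symmetric])
  finally show "(\<integral>\<^sup>+\<epsilon>. ennreal (max 0 ((dyadic_sum \<alpha> N h j \<epsilon>)\<^sup>2 / (2 ^ h * \<sigma>\<^sup>2) - w)) \<partial>noise n \<sigma>) \<le> ennreal (8 * exp (- w / 4))"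
    unfolding e by (intro noise_linear_excess s w)
qed

section \<open>Mean and pathwise use of the excess\<close>

lemma sum_reverse_levels: "(\<Sum>h<r. f (r - h)) = (\<Sum>i<r. f (Suc i :: nat) :: real)"
proof -
  have "(\<Sum>h<r. f (r - h)) = (\<Sum>h<r. f (Suc (r - Suc h)))" by (intro sum.cong) (auto simp: Suc_diff_Suc)
  also have "\<dots> = (\<Sum>i<r. f (Suc i))" by (rule sum.nat_diff_reindex)
  finally show ?thesis .
qed

lemma geometric_sums:
  "(\<Sum>i<r. (3/4::real) ^ Suc i) \<le> 3" "(\<Sum>i<r. real (Suc i) * (3/4::real) ^ Suc i) \<le> 12" "(\<Sum>i<r. (1/2::real) ^ Suc i) \<le> 1"
proof -
  have "(\<Sum>i<r. (3/4::real) ^ Suc i) = 3 - 3 * (3/4) ^ r" by (induction r) (auto simp: algebra_simps)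
  then show "(\<Sum>i<r. (3/4::real) ^ Suc i) \<le> 3" by simp
  have "(\<Sum>i<r. real (Suc i) * (3/4::real) ^ Suc i) = 12 - (3 * real r + 12) * (3/4) ^ r"
  proof (induction r)
    case (Suc r)
    show ?case unfolding sum.lessThan_Suc Suc.IH by (simp add: field_simps)
  qed simp
  then show "(\<Sum>i<r. real (Suc i) * (3/4::real) ^ Suc i) \<le> 12" by simp
  have "(\<Sum>i<r. (1/2::real) ^ Suc i) = 1 - (1/2) ^ r" by (induction r) (auto simp: algebra_simps)
  then show "(\<Sum>i<r. (1/2::real) ^ Suc i) \<le> 1" by simp
qed

text \<open>With \<open>i = r - h\<close> there are \<open>2 ^ i\<close> blocks of weight
  \<open>(3/4) ^ i\<close>, each with mean at most \<open>8 exp (- w / 4) exp (- 2 i)\<close>. Since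
  \<open>exp (-2) <= 1/3\<close>, level \<open>i\<close> contributes at most
  \<open>(1/2) ^ i\<close> times \<open>8 exp (- w / 4)\<close>, and the levels start at
  \<open>i = 1\<close>.\<close>

lemma excess_expectation:
  assumes "\<sigma> > 0" "w \<ge> 2" "{\<alpha>..<\<alpha> + N} \<subseteq> {1..n}"
  shows "(\<lambda>\<epsilon>. ennreal (excess \<sigma> w \<alpha> N \<epsilon>)) \<in> borel_measurable (noise n \<sigma>)"
    and "(\<integral>\<^sup>+\<epsilon>. ennreal (excess \<sigma> w \<alpha> N \<epsilon>) \<partial>noise n \<sigma>) \<le> ennreal (8 * exp (- w / 4))"
proof -
  define r where "r = Suc (floor_log N)"
  define X where "X h j \<epsilon> = max 0 ((dyadic_sum \<alpha> N h j \<epsilon>)\<^sup>2 / (2 ^ h * \<sigma>\<^sup>2) - (w + 8 * real (r - h)))" for h j \<epsilon>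
  have w8: "w + 8 * real i \<ge> 2" for i using assms(2) by simp
  have Xm: "(\<lambda>\<epsilon>. ennreal (X h j \<epsilon>)) \<in> borel_measurable (noise n \<sigma>)" for h j
    unfolding X_def by (rule dyadic_sum_excess(1)[OF assms(1) w8 assms(3)])
  have Xi: "(\<integral>\<^sup>+\<epsilon>. ennreal (X h j \<epsilon>) \<partial>noise n \<sigma>) \<le> ennreal (8 * exp (- (w + 8 * real (r - h)) / 4))" for h j
    unfolding X_def by (rule dyadic_sum_excess(2)[OF assms(1) w8 assms(3)])
  have X0: "X h j \<epsilon> \<ge> 0" for h j \<epsilon> by (simp add: X_def)
  have e: "ennreal (excess \<sigma> w \<alpha> N \<epsilon>) = (\<Sum>h<r. ennreal ((3/4) ^ (r - h)) * (\<Sum>j<2 ^ (r - h). ennreal (X h j \<epsilon>)))" for \<epsilon>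
  proof -
    have "excess \<sigma> w \<alpha> N \<epsilon> = (\<Sum>h<r. (3/4) ^ (r - h) * (\<Sum>j<2 ^ (r - h). X h j \<epsilon>))"
      by (simp add: excess_def X_def r_def)
    also have "ennreal \<dots> = (\<Sum>h<r. ennreal ((3/4) ^ (r - h) * (\<Sum>j<2 ^ (r - h). X h j \<epsilon>)))"
      by (rule sum_ennreal[symmetric]) (auto intro!: mult_nonneg_nonneg sum_nonneg X0)
    also have "\<dots> = (\<Sum>h<r. ennreal ((3/4) ^ (r - h)) * (\<Sum>j<2 ^ (r - h). ennreal (X h j \<epsilon>)))"
      by (intro sum.cong refl) (simp add: ennreal_mult' sum_ennreal X0)
    finally show ?thesis .
  qed
  show "(\<lambda>\<epsilon>. ennreal (excess \<sigma> w \<alpha> N \<epsilon>)) \<in> borel_measurable (noise n \<sigma>)"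
    unfolding e using Xm by measurable
  have "(\<integral>\<^sup>+\<epsilon>. ennreal (excess \<sigma> w \<alpha> N \<epsilon>) \<partial>noise n \<sigma>) =
      (\<Sum>h<r. ennreal ((3/4) ^ (r - h)) * (\<Sum>j<2 ^ (r - h). \<integral>\<^sup>+\<epsilon>. ennreal (X h j \<epsilon>) \<partial>noise n \<sigma>))"
    unfolding e using Xm by (simp add: nn_integral_sum nn_integral_cmult)
  also have "\<dots> \<le> (\<Sum>h<r. ennreal ((3/4) ^ (r - h)) * (\<Sum>j<(2::nat) ^ (r - h). ennreal (8 * exp (- (w + 8 * real (r - h)) / 4))))"
    by (intro sum_mono mult_left_mono Xi) auto
  also have "\<dots> = (\<Sum>h<r. ennreal ((3/4) ^ (r - h) * (2 ^ (r - h) * (8 * exp (- (w + 8 * real (r - h)) / 4)))))"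
    by (intro sum.cong refl) (simp add: ennreal_mult' ennreal_power[symmetric])
  also have "\<dots> \<le> (\<Sum>h<r. ennreal (8 * exp (- w / 4) * (1/2) ^ (r - h)))"
  proof (intro sum_mono ennreal_leI)
    fix h
    have "exp (-2) \<le> (1/3 :: real)"
      using exp_ge_add_one_self[of 2] by (simp add: exp_minus field_simps)
    then have "exp (-2) ^ (r - h) \<le> (1/3 :: real) ^ (r - h)" by (intro power_mono) auto
    moreover have "exp (-2) ^ (r - h) = exp (- 2 * real (r - h))" by (simp add: exp_of_nat_mult[symmetric] mult.commute)
    ultimately have "(3/2) ^ (r - h) * exp (- 2 * real (r - h)) \<le> (3/2) ^ (r - h) * (1/3) ^ (r - h)" by simp
    also have "\<dots> = (1/2 :: real) ^ (r - h)" by (simp flip: power_mult_distrib)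
    finally have 1: "(3/2) ^ (r - h) * exp (- 2 * real (r - h)) \<le> (1/2) ^ (r - h)" .
    have "(3/4) ^ (r - h) * (2 ^ (r - h) * (8 * exp (- (w + 8 * real (r - h)) / 4)))
       = 8 * exp (- w / 4) * (((3/4) ^ (r - h) * 2 ^ (r - h)) * exp (- 2 * real (r - h)))"
    proof -
      have "exp (- (w + 8 * real (r - h)) / 4) = exp (- w / 4) * exp (- 2 * real (r - h))"
        by (simp flip: exp_add)
      then show ?thesis by simp
    qed
    also have "(3/4) ^ (r - h) * 2 ^ (r - h) = (3/2 :: real) ^ (r - h)" by (simp flip: power_mult_distrib)
    also have "8 * exp (- w / 4) * ((3/2) ^ (r - h) * exp (- 2 * real (r - h))) \<le> 8 * exp (- w / 4) * (1/2) ^ (r - h)"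
      by (intro mult_left_mono 1) auto
    finally show "(3/4) ^ (r - h) * (2 ^ (r - h) * (8 * exp (- (w + 8 * real (r - h)) / 4))) \<le> 8 * exp (- w / 4) * (1/2) ^ (r - h)" .
  qed
  also have "\<dots> = ennreal (8 * exp (- w / 4) * (\<Sum>h<r. (1/2) ^ (r - h)))"
    by (subst sum_ennreal) (auto simp: sum_distrib_left)
  also have "\<dots> \<le> ennreal (8 * exp (- w / 4))"
  proof (rule ennreal_leI)
    have "(\<Sum>h<r. (1/2::real) ^ (r - h)) \<le> 1" unfolding sum_reverse_levels[of "\<lambda>i. (1/2) ^ i"] by (rule geometric_sums(3))
    then show "8 * exp (- w / 4) * (\<Sum>h<r. (1/2::real) ^ (r - h)) \<le> 8 * exp (- w / 4)"
      by (simp add: mult_left_le)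
  qed
  finally show "(\<integral>\<^sup>+\<epsilon>. ennreal (excess \<sigma> w \<alpha> N \<epsilon>) \<partial>noise n \<sigma>) \<le> ennreal (8 * exp (- w / 4))" .
qed

text \<open>Holds for every noise vector: a normalised squared dyadic sum is at most its threshold
  plus the excess of its level, and a weighted Cauchy-Schwarz inequality adds the levels.\<close>

lemma partial_sum_excess:
  assumes s: "\<sigma> > 0" and w: "w \<ge> 2" and t: "t \<le> N"
  shows "(\<Sum>i\<in>{\<alpha>..<\<alpha> + t}. \<epsilon> i)\<^sup>2 \<le> real N * (306 * \<sigma>\<^sup>2 * w + 306 * \<sigma>\<^sup>2 * excess \<sigma> w \<alpha> N \<epsilon>)"
proof (cases "N = 0")
  case True then show ?thesis using t by simp
next
  case False
  define r where "r = Suc (floor_log N)"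
  have r: "N < 2 ^ r" "2 ^ r \<le> 2 * N" using floor_log_bounds[of N] False by (auto simp: r_def)
  define X where "X h = (\<Sum>j<2 ^ (r - h). max 0 ((dyadic_sum \<alpha> N h j \<epsilon>)\<^sup>2 / (2 ^ h * \<sigma>\<^sup>2) - (w + 8 * real (r - h))))" for h
  define B where "B h = w + 8 * real (r - h) + X h" for h
  have X0: "X h \<ge> 0" for h unfolding X_def by (intro sum_nonneg) auto
  have B0: "B h \<ge> 0" for h using X0[of h] w by (simp add: B_def)
  define Y where "Y h = sqrt (2 ^ h * \<sigma>\<^sup>2 * B h)" for h
  define x where "x i = (if i < N then \<epsilon> (\<alpha> + i) else 0)" for i
  have "\<bar>\<Sum>i<t. x i\<bar> \<le> (\<Sum>h<r. Y h)"
  proof (rule dyadic_prefix_bound)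
    show "t < 2 ^ r" using t r by linarith
    fix h j :: nat assume hj: "h < r" "j < 2 ^ (r - h)"
    have "max 0 ((dyadic_sum \<alpha> N h j \<epsilon>)\<^sup>2 / (2 ^ h * \<sigma>\<^sup>2) - (w + 8 * real (r - h))) \<le> X h"
      unfolding X_def using hj by (intro member_le_sum) auto
    then have "(dyadic_sum \<alpha> N h j \<epsilon>)\<^sup>2 / (2 ^ h * \<sigma>\<^sup>2) \<le> B h" unfolding B_def by linarith
    then have "(dyadic_sum \<alpha> N h j \<epsilon>)\<^sup>2 \<le> 2 ^ h * \<sigma>\<^sup>2 * B h" using s by (simp add: field_simps)
    then have "\<bar>dyadic_sum \<alpha> N h j \<epsilon>\<bar> \<le> Y h" unfolding Y_def by (metis real_sqrt_abs real_sqrt_le_iff)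
    then show "\<bar>\<Sum>i=j * 2 ^ h..<Suc j * 2 ^ h. x i\<bar> \<le> Y h" by (simp add: dyadic_sum_def x_def)
  qed
  then have "(\<Sum>i<t. x i)\<^sup>2 \<le> (\<Sum>h<r. Y h)\<^sup>2" by (metis abs_ge_zero power2_abs power_mono)
  also have "\<dots> \<le> (\<Sum>h<r. (3/4) ^ (r - h)) * (\<Sum>h<r. 2 ^ r * \<sigma>\<^sup>2 * ((3/4) ^ (r - h) * B h))"
  proof (rule sum_square_le)
    \<comment> \<open>The weight \<open>(3/4) ^ (r - h)\<close> is used twice, once in each factor.
      The product is at least \<open>2 ^ h / 2 ^ r\<close> because
      \<open>2 (3/4)^2 = 9/8\<close>.\<close>
    fix h assume "h \<in> {..<r}"
    then have p: "(2::real) ^ r = 2 ^ h * 2 ^ (r - h)" by (simp flip: power_add)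
    have "1 \<le> (9/8 :: real) ^ (r - h)" by (rule one_le_power) simp
    also have "(9/8 :: real) ^ (r - h) = 2 ^ (r - h) * ((3/4) ^ (r - h) * (3/4) ^ (r - h))"
      by (simp flip: power_mult_distrib)
    finally have "2 ^ h * \<sigma>\<^sup>2 * B h * 1 \<le> 2 ^ h * \<sigma>\<^sup>2 * B h * (2 ^ (r - h) * ((3/4) ^ (r - h) * (3/4) ^ (r - h)))"
      using B0 by (intro mult_left_mono) auto
    then show "(Y h)\<^sup>2 \<le> (3/4) ^ (r - h) * (2 ^ r * \<sigma>\<^sup>2 * ((3/4) ^ (r - h) * B h))"
      unfolding Y_def p using B0[of h] by (simp add: mult_ac)
  qed (use B0 in auto)
  also have "\<dots> = (\<Sum>h<r. (3/4) ^ (r - h)) * (2 ^ r * \<sigma>\<^sup>2 * (\<Sum>h<r. (3/4) ^ (r - h) * B h))"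
    by (simp add: sum_distrib_left)
  also have "\<dots> \<le> 3 * ((2 * real N) * \<sigma>\<^sup>2 * (3 * w + 96 + excess \<sigma> w \<alpha> N \<epsilon>))"
  proof (intro mult_mono)
    show "(\<Sum>h<r. (3/4::real) ^ (r - h)) \<le> 3" unfolding sum_reverse_levels[of "\<lambda>i. (3/4) ^ i"] by (rule geometric_sums(1))
    show "(2::real) ^ r \<le> 2 * real N" using r(2) by (metis of_nat_le_iff of_nat_mult of_nat_numeral of_nat_power)
    have "(\<Sum>h<r. (3/4) ^ (r - h) * B h) = w * (\<Sum>h<r. (3/4) ^ (r - h)) + 8 * (\<Sum>h<r. real (r - h) * (3/4) ^ (r - h)) + (\<Sum>h<r. (3/4) ^ (r - h) * X h)"
    proof -
      have "(3/4) ^ (r - h) * B h = w * (3/4) ^ (r - h) + 8 * (real (r - h) * (3/4) ^ (r - h)) + (3/4) ^ (r - h) * X h" for h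
        by (simp add: B_def algebra_simps)
      then show ?thesis by (simp only: sum.distrib sum_distrib_left)
    qed
    moreover have "(\<Sum>h<r. (3/4) ^ (r - h) * X h) = excess \<sigma> w \<alpha> N \<epsilon>" by (simp add: excess_def X_def r_def)
    moreover have "(\<Sum>h<r. real (r - h) * (3/4::real) ^ (r - h)) \<le> 12"
      unfolding sum_reverse_levels[of "\<lambda>i. real i * (3/4) ^ i"] by (rule geometric_sums(2))
    moreover have "w * (\<Sum>h<r. (3/4::real) ^ (r - h)) \<le> w * 3"
      unfolding sum_reverse_levels[of "\<lambda>i. (3/4) ^ i"] using w by (intro mult_left_mono geometric_sums(1)) auto
    ultimately show "(\<Sum>h<r. (3/4) ^ (r - h) * B h) \<le> 3 * w + 96 + excess \<sigma> w \<alpha> N \<epsilon>" by linarith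
  qed (use w excess_nonneg B0 in \<open>auto intro!: sum_nonneg mult_nonneg_nonneg\<close>)
  also have "\<dots> = real N * \<sigma>\<^sup>2 * (18 * w + 576 + 6 * excess \<sigma> w \<alpha> N \<epsilon>)" by (simp add: algebra_simps)
  \<comment> \<open>\<open>576 <= 288 w\<close> because \<open>w >= 2\<close>, and
    \<open>18 + 288 = 306\<close>.\<close>
  also have "\<dots> \<le> real N * \<sigma>\<^sup>2 * (306 * w + 306 * excess \<sigma> w \<alpha> N \<epsilon>)"
    using w excess_nonneg[of \<sigma> w \<alpha> N \<epsilon>] by (intro mult_left_mono) auto
  also have "\<dots> = real N * (306 * \<sigma>\<^sup>2 * w + 306 * \<sigma>\<^sup>2 * excess \<sigma> w \<alpha> N \<epsilon>)" by (simp add: algebra_simps)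
  finally have "(\<Sum>i<t. x i)\<^sup>2 \<le> real N * (306 * \<sigma>\<^sup>2 * w + 306 * \<sigma>\<^sup>2 * excess \<sigma> w \<alpha> N \<epsilon>)" .
  moreover have "(\<Sum>i\<in>{\<alpha>..<\<alpha> + t}. \<epsilon> i) = (\<Sum>i<t. x i)"
    by (rule sum.reindex_bij_witness[of _ "\<lambda>i. \<alpha> + i" "\<lambda>i. i - \<alpha>"]) (use t in \<open>auto simp: x_def\<close>)
  ultimately show ?thesis by simp
qed

section \<open>The oracle inequality\<close>

lemma partition_bounds:
  fixes \<mu> :: "nat \<Rightarrow> nat"
  assumes "\<And>i. i < k \<Longrightarrow> \<mu> i \<le> \<mu> (Suc i)" "j \<le> k"
  shows "\<mu> 0 \<le> \<mu> j" "\<mu> j \<le> \<mu> k"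
proof -
  show "\<mu> 0 \<le> \<mu> j" using assms(2)
  proof (induction j)
    case (Suc j) then show ?case using assms(1)[of j] by simp
  qed simp
  show "\<mu> j \<le> \<mu> k" using assms(2)
  proof (induction j rule: inc_induct)
    case (step j) then show ?case using assms(1)[of j] by simp
  qed simp
qed

lemma partition_sum:
  fixes \<mu> :: "nat \<Rightarrow> nat" and f :: "nat \<Rightarrow> real"
  assumes "\<And>i. i < k \<Longrightarrow> \<mu> i \<le> \<mu> (Suc i)"
  shows "(\<Sum>i\<in>{\<mu> 0<..\<mu> k}. f i) = (\<Sum>j<k. \<Sum>i\<in>{\<mu> j<..\<mu> (Suc j)}. f i)"
  using assms
proof (induction k)
  case 0 then show ?case by simp
next
  case (Suc k)
  have "\<mu> 0 \<le> \<mu> k" "\<mu> k \<le> \<mu> (Suc k)" using partition_bounds(1)[of "Suc k" \<mu> k] Suc.prems by auto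
  then have "{\<mu> 0<..\<mu> (Suc k)} = {\<mu> 0<..\<mu> k} \<union> {\<mu> k<..\<mu> (Suc k)}" "{\<mu> 0<..\<mu> k} \<inter> {\<mu> k<..\<mu> (Suc k)} = {}" by auto
  then show ?case using Suc by (simp add: sum.union_disjoint)
qed

lemma partition_cover:
  fixes \<mu> :: "nat \<Rightarrow> nat"
  assumes "\<And>i. i < k \<Longrightarrow> \<mu> i \<le> \<mu> (Suc i)" "\<mu> 0 < x" "x \<le> \<mu> k"
  shows "\<exists>j<k. \<mu> j < x \<and> x \<le> \<mu> (Suc j)"
  using assms
proof (induction k)
  case 0 then show ?case by simp
next
  case (Suc k)
  show ?case
  proof (cases "x \<le> \<mu> k")
    case True
    then have "\<exists>j<k. \<mu> j < x \<and> x \<le> \<mu> (Suc j)" using Suc by simp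
    then show ?thesis using less_SucI by blast
  next
    case False then show ?thesis using Suc.prems by auto
  qed
qed

text \<open>A nonzero difference at \<open>i\<close> in block \<open>j\<close> has a window that
  leaves the block on the right, so \<open>i\<close> is one of the last \<open>Suc d\<close>
  positions up to \<open>\<mu> (Suc j)\<close>.\<close>

lemma Theta_fd_support:
  assumes "\<theta> \<in> Theta n d k" "n > 0"
  shows "card {i. 1 \<le> i \<and> i + Suc d \<le> n \<and> fd (Suc d) \<theta> i \<noteq> 0} \<le> k * Suc d"
proof -
  obtain \<mu> :: "nat \<Rightarrow> nat" where m: "\<mu> 0 = 0" "\<mu> k = n" "\<And>i. i < k \<Longrightarrow> \<mu> i \<le> \<mu> (Suc i)"
    "\<And>i j. j < k \<Longrightarrow> \<mu> j < i \<Longrightarrow> i + Suc d \<le> \<mu> (Suc j) \<Longrightarrow> fd (Suc d) \<theta> i = 0"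
    using Theta_structure[OF assms] by metis
  \<comment> \<open>Truncated subtraction can only shorten this range, so it never has more than
    \<open>Suc d\<close> elements.\<close>
  define U where "U j = {\<mu> (Suc j) + 1 - Suc d..\<mu> (Suc j)}" for j
  have "{i. 1 \<le> i \<and> i + Suc d \<le> n \<and> fd (Suc d) \<theta> i \<noteq> 0} \<subseteq> (\<Union>j\<in>{..<k}. U j)"
  proof (intro subsetI, elim CollectE conjE)
    fix i assume i: "1 \<le> i" "i + Suc d \<le> n" "fd (Suc d) \<theta> i \<noteq> 0"
    obtain j where j: "j < k" "\<mu> j < i" "i \<le> \<mu> (Suc j)"
      using partition_cover[of k \<mu> i] m i by auto
    then have "\<not> i + Suc d \<le> \<mu> (Suc j)" using m(4) i(3) by blast
    then show "i \<in> (\<Union>j\<in>{..<k}. U j)" using j by (force simp: U_def)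
  qed
  then have "card {i. 1 \<le> i \<and> i + Suc d \<le> n \<and> fd (Suc d) \<theta> i \<noteq> 0} \<le> card (\<Union>j\<in>{..<k}. U j)"
    by (rule card_mono[rotated]) (simp add: U_def)
  also have "\<dots> \<le> (\<Sum>j\<in>{..<k}. card (U j))" by (rule card_UN_le) simp
  also have "\<dots> \<le> (\<Sum>j\<in>{..<k}. Suc d)" by (rule sum_mono) (simp add: U_def)
  finally show ?thesis by simp
qed

definition wwidth :: "nat \<Rightarrow> nat \<Rightarrow> nat" where "wwidth a b = 2 * floor_log (b - a) + 2"

text \<open>Determined by the knots of the competitor and the noise alone, so its mean can be
  computed although the estimator depends on the noise.\<close>

definition total_excess :: "real \<Rightarrow> real \<Rightarrow> (nat \<Rightarrow> nat) \<Rightarrow> nat \<Rightarrow> (nat \<Rightarrow> real) \<Rightarrow> real" where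
  "total_excess \<sigma> w \<mu> k \<epsilon> = (\<Sum>j<k. \<Sum>(p,q)\<in>{..wwidth (\<mu> j) (\<mu> (Suc j))} \<times> {..wwidth (\<mu> j) (\<mu> (Suc j))}.
     excess \<sigma> w (Min (wpiece (\<mu> j) (\<mu> (Suc j)) p q)) (card (wpiece (\<mu> j) (\<mu> (Suc j)) p q)) \<epsilon>)"

text \<open>\<open>\<theta>'\<close> is the competitor. Inside its blocks the differences of
  \<open>\<theta> - \<theta>'\<close> are those of \<open>\<theta>\<close>; this supplies the sign
  and bounds the number of nonzero positions over all blocks by \<open>k (d + 1)\<close>. Two pieces
  for each of them and one more per block give \<open>(2 (d + 1) + 1) k\<close>.\<close>

lemma noise_inner_product_bound:
  assumes \<theta>: "\<theta> \<in> Theta n d k" and n: "n > 0" and s: "\<sigma> > 0" and w: "w \<ge> 2"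
    and \<mu>: "\<mu> 0 = 0" "\<mu> k = n" "\<And>i. i < k \<Longrightarrow> \<mu> i \<le> \<mu> (Suc i)"
    and z: "\<And>i j. j < k \<Longrightarrow> \<mu> j < i \<Longrightarrow> i + Suc d \<le> \<mu> (Suc j) \<Longrightarrow> fd (Suc d) \<theta>' i = 0"
  shows "(\<Sum>i=1..n. \<epsilon> i * (\<theta> i - \<theta>' i))\<^sup>2 \<le>
    306 * Cblk (Suc d) * \<sigma>\<^sup>2 * ((2 * real (Suc d) + 1) * real k * w + total_excess \<sigma> w \<mu> k \<epsilon>) * (\<Sum>i=1..n. (\<theta> i - \<theta>' i)\<^sup>2)"
proof -
  define m where "m = Suc d"
  define v where "v i = \<theta> i - \<theta>' i" for i
  have rng: "{\<mu> 0<..\<mu> k} = {1..n}" using \<mu> by auto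
  have fdv: "fd m v i = fd m \<theta> i" if "j < k" "\<mu> j < i" "i + m \<le> \<mu> (Suc j)" for i j
    unfolding v_def fd_diff using z[of j i] that by (simp add: m_def del: fd.simps)
  have mun: "\<mu> j \<le> n" if "j \<le> k" for j using partition_bounds(2)[of k \<mu> j] \<mu> that by simp
  define Hits where "Hits j = {i. \<mu> j < i \<and> i + m \<le> \<mu> (Suc j) \<and> fd m v i \<noteq> 0}" for j
  define A where "A = 306 * \<sigma>\<^sup>2 * w"
  define \<beta> where "\<beta> j p q = 306 * \<sigma>\<^sup>2 * excess \<sigma> w (Min (wpiece (\<mu> j) (\<mu> (Suc j)) p q)) (card (wpiece (\<mu> j) (\<mu> (Suc j)) p q)) \<epsilon>" for j p q
  define B where "B j = (\<Sum>(p,q)\<in>{..wwidth (\<mu> j) (\<mu> (Suc j))} \<times> {..wwidth (\<mu> j) (\<mu> (Suc j))}. \<beta> j p q)" for j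
  have A0: "A \<ge> 0" using w by (simp add: A_def)
  have \<beta>0: "\<beta> j p q \<ge> 0" for j p q using excess_nonneg by (simp add: \<beta>_def)
  have B0: "B j \<ge> 0" for j unfolding B_def using \<beta>0 by (intro sum_nonneg) auto
  have blk: "(\<Sum>i\<in>{\<mu> j<..\<mu> (Suc j)}. \<epsilon> i * v i)\<^sup>2 \<le>
     Cblk m * (real (2 * card (Hits j) + 1) * A + B j) * (\<Sum>i\<in>{\<mu> j<..\<mu> (Suc j)}. (v i)\<^sup>2)" if j: "j < k" for j
    unfolding Hits_def B_def wwidth_def
  proof (rule block_bound)
    fix i assume i: "\<mu> j < i" "i + m \<le> \<mu> (Suc j)"
    have "i + m \<le> n" using i mun[of "Suc j"] j by simp
    then have "fd m \<theta> i \<ge> 0" using Theta_structure[OF \<theta> n] i by (metis One_nat_def Suc_leI bot_nat_0.not_eq_extremum m_def not_less_zero)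
    then show "fd m v i \<ge> 0" using fdv[OF j i] by simp
  next
    fix p q t assume t: "t \<le> card (wpiece (\<mu> j) (\<mu> (Suc j)) p q)"
    show "(\<Sum>i\<in>{Min (wpiece (\<mu> j) (\<mu> (Suc j)) p q)..<Min (wpiece (\<mu> j) (\<mu> (Suc j)) p q) + t}. \<epsilon> i)\<^sup>2
       \<le> real (card (wpiece (\<mu> j) (\<mu> (Suc j)) p q)) * (A + \<beta> j p q)"
      unfolding A_def \<beta>_def by (rule partial_sum_excess[OF s w t])
  qed (use A0 \<beta>0 in \<open>auto simp: m_def\<close>)
  have hits: "(\<Sum>j<k. card (Hits j)) \<le> k * m"
  proof -
    have fH: "finite (Hits j)" for j by (rule finite_subset[of _ "{..\<mu> (Suc j)}"]) (auto simp: Hits_def)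
    have lt: "Hits i \<inter> Hits j = {}" if "i < j" "j < k" for i j
    proof -
      have "\<mu> (Suc i) \<le> \<mu> j" using partition_bounds(2)[of j \<mu> "Suc i"] \<mu>(3) that by simp
      then show ?thesis by (auto simp: Hits_def)
    qed
    have disj: "\<forall>i\<in>{..<k}. \<forall>j\<in>{..<k}. i \<noteq> j \<longrightarrow> Hits i \<inter> Hits j = {}"
    proof (intro ballI impI)
      fix i j assume "i \<in> {..<k}" "j \<in> {..<k}" "i \<noteq> j"
      then show "Hits i \<inter> Hits j = {}" using lt[of i j] lt[of j i] by (cases "i < j") auto
    qed
    have "(\<Sum>j<k. card (Hits j)) = card (\<Union>j\<in>{..<k}. Hits j)"
      by (rule card_UN_disjoint[symmetric]) (use fH disj in auto)
    also have "\<dots> \<le> card {i. 1 \<le> i \<and> i + m \<le> n \<and> fd m \<theta> i \<noteq> 0}"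
    proof (rule card_mono)
      show "finite {i. 1 \<le> i \<and> i + m \<le> n \<and> fd m \<theta> i \<noteq> 0}" by (rule finite_subset[of _ "{..n}"]) auto
      show "(\<Union>j\<in>{..<k}. Hits j) \<subseteq> {i. 1 \<le> i \<and> i + m \<le> n \<and> fd m \<theta> i \<noteq> 0}"
      proof (intro subsetI)
        fix i assume "i \<in> (\<Union>j\<in>{..<k}. Hits j)"
        then obtain j where j: "j < k" "\<mu> j < i" "i + m \<le> \<mu> (Suc j)" "fd m v i \<noteq> 0" by (auto simp: Hits_def)
        then have "fd m \<theta> i \<noteq> 0" using fdv[OF j(1-3)] by simp
        moreover have "i + m \<le> n" using j mun[of "Suc j"] by simp
        ultimately show "i \<in> {i. 1 \<le> i \<and> i + m \<le> n \<and> fd m \<theta> i \<noteq> 0}" using j(2) by simp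
      qed
    qed
    also have "\<dots> \<le> k * m" unfolding m_def by (rule Theta_fd_support[OF \<theta> n])
    finally show ?thesis .
  qed
  have "(\<Sum>i=1..n. \<epsilon> i * v i)\<^sup>2 = (\<Sum>j<k. \<Sum>i\<in>{\<mu> j<..\<mu> (Suc j)}. \<epsilon> i * v i)\<^sup>2"
    unfolding rng[symmetric] by (subst partition_sum[where \<mu> = \<mu> and k = k]) (use \<mu>(3) in auto)
  also have "\<dots> \<le> (\<Sum>j<k. Cblk m * (real (2 * card (Hits j) + 1) * A + B j)) * (\<Sum>j<k. \<Sum>i\<in>{\<mu> j<..\<mu> (Suc j)}. (v i)\<^sup>2)"
  proof (rule sum_square_le)
    fix j assume "j \<in> {..<k}"
    then show "(\<Sum>i\<in>{\<mu> j<..\<mu> (Suc j)}. \<epsilon> i * v i)\<^sup>2 \<le> Cblk m * (real (2 * card (Hits j) + 1) * A + B j) * (\<Sum>i\<in>{\<mu> j<..\<mu> (Suc j)}. (v i)\<^sup>2)"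
      using blk by simp
    show "0 \<le> Cblk m * (real (2 * card (Hits j) + 1) * A + B j)"
      using A0 B0[of j] Cblk_nonneg[of m] by simp
  qed (auto intro: sum_nonneg)
  also have "(\<Sum>j<k. \<Sum>i\<in>{\<mu> j<..\<mu> (Suc j)}. (v i)\<^sup>2) = (\<Sum>i=1..n. (v i)\<^sup>2)"
    unfolding rng[symmetric] by (subst partition_sum[where \<mu> = \<mu> and k = k]) (use \<mu>(3) in auto)
  also have "(\<Sum>j<k. Cblk m * (real (2 * card (Hits j) + 1) * A + B j)) * (\<Sum>i=1..n. (v i)\<^sup>2) \<le>
     Cblk m * ((2 * real m + 1) * real k * A + (\<Sum>j<k. B j)) * (\<Sum>i=1..n. (v i)\<^sup>2)"
  proof (rule mult_right_mono)
    have "(\<Sum>j<k. Cblk m * (real (2 * card (Hits j) + 1) * A + B j)) = Cblk m * ((2 * real (\<Sum>j<k. card (Hits j)) + real k) * A + (\<Sum>j<k. B j))"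
      by (simp add: sum_distrib_left[symmetric] sum.distrib sum_distrib_right[symmetric])
    also have "\<dots> \<le> Cblk m * ((2 * real m + 1) * real k * A + (\<Sum>j<k. B j))"
    proof (intro mult_left_mono add_right_mono mult_right_mono A0 Cblk_nonneg)
      have "real (\<Sum>j<k. card (Hits j)) \<le> real (k * m)" using hits by (simp only: of_nat_le_iff)
      then show "2 * real (\<Sum>j<k. card (Hits j)) + real k \<le> (2 * real m + 1) * real k" by (simp add: algebra_simps)
    qed
    finally show "(\<Sum>j<k. Cblk m * (real (2 * card (Hits j) + 1) * A + B j)) \<le> Cblk m * ((2 * real m + 1) * real k * A + (\<Sum>j<k. B j))" .
  qed (auto intro: sum_nonneg)
  also have "(\<Sum>j<k. B j) = 306 * \<sigma>\<^sup>2 * total_excess \<sigma> w \<mu> k \<epsilon>"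
    unfolding B_def total_excess_def \<beta>_def sum_distrib_left by (simp add: case_prod_unfold)
  finally show ?thesis unfolding A_def v_def m_def by (simp add: algebra_simps)
qed

text \<open>The constant 16 keeps the iterated logarithm away from 0 even for \<open>k = n\<close>.
  The value \<open>5/8\<close> makes the threshold \<open>8 ln (ln (16 n / k))\<close> at least 5,
  above the 2 that the tail bound asks for.\<close>

lemma loglog_lower_bound:
  assumes "1 \<le> k" "k \<le> n"
  shows "ln (16 * real n / real k) \<ge> 8/3" "ln (ln (16 * real n / real k)) \<ge> 5/8"
proof -
  have "ln (16::real) = 4 * ln 2" using ln_realpow[of "2::real" 4] by simp
  then have "ln (16::real) \<ge> 8/3" using ln2_ge_two_thirds by linarith
  moreover have "real n / real k \<ge> 1" using assms by simp
  then have "ln 16 \<le> ln (16 * (real n / real k))" by (subst ln_le_cancel_iff) auto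
  ultimately show 1: "ln (16 * real n / real k) \<ge> 8/3" by simp
  have "ln (3/8::real) \<le> 3/8 - 1" by (rule ln_le_minus_one) simp
  moreover have "ln (3/8::real) = - ln (8/3)" using ln_inverse[of "8/3::real"] by simp
  ultimately have "ln (8/3::real) \<ge> 5/8" by simp
  moreover have "ln (8/3) \<le> ln (ln (16 * real n / real k))" using 1 by (subst ln_le_cancel_iff) auto
  ultimately show "ln (ln (16 * real n / real k)) \<ge> 5/8" by simp
qed

text \<open>The left side is the number of level pairs of a block of length \<open>l\<close>, which
  for a long block can exceed the order of \<open>Lg^2\<close>. With \<open>z = l k / n\<close>, the
  length relative to the mean \<open>n / k\<close>, the surplus is governed by
  \<open>(ln z)^2 <= 4 z\<close> for \<open>z >= 1\<close>, and the \<open>z\<close> of all blocks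
  add up to \<open>k\<close>. This stands in for a concavity argument.\<close>

lemma block_width_bound:
  fixes l n k :: nat
  assumes k: "1 \<le> k" "k \<le> n"
  defines "Lg \<equiv> ln (16 * real n / real k)"
  shows "(2 * real (floor_log l) + 3)\<^sup>2 \<le> 128 * (real l * real k / real n) + 32 * Lg\<^sup>2"
proof -
  have nk: "real n / real k \<ge> 1" "real n / real k > 0" using k by auto
  have ln2: "ln (2::real) \<ge> 2/3" by (rule ln2_ge_two_thirds)
  have Lg: "Lg = ln 16 + ln (real n / real k)" unfolding Lg_def using nk k ln_mult[of 16 "real n / real k"] by simp
  have Lg1: "Lg \<ge> 8/3" unfolding Lg_def by (rule loglog_lower_bound(1)[OF k])
  have ln16: "ln (16::real) \<ge> 8/3" using loglog_lower_bound(1)[of 1 1] by simp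
  show ?thesis
  proof (cases "l = 0")
    case True
    have "(1::real) \<le> Lg * Lg" using mult_mono[of 1 Lg 1 Lg] Lg1 by simp
    then show ?thesis using True by (simp add: power2_eq_square)
  next
    case False
    define f where "f = real (floor_log l)"
    define z where "z = real l * real k / real n"
    have z0: "z > 0" using False k by (simp add: z_def)
    have "2 ^ floor_log l \<le> l" using floor_log_bounds(1)[of l] False by simp
    then have "(2::real) ^ floor_log l \<le> real l" by (metis of_nat_le_iff of_nat_numeral of_nat_power)
    then have "ln ((2::real) ^ floor_log l) \<le> ln (real l)" using False by (subst ln_le_cancel_iff) auto
    then have "f * ln 2 \<le> ln (real l)" by (simp add: ln_realpow f_def)
    moreover have "f * (2/3) \<le> f * ln 2" using ln2 by (intro mult_left_mono) (auto simp: f_def)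
    ultimately have "2 * f \<le> 4 * ln (real l)" using False by (simp add: f_def)
    moreover have "ln (real l) = ln z + ln (real n / real k)"
    proof -
      have "real l = z * (real n / real k)" using k by (simp add: z_def)
      then have "ln (real l) = ln (z * (real n / real k))" by (rule arg_cong)
      also have "\<dots> = ln z + ln (real n / real k)" by (rule ln_mult_pos[OF z0 nk(2)])
      finally show ?thesis .
    qed
    ultimately have up: "2 * f + 3 \<le> 4 * ln z + 4 * Lg" using Lg ln16 by linarith
    have f0: "f \<ge> 0" by (simp add: f_def)
    have "(2 * f + 3)\<^sup>2 \<le> 128 * z + 32 * Lg\<^sup>2"
    proof (cases "z \<ge> 1")
      case True
      \<comment> \<open>Passing to the square root turns \<open>ln z <= z\<close> into a bound on
        \<open>(ln z)^2\<close> that is linear in \<open>z\<close>.\<close>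
      have "ln z = 2 * ln (sqrt z)" using z0 by (simp add: ln_sqrt)
      also have "ln (sqrt z) \<le> sqrt z" using z0 ln_le_minus_one[of "sqrt z"] by simp
      finally have "ln z \<le> 2 * sqrt z" by simp
      then have "(ln z)\<^sup>2 \<le> (2 * sqrt z)\<^sup>2" using True by (intro power_mono) auto
      then have lz: "(ln z)\<^sup>2 \<le> 4 * z" using z0 by (simp add: power_mult_distrib)
      have "(2 * f + 3)\<^sup>2 \<le> (4 * ln z + 4 * Lg)\<^sup>2" using up f0 by (intro power_mono) auto
      also have "\<dots> \<le> 32 * (ln z)\<^sup>2 + 32 * Lg\<^sup>2"
        using sum_squares_ge_zero[of "4 * ln z - 4 * Lg" 0] by (simp add: power2_eq_square algebra_simps)
      finally show ?thesis using lz by linarith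
    next
      case False
      then have "ln z \<le> 0" using z0 by simp
      then have "(2 * f + 3)\<^sup>2 \<le> (4 * Lg)\<^sup>2" using up f0 by (intro power_mono) auto
      also have "\<dots> = 16 * Lg\<^sup>2" by (simp add: power_mult_distrib)
      also have "\<dots> \<le> 128 * z + 32 * Lg\<^sup>2" using z0 by simp
      finally show ?thesis .
    qed
    then show ?thesis by (simp add: f_def z_def)
  qed
qed

lemma total_excess_nonneg: "total_excess \<sigma> w \<mu> k \<epsilon> \<ge> 0"
  unfolding total_excess_def by (intro sum_nonneg) (auto simp: excess_nonneg)

text \<open>With \<open>Lg = ln (16 n / k)\<close>, the block counts add up to at most
  \<open>128 k + 32 k Lg^2 <= 160 k Lg^2\<close> pairs, and each pair contributes at most
  \<open>8 exp (- w / 4)\<close>; hence 1280.\<close>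

lemma total_excess_expectation:
  assumes s: "\<sigma> > 0" and w: "w \<ge> 2" and k: "1 \<le> k" "k \<le> n"
    and \<mu>: "\<mu> 0 = 0" "\<mu> k = n" "\<And>i. i < k \<Longrightarrow> \<mu> i \<le> \<mu> (Suc i)"
  shows "(\<lambda>\<epsilon>. ennreal (total_excess \<sigma> w \<mu> k \<epsilon>)) \<in> borel_measurable (noise n \<sigma>)"
    and "(\<integral>\<^sup>+\<epsilon>. ennreal (total_excess \<sigma> w \<mu> k \<epsilon>) \<partial>noise n \<sigma>) \<le>
      ennreal (1280 * real k * (ln (16 * real n / real k))\<^sup>2 * exp (- w / 4))"
proof -
  define X where "X j pq \<epsilon> = excess \<sigma> w (Min (wpiece (\<mu> j) (\<mu> (Suc j)) (fst pq) (snd pq))) (card (wpiece (\<mu> j) (\<mu> (Suc j)) (fst pq) (snd pq))) \<epsilon>" for j pq \<epsilon>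
  define F where "F j = {..wwidth (\<mu> j) (\<mu> (Suc j))} \<times> {..wwidth (\<mu> j) (\<mu> (Suc j))}" for j
  define Lg where "Lg = ln (16 * real n / real k)"
  have n: "n > 0" using k by simp
  have X0: "X j pq \<epsilon> \<ge> 0" for j pq \<epsilon> by (simp add: X_def excess_nonneg)
  have sub: "{Min (wpiece (\<mu> j) (\<mu> (Suc j)) p q)..<Min (wpiece (\<mu> j) (\<mu> (Suc j)) p q) + card (wpiece (\<mu> j) (\<mu> (Suc j)) p q)} \<subseteq> {1..n}"
    if "j < k" for j p q
  proof -
    have "\<mu> (Suc j) \<le> n" using partition_bounds(2)[of k \<mu> "Suc j"] \<mu> that by simp
    then have "wpiece (\<mu> j) (\<mu> (Suc j)) p q \<subseteq> {1..n}" by (auto simp: wpiece_def)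
    then show ?thesis by (simp only: wpiece_eq[symmetric])
  qed
  have Xm: "(\<lambda>\<epsilon>. ennreal (X j pq \<epsilon>)) \<in> borel_measurable (noise n \<sigma>)" if "j < k" for j pq
    unfolding X_def by (rule excess_expectation(1)[OF s w sub[OF that]])
  have Xi: "(\<integral>\<^sup>+\<epsilon>. ennreal (X j pq \<epsilon>) \<partial>noise n \<sigma>) \<le> ennreal (8 * exp (- w / 4))" if "j < k" for j pq
    unfolding X_def by (rule excess_expectation(2)[OF s w sub[OF that]])
  have e: "ennreal (total_excess \<sigma> w \<mu> k \<epsilon>) = (\<Sum>j<k. \<Sum>pq\<in>F j. ennreal (X j pq \<epsilon>))" for \<epsilon>
    unfolding total_excess_def case_prod_unfold X_def[symmetric] F_def[symmetric]
    by (simp add: sum_ennreal X0 sum_nonneg)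
  have "(\<lambda>\<epsilon>. \<Sum>j<k. \<Sum>pq\<in>F j. ennreal (X j pq \<epsilon>)) \<in> borel_measurable (noise n \<sigma>)"
    using Xm by (intro borel_measurable_sum) auto
  then show "(\<lambda>\<epsilon>. ennreal (total_excess \<sigma> w \<mu> k \<epsilon>)) \<in> borel_measurable (noise n \<sigma>)" unfolding e .
  have "(\<integral>\<^sup>+\<epsilon>. ennreal (total_excess \<sigma> w \<mu> k \<epsilon>) \<partial>noise n \<sigma>) = (\<Sum>j<k. \<integral>\<^sup>+\<epsilon>. (\<Sum>pq\<in>F j. ennreal (X j pq \<epsilon>)) \<partial>noise n \<sigma>)"
    unfolding e by (rule nn_integral_sum) (use Xm in \<open>auto intro!: borel_measurable_sum\<close>)
  also have "\<dots> = (\<Sum>j<k. \<Sum>pq\<in>F j. \<integral>\<^sup>+\<epsilon>. ennreal (X j pq \<epsilon>) \<partial>noise n \<sigma>)"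
    by (intro sum.cong refl nn_integral_sum) (use Xm in auto)
  also have "\<dots> \<le> (\<Sum>j<k. \<Sum>pq\<in>F j. ennreal (8 * exp (- w / 4)))"
    by (intro sum_mono Xi) auto
  also have "\<dots> = ennreal (\<Sum>j<k. \<Sum>pq\<in>F j. 8 * exp (- w / 4))"
    by (simp add: sum_ennreal sum_nonneg del: sum_constant)
  also have "\<dots> \<le> ennreal (1280 * real k * Lg\<^sup>2 * exp (- w / 4))"
  proof (rule ennreal_leI)
    have cF: "real (card (F j)) \<le> 128 * ((real (\<mu> (Suc j)) - real (\<mu> j)) * real k / real n) + 32 * Lg\<^sup>2" if "j < k" for j
    proof -
      have "real (card (F j)) = (2 * real (floor_log (\<mu> (Suc j) - \<mu> j)) + 3)\<^sup>2"
        by (simp add: F_def wwidth_def card_cartesian_product power2_eq_square algebra_simps)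
      also have "\<dots> \<le> 128 * (real (\<mu> (Suc j) - \<mu> j) * real k / real n) + 32 * Lg\<^sup>2"
        unfolding Lg_def by (rule block_width_bound[OF k])
      finally show ?thesis using \<mu>(3)[OF that] by (simp add: of_nat_diff)
    qed
    have "Lg \<ge> 1" unfolding Lg_def using loglog_lower_bound(1)[OF k] by linarith
    then have Lg2: "Lg\<^sup>2 \<ge> 1" by (simp add: one_le_power)
    have "(\<Sum>j<k. real (card (F j))) \<le> (\<Sum>j<k. 128 * ((real (\<mu> (Suc j)) - real (\<mu> j)) * real k / real n) + 32 * Lg\<^sup>2)"
      by (intro sum_mono cF) auto
    also have "\<dots> = 128 * ((\<Sum>j<k. real (\<mu> (Suc j)) - real (\<mu> j)) * real k / real n) + 32 * real k * Lg\<^sup>2"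
      by (simp add: sum.distrib sum_distrib_left sum_distrib_right sum_divide_distrib)
    also have "(\<Sum>j<k. real (\<mu> (Suc j)) - real (\<mu> j)) = real n"
      using sum_lessThan_telescope[of "\<lambda>j. real (\<mu> j)" k] \<mu>(1,2) by simp
    also have "128 * (real n * real k / real n) + 32 * real k * Lg\<^sup>2 \<le> 160 * real k * Lg\<^sup>2"
      using n mult_left_mono[OF Lg2, of "128 * real k"] by simp
    finally have "(\<Sum>j<k. real (card (F j))) \<le> 160 * real k * Lg\<^sup>2" .
    then have "(\<Sum>j<k. real (card (F j))) * (8 * exp (- w / 4)) \<le> 160 * real k * Lg\<^sup>2 * (8 * exp (- w / 4))"
      by (rule mult_right_mono) simp
    then show "(\<Sum>j<k. \<Sum>pq\<in>F j. 8 * exp (- w / 4)) \<le> 1280 * real k * Lg\<^sup>2 * exp (- w / 4)"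
      by (simp add: sum_distrib_right)
  qed
  finally show "(\<integral>\<^sup>+\<epsilon>. ennreal (total_excess \<sigma> w \<mu> k \<epsilon>) \<partial>noise n \<sigma>) \<le>
      ennreal (1280 * real k * (ln (16 * real n / real k))\<^sup>2 * exp (- w / 4))" unfolding Lg_def .
qed

section \<open>From the basic inequality to the risk\<close>

lemma edist_sq: "(edist n x y)\<^sup>2 = (\<Sum>i=1..n. (x i - y i)\<^sup>2)"
  unfolding edist_def L2_set_def by (simp add: sum_nonneg)

lemma obs_in_Rn: "obs n \<theta> \<epsilon> \<in> space (Rn n)"
  by (simp add: obs_def Rn_def space_PiM)

text \<open>\<open>D <= S + 2 P\<close> by minimality, \<open>2 P <= \<eta> V + Q / \<eta>\<close>
  by the arithmetic-geometric mean inequality, and \<open>V <= 2 D + 2 S\<close>. The resulting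
  \<open>2 \<eta> D\<close> moves to the left, where the factor \<open>1 - 2 \<eta>\<close> is
  positive.\<close>

lemma LSE_oracle_pointwise:
  assumes lse: "is_LSE n d k T" and \<theta>: "\<theta> \<in> Theta n d k" and \<eta>: "0 < \<eta>" "\<eta> < 1/2" and Q: "Q \<ge> 0"
    and inner: "(\<Sum>i=1..n. \<epsilon> i * (T (obs n \<theta>\<^sub>0 \<epsilon>) i - \<theta> i))\<^sup>2 \<le> Q * (\<Sum>i=1..n. (T (obs n \<theta>\<^sub>0 \<epsilon>) i - \<theta> i)\<^sup>2)"
  shows "(1 - 2 * \<eta>) * (edist n (T (obs n \<theta>\<^sub>0 \<epsilon>)) \<theta>\<^sub>0)\<^sup>2 \<le> (1 + 2 * \<eta>) * (edist n \<theta> \<theta>\<^sub>0)\<^sup>2 + Q / \<eta>"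
proof -
  define t where "t = T (obs n \<theta>\<^sub>0 \<epsilon>)"
  define D S where "D = (\<Sum>i=1..n. (t i - \<theta>\<^sub>0 i)\<^sup>2)" and "S = (\<Sum>i=1..n. (\<theta> i - \<theta>\<^sub>0 i)\<^sup>2)"
  define V P where "V = (\<Sum>i=1..n. (t i - \<theta> i)\<^sup>2)" and "P = (\<Sum>i=1..n. \<epsilon> i * (t i - \<theta> i))"
  have ex: "(edist n (obs n \<theta>\<^sub>0 \<epsilon>) u)\<^sup>2 = (\<Sum>i=1..n. (u i - \<theta>\<^sub>0 i)\<^sup>2 - 2 * (\<epsilon> i * (u i - \<theta>\<^sub>0 i)) + (\<epsilon> i)\<^sup>2)" for u
    unfolding edist_sq by (intro sum.cong refl) (simp add: obs_def power2_eq_square algebra_simps)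
  have "is_arg_min (\<lambda>u. (edist n (obs n \<theta>\<^sub>0 \<epsilon>) u)\<^sup>2) (\<lambda>u. u \<in> Theta n d k) t"
    unfolding t_def using lse obs_in_Rn[of n \<theta>\<^sub>0 \<epsilon>] unfolding is_LSE_def by blast
  then have "(edist n (obs n \<theta>\<^sub>0 \<epsilon>) t)\<^sup>2 \<le> (edist n (obs n \<theta>\<^sub>0 \<epsilon>) \<theta>)\<^sup>2"
    using \<theta> unfolding is_arg_min_def by (meson not_le)
  then have "D - 2 * (\<Sum>i=1..n. \<epsilon> i * (t i - \<theta>\<^sub>0 i)) \<le> S - 2 * (\<Sum>i=1..n. \<epsilon> i * (\<theta> i - \<theta>\<^sub>0 i))"
    unfolding ex D_def S_def by (simp add: sum.distrib sum_subtractf sum_distrib_left)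
  moreover have "P = (\<Sum>i=1..n. \<epsilon> i * (t i - \<theta>\<^sub>0 i)) - (\<Sum>i=1..n. \<epsilon> i * (\<theta> i - \<theta>\<^sub>0 i))"
    unfolding P_def sum_subtractf[symmetric] by (intro sum.cong refl) (simp add: algebra_simps)
  ultimately have 1: "D \<le> S + 2 * P" by simp
  have V0: "V \<ge> 0" unfolding V_def by (intro sum_nonneg) auto
  have "V \<le> (\<Sum>i=1..n. 2 * (t i - \<theta>\<^sub>0 i)\<^sup>2 + 2 * (\<theta> i - \<theta>\<^sub>0 i)\<^sup>2)"
    unfolding V_def
  proof (rule sum_mono)
    fix i
    have "0 \<le> ((t i - \<theta>\<^sub>0 i) + (\<theta> i - \<theta>\<^sub>0 i))\<^sup>2" by simp
    then show "(t i - \<theta> i)\<^sup>2 \<le> 2 * (t i - \<theta>\<^sub>0 i)\<^sup>2 + 2 * (\<theta> i - \<theta>\<^sub>0 i)\<^sup>2"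
      by (simp add: power2_eq_square algebra_simps)
  qed
  then have 2: "V \<le> 2 * D + 2 * S" by (simp add: D_def S_def sum.distrib sum_distrib_left)
  have P2: "P\<^sup>2 \<le> Q * V" using inner by (simp add: P_def V_def t_def)
  have 3: "2 * P \<le> \<eta> * V + Q / \<eta>"
  proof -
    have "\<bar>P\<bar> \<le> sqrt Q * sqrt V" using P2 by (metis real_sqrt_abs real_sqrt_le_iff real_sqrt_mult)
    moreover have "sqrt Q * sqrt V = sqrt (\<eta> * V) * sqrt (Q / \<eta>)" using \<eta>(1) by (simp add: real_sqrt_mult real_sqrt_divide)
    ultimately have "2 * P \<le> 2 * (sqrt (\<eta> * V) * sqrt (Q / \<eta>))" by linarith
    also have "\<dots> \<le> (sqrt (\<eta> * V))\<^sup>2 + (sqrt (Q / \<eta>))\<^sup>2"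
      using sum_squares_bound[of "sqrt (\<eta> * V)" "sqrt (Q / \<eta>)"] by simp
    also have "\<dots> = \<eta> * V + Q / \<eta>" using \<eta> V0 Q by simp
    finally show ?thesis .
  qed
  have "\<eta> * V \<le> \<eta> * (2 * D + 2 * S)" using 2 \<eta> by (intro mult_left_mono) auto
  then have "(1 - 2 * \<eta>) * D \<le> (1 + 2 * \<eta>) * S + Q / \<eta>" using 1 3 by (simp add: algebra_simps)
  then show ?thesis unfolding edist_sq D_def S_def t_def .
qed

text \<open>The thresholds give \<open>8 (2 (d + 1) + 1)\<close>. The mean total excess gives
  \<open>1280 k\<close>, at most \<open>2560 k ln (ln (16 n / k))\<close> because the iterated
  logarithm is at least \<open>1/2\<close>.\<close>

definition Crisk :: "nat \<Rightarrow> real" where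
  "Crisk d = 306 * Cblk (Suc d) * (8 * (2 * real (Suc d) + 1) + 2560)"

lemma LSE_risk_bound:
  assumes lse: "is_LSE n d k T" and \<theta>: "\<theta> \<in> Theta n d k" and \<eta>: "0 < \<eta>" "\<eta> < 1/2"
    and k: "1 \<le> k" "k \<le> n" and s: "\<sigma> > 0"
  shows "risk n \<sigma> \<theta>\<^sub>0 T \<le> ennreal ((1 + 2 * \<eta>) / (1 - 2 * \<eta>) * (edist n \<theta> \<theta>\<^sub>0)\<^sup>2
     + Crisk d / (\<eta> * (1 - 2 * \<eta>)) * \<sigma>\<^sup>2 * real k * ln (ln (16 * real n / real k)))"
proof -
  have n: "n > 0" using k by simp
  define Lg where "Lg = ln (16 * real n / real k)"
  have Lg: "Lg \<ge> 8/3" "ln Lg \<ge> 5/8" unfolding Lg_def using loglog_lower_bound[OF k] by auto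
  \<comment> \<open>Chosen so that \<open>exp (- w / 4) = 1 / Lg^2\<close>, which cancels the factor
    \<open>Lg^2\<close> in the mean total excess.\<close>
  define w where "w = 8 * ln Lg"
  have w: "w \<ge> 2" using Lg by (simp add: w_def)
  obtain \<mu> :: "nat \<Rightarrow> nat" where \<mu>: "\<mu> 0 = 0" "\<mu> k = n" "\<And>i. i < k \<Longrightarrow> \<mu> i \<le> \<mu> (Suc i)"
    and z: "\<And>i j. j < k \<Longrightarrow> \<mu> j < i \<Longrightarrow> i + Suc d \<le> \<mu> (Suc j) \<Longrightarrow> fd (Suc d) \<theta> i = 0"
    using Theta_structure[OF \<theta> n] by metis
  define K where "K = 306 * Cblk (Suc d) * \<sigma>\<^sup>2"
  define Q where "Q \<epsilon> = K * ((2 * real (Suc d) + 1) * real k * w + total_excess \<sigma> w \<mu> k \<epsilon>)" for \<epsilon>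
  have K0: "K \<ge> 0" using Cblk_nonneg[of "Suc d"] by (simp add: K_def)
  have Q0: "Q \<epsilon> \<ge> 0" for \<epsilon> using K0 w total_excess_nonneg[of \<sigma> w \<mu> k \<epsilon>] by (simp add: Q_def)
  define R1 where "R1 = (1 + 2 * \<eta>) / (1 - 2 * \<eta>) * (edist n \<theta> \<theta>\<^sub>0)\<^sup>2 + 1 / (\<eta> * (1 - 2 * \<eta>)) * K * ((2 * real (Suc d) + 1) * real k * w)"
  define R2 where "R2 = 1 / (\<eta> * (1 - 2 * \<eta>)) * K"
  have R10: "R1 \<ge> 0" unfolding R1_def using \<eta> K0 w by (intro add_nonneg_nonneg mult_nonneg_nonneg divide_nonneg_nonneg) auto
  have R20: "R2 \<ge> 0" unfolding R2_def using \<eta> K0 by (intro mult_nonneg_nonneg divide_nonneg_nonneg) auto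
  have pt: "(edist n (T (obs n \<theta>\<^sub>0 \<epsilon>)) \<theta>\<^sub>0)\<^sup>2 \<le> R1 + R2 * total_excess \<sigma> w \<mu> k \<epsilon>" for \<epsilon>
  proof -
    have Tin: "T (obs n \<theta>\<^sub>0 \<epsilon>) \<in> Theta n d k"
      using lse obs_in_Rn[of n \<theta>\<^sub>0 \<epsilon>] unfolding is_LSE_def is_arg_min_def by blast
    have "(\<Sum>i=1..n. \<epsilon> i * (T (obs n \<theta>\<^sub>0 \<epsilon>) i - \<theta> i))\<^sup>2 \<le> Q \<epsilon> * (\<Sum>i=1..n. (T (obs n \<theta>\<^sub>0 \<epsilon>) i - \<theta> i)\<^sup>2)"
      unfolding Q_def K_def
      by (rule noise_inner_product_bound[OF Tin n s w \<mu>(1,2)]) (erule \<mu>(3), rule z)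
    from LSE_oracle_pointwise[OF lse \<theta> \<eta> Q0 this]
    have "(edist n (T (obs n \<theta>\<^sub>0 \<epsilon>)) \<theta>\<^sub>0)\<^sup>2 \<le> ((1 + 2 * \<eta>) * (edist n \<theta> \<theta>\<^sub>0)\<^sup>2 + Q \<epsilon> / \<eta>) / (1 - 2 * \<eta>)"
      using \<eta> by (simp add: pos_le_divide_eq mult.commute)
    also have "\<dots> = R1 + R2 * total_excess \<sigma> w \<mu> k \<epsilon>"
    proof -
      have "(a * S + K * (x + y) / \<eta>) / u = a / u * S + 1 / (\<eta> * u) * K * x + 1 / (\<eta> * u) * K * y"
        if "u > 0" for a S x y u :: real
        using that \<eta>(1) by (simp add: field_simps)
      then show ?thesis using \<eta>(2) unfolding R1_def R2_def Q_def by simp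
    qed
    finally show ?thesis .
  qed
  note E = total_excess_expectation[OF s w k \<mu>]
  interpret prob_space "noise n \<sigma>" by (rule prob_space_noise[OF s])
  have "risk n \<sigma> \<theta>\<^sub>0 T \<le> (\<integral>\<^sup>+\<epsilon>. ennreal R1 + ennreal R2 * ennreal (total_excess \<sigma> w \<mu> k \<epsilon>) \<partial>noise n \<sigma>)"
    unfolding risk_def
  proof (rule nn_integral_mono)
    fix \<epsilon>
    show "ennreal ((edist n (T (obs n \<theta>\<^sub>0 \<epsilon>)) \<theta>\<^sub>0)\<^sup>2) \<le> ennreal R1 + ennreal R2 * ennreal (total_excess \<sigma> w \<mu> k \<epsilon>)"
      using ennreal_leI[OF pt[of \<epsilon>]] R10 R20 total_excess_nonneg[of \<sigma> w \<mu> k \<epsilon>] by (simp add: ennreal_plus ennreal_mult)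
  qed
  also have "\<dots> = ennreal R1 + ennreal R2 * (\<integral>\<^sup>+\<epsilon>. ennreal (total_excess \<sigma> w \<mu> k \<epsilon>) \<partial>noise n \<sigma>)"
    using E(1) by (simp add: nn_integral_add nn_integral_cmult emeasure_space_1)
  also have "\<dots> \<le> ennreal R1 + ennreal R2 * ennreal (1280 * real k * Lg\<^sup>2 * exp (- w / 4))"
    unfolding Lg_def by (intro add_left_mono mult_left_mono E(2)) auto
  also have "\<dots> = ennreal (R1 + R2 * (1280 * real k * Lg\<^sup>2 * exp (- w / 4)))"
    using R10 R20 by (simp add: ennreal_plus ennreal_mult)
  also have "\<dots> \<le> ennreal ((1 + 2 * \<eta>) / (1 - 2 * \<eta>) * (edist n \<theta> \<theta>\<^sub>0)\<^sup>2
     + Crisk d / (\<eta> * (1 - 2 * \<eta>)) * \<sigma>\<^sup>2 * real k * ln Lg)"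
  proof (rule ennreal_leI)
    have "exp (- w / 4) = 1 / Lg\<^sup>2"
    proof -
      have "exp (- w / 4) = exp (- (ln Lg + ln Lg))" by (simp add: w_def)
      also have "\<dots> = 1 / Lg\<^sup>2" using Lg unfolding exp_minus exp_add by (simp add: power2_eq_square field_simps)
      finally show ?thesis .
    qed
    then have "1280 * real k * Lg\<^sup>2 * exp (- w / 4) = 1280 * real k" using Lg by simp
    also have "\<dots> \<le> 2560 * real k * ln Lg" using Lg(2) mult_left_mono[OF Lg(2), of "2560 * real k"] by simp
    finally have "R2 * (1280 * real k * Lg\<^sup>2 * exp (- w / 4)) \<le> R2 * (2560 * real k * ln Lg)" using R20 by (rule mult_left_mono)
    then have "R1 + R2 * (1280 * real k * Lg\<^sup>2 * exp (- w / 4)) \<le> R1 + R2 * (2560 * real k * ln Lg)" by simp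
    also have "\<dots> = (1 + 2 * \<eta>) / (1 - 2 * \<eta>) * (edist n \<theta> \<theta>\<^sub>0)\<^sup>2
     + 1 / (\<eta> * (1 - 2 * \<eta>)) * (K * ((2 * real (Suc d) + 1) * real k * w + 2560 * real k * ln Lg))"
      unfolding R1_def R2_def by (simp only: distrib_left mult.assoc add.assoc)
    also have "K * ((2 * real (Suc d) + 1) * real k * w + 2560 * real k * ln Lg) = Crisk d * \<sigma>\<^sup>2 * real k * ln Lg"
      unfolding K_def Crisk_def w_def by (simp add: algebra_simps)
    finally show "R1 + R2 * (1280 * real k * Lg\<^sup>2 * exp (- w / 4)) \<le> (1 + 2 * \<eta>) / (1 - 2 * \<eta>) * (edist n \<theta> \<theta>\<^sub>0)\<^sup>2
     + Crisk d / (\<eta> * (1 - 2 * \<eta>)) * \<sigma>\<^sup>2 * real k * ln Lg" by simp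
  qed
  finally show ?thesis unfolding Lg_def .
qed

lemma LSE_oracle_inequality:
  assumes "\<delta> > 0"
  shows "\<exists>C > 0. \<forall>n k \<sigma> \<theta>\<^sub>0 T. 1 \<le> k \<longrightarrow> k \<le> n \<longrightarrow> \<sigma> > 0 \<longrightarrow> is_LSE n d k T \<longrightarrow>
    risk n \<sigma> \<theta>\<^sub>0 T \<le> ennreal ((1 + \<delta>) * (INF \<theta>\<in>Theta n d k. (edist n \<theta> \<theta>\<^sub>0)\<^sup>2)
       + C * \<sigma>\<^sup>2 * real k * ln (ln (16 * real n / real k)))"
proof -
  \<comment> \<open>The solution of
    \<open>(1 + 2 \<eta>) / (1 - 2 \<eta>) = 1 + \<delta>\<close>.\<close>
  define \<eta> where "\<eta> = \<delta> / (2 * (2 + \<delta>))"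
  have \<eta>: "0 < \<eta>" "\<eta> < 1/2" using assms by (auto simp: \<eta>_def divide_simps)
  have 2: "1 - 2 * \<eta> = 2 / (2 + \<delta>)" "1 + 2 * \<eta> = (1 + \<delta>) * (2 / (2 + \<delta>))"
    using assms by (simp_all add: \<eta>_def field_simps)
  then have ratio: "(1 + 2 * \<eta>) / (1 - 2 * \<eta>) = 1 + \<delta>" using assms by simp
  \<comment> \<open>The added 1 makes \<open>C\<close> positive from \<open>Crisk d >= 0\<close>
    alone.\<close>
  define C where "C = Crisk d / (\<eta> * (1 - 2 * \<eta>)) + 1"
  have Cr: "Crisk d \<ge> 0" using Cblk_nonneg[of "Suc d"] by (simp add: Crisk_def)
  have C0: "C > 0" unfolding C_def using \<eta> Cr by (intro add_nonneg_pos divide_nonneg_nonneg mult_nonneg_nonneg) auto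
  show ?thesis
  proof (intro exI[of _ C] conjI C0 allI impI)
    fix n k :: nat and \<sigma> :: real and \<theta>\<^sub>0 T
    assume k: "1 \<le> k" "k \<le> n" and s: "\<sigma> > 0" and lse: "is_LSE n d k T"
    define B where "B = C * \<sigma>\<^sup>2 * real k * ln (ln (16 * real n / real k))"
    have ll: "ln (ln (16 * real n / real k)) \<ge> 0" using loglog_lower_bound(2)[OF k] by linarith
    have B0: "B \<ge> 0" using C0 ll by (simp add: B_def)
    have bd: "risk n \<sigma> \<theta>\<^sub>0 T \<le> ennreal ((1 + \<delta>) * (edist n \<theta> \<theta>\<^sub>0)\<^sup>2 + B)" if "\<theta> \<in> Theta n d k" for \<theta>
    proof -
      have "risk n \<sigma> \<theta>\<^sub>0 T \<le> ennreal ((1 + \<delta>) * (edist n \<theta> \<theta>\<^sub>0)\<^sup>2 + (C - 1) * \<sigma>\<^sup>2 * real k * ln (ln (16 * real n / real k)))"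
        using LSE_risk_bound[OF lse that \<eta> k s, of \<theta>\<^sub>0] unfolding ratio C_def by simp
      also have "\<dots> \<le> ennreal ((1 + \<delta>) * (edist n \<theta> \<theta>\<^sub>0)\<^sup>2 + B)"
        unfolding B_def using ll by (intro ennreal_leI add_left_mono mult_right_mono) auto
      finally show ?thesis .
    qed
    \<comment> \<open>The infimum is taken in the reals and is meaningful only over a nonempty set;
      a value of the estimator is a witness.\<close>
    have ne: "Theta n d k \<noteq> {}"
      using lse obs_in_Rn[of n \<theta>\<^sub>0 "\<lambda>_. 0"] unfolding is_LSE_def is_arg_min_def by blast
    then obtain \<theta>1 where "\<theta>1 \<in> Theta n d k" by blast
    then have "risk n \<sigma> \<theta>\<^sub>0 T < \<top>" using bd[of \<theta>1] by (meson ennreal_less_top le_less_trans)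
    then obtain r where r: "r \<ge> 0" "risk n \<sigma> \<theta>\<^sub>0 T = ennreal r" by (cases "risk n \<sigma> \<theta>\<^sub>0 T") auto
    \<comment> \<open>Solved for the distance, the bound for every competitor passes to the
      infimum.\<close>
    have "(r - B) / (1 + \<delta>) \<le> (INF \<theta>\<in>Theta n d k. (edist n \<theta> \<theta>\<^sub>0)\<^sup>2)"
    proof (rule cINF_greatest[OF ne])
      fix \<theta> assume "\<theta> \<in> Theta n d k"
      from bd[OF this] have "r \<le> (1 + \<delta>) * (edist n \<theta> \<theta>\<^sub>0)\<^sup>2 + B"
        unfolding r(2) using assms B0 by (subst (asm) ennreal_le_iff) auto
      then show "(r - B) / (1 + \<delta>) \<le> (edist n \<theta> \<theta>\<^sub>0)\<^sup>2" using assms by (simp add: field_simps)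
    qed
    then have "r \<le> (1 + \<delta>) * (INF \<theta>\<in>Theta n d k. (edist n \<theta> \<theta>\<^sub>0)\<^sup>2) + B" using assms by (simp add: field_simps)
    then show "risk n \<sigma> \<theta>\<^sub>0 T \<le> ennreal ((1 + \<delta>) * (INF \<theta>\<in>Theta n d k. (edist n \<theta> \<theta>\<^sub>0)\<^sup>2)
       + C * \<sigma>\<^sup>2 * real k * ln (ln (16 * real n / real k)))"
      unfolding r(2) B_def by (rule ennreal_leI)
  qed
qed

section \<open>The minimax lower bound\<close>

text \<open>The density of the law of \<open>obs n \<theta>\<close> with respect to \<open>noise n \<sigma>\<close>.\<close>

definition lik :: "nat \<Rightarrow> real \<Rightarrow> (nat \<Rightarrow> real) \<Rightarrow> (nat \<Rightarrow> real) \<Rightarrow> real" where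
  "lik n \<sigma> \<theta> y = exp ((\<Sum>i=1..n. \<theta> i / \<sigma>\<^sup>2 * y i) - (\<Sum>i=1..n. (\<theta> i)\<^sup>2) / (2 * \<sigma>\<^sup>2))"

lemma lik_measurable: "(\<lambda>y. ennreal (lik n \<sigma> \<theta> y)) \<in> borel_measurable (Rn n)"
  unfolding lik_def using Rn_linear[where n = n and c = "\<lambda>i. \<theta> i / \<sigma>\<^sup>2"] by measurable

lemma obs_measurable: "obs n \<theta> \<in> Rn n \<rightarrow>\<^sub>M Rn n"
  unfolding Rn_def obs_def by (rule measurable_restrict) measurable

lemma normal_shift:
  assumes "A \<in> sets borel"
  shows "emeasure (density lborel (\<lambda>x. ennreal (normal_density 0 \<sigma> x))) ((\<lambda>x. t + x) -` A) =
    emeasure (density lborel (\<lambda>x. ennreal (normal_density t \<sigma> x))) A"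
proof -
  have A: "(\<lambda>x. t + x) -` A \<in> sets borel"
    using measurable_sets[of "\<lambda>x. t + x" borel borel A] assms by simp
  have "emeasure (density lborel (\<lambda>x. ennreal (normal_density t \<sigma> x))) A
    = (\<integral>\<^sup>+x. ennreal (normal_density t \<sigma> x) * indicator A x \<partial>lborel)"
    using assms by (simp add: emeasure_density)
  also have "\<dots> = (\<integral>\<^sup>+x. ennreal (normal_density t \<sigma> (t + 1 * x)) * indicator A (t + 1 * x) \<partial>lborel)"
    using assms by (subst nn_integral_real_affine[of _ 1 t]) (auto simp: )
  also have "\<dots> = (\<integral>\<^sup>+x. ennreal (normal_density 0 \<sigma> x) * indicator ((\<lambda>x. t + x) -` A) x \<partial>lborel)"
    by (simp add: normal_density_def indicator_def)
  finally show ?thesis using A by (simp add: emeasure_density)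
qed

lemma normal_tilt:
  assumes "\<sigma> > 0" "A \<in> sets borel"
  shows "(\<integral>\<^sup>+x. ennreal (exp (t / \<sigma>\<^sup>2 * x - t\<^sup>2 / (2 * \<sigma>\<^sup>2))) * indicator A x \<partial>density lborel (\<lambda>x. ennreal (normal_density 0 \<sigma> x))) =
    emeasure (density lborel (\<lambda>x. ennreal (normal_density t \<sigma> x))) A"
proof -
  have e: "normal_density 0 \<sigma> x * exp (t / \<sigma>\<^sup>2 * x - t\<^sup>2 / (2 * \<sigma>\<^sup>2)) = normal_density t \<sigma> x" for x
  proof -
    have "- (x\<^sup>2 / (2 * \<sigma>\<^sup>2)) + (t / \<sigma>\<^sup>2 * x - t\<^sup>2 / (2 * \<sigma>\<^sup>2)) = - ((x - t)\<^sup>2 / (2 * \<sigma>\<^sup>2))"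
      using assms(1) by (simp add: field_simps power2_eq_square)
    then have "exp (- (x\<^sup>2 / (2 * \<sigma>\<^sup>2))) * exp (t / \<sigma>\<^sup>2 * x - t\<^sup>2 / (2 * \<sigma>\<^sup>2)) = exp (- ((x - t)\<^sup>2 / (2 * \<sigma>\<^sup>2)))"
      by (simp flip: exp_add)
    then show ?thesis by (simp add: normal_density_def)
  qed
  have "(\<integral>\<^sup>+x. ennreal (exp (t / \<sigma>\<^sup>2 * x - t\<^sup>2 / (2 * \<sigma>\<^sup>2))) * indicator A x \<partial>density lborel (\<lambda>x. ennreal (normal_density 0 \<sigma> x)))
    = (\<integral>\<^sup>+x. ennreal (normal_density 0 \<sigma> x) * (ennreal (exp (t / \<sigma>\<^sup>2 * x - t\<^sup>2 / (2 * \<sigma>\<^sup>2))) * indicator A x) \<partial>lborel)"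
    using assms(2) by (intro nn_integral_density) auto
  also have "\<dots> = (\<integral>\<^sup>+x. ennreal (normal_density t \<sigma> x) * indicator A x \<partial>lborel)"
    by (simp only: mult.assoc[symmetric] ennreal_mult'[symmetric, OF normal_density_nonneg] e)
  finally show ?thesis using assms(2) by (simp add: emeasure_density)
qed

text \<open>Shifting the noise and weighting it by \<open>lik\<close> give the same measure: on
  boxes both are products of normal laws with means \<open>\<theta> i\<close>, and boxes determine a
  product measure.\<close>

lemma noise_change_of_measure:
  assumes s: "\<sigma> > 0" and F: "F \<in> borel_measurable (Rn n)"
  shows "(\<integral>\<^sup>+\<epsilon>. F (obs n \<theta> \<epsilon>) \<partial>noise n \<sigma>) = (\<integral>\<^sup>+y. ennreal (lik n \<sigma> \<theta> y) * F y \<partial>noise n \<sigma>)"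
proof -
  define D where "D t = density lborel (\<lambda>x. ennreal (normal_density t \<sigma> x))" for t :: real
  have setsD: "sets (D t) = sets borel" "space (D t) = UNIV" for t by (simp_all add: D_def)
  have sfD: "sigma_finite_measure (D t)" for t
    unfolding D_def using prob_space_imp_sigma_finite prob_space_normal_density s by blast
  interpret P: product_sigma_finite "\<lambda>i. D (\<theta> i)" using sfD by (simp add: product_sigma_finite_def)
  interpret P0: product_sigma_finite "\<lambda>_::nat. D 0" using sfD by (simp add: product_sigma_finite_def)
  have noise: "noise n \<sigma> = Pi\<^sub>M {1..n} (\<lambda>_. D 0)" by (simp add: noise_def D_def)
  have sets: "sets (Pi\<^sub>M {1..n} (\<lambda>i. D (\<theta> i))) = sets (Rn n)"
    unfolding Rn_def by (rule sets_PiM_cong) (auto simp: setsD)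
  have Asets: "Pi\<^sub>E {1..n} A \<in> sets (Rn n)" if "\<And>i. i \<in> {1..n} \<Longrightarrow> A i \<in> sets (D (\<theta> i))" for A
    unfolding Rn_def using that by (intro sets_PiM_I_finite) (auto simp: setsD)
  have obsm: "obs n \<theta> \<in> noise n \<sigma> \<rightarrow>\<^sub>M Rn n" unfolding measurable_noise by (rule obs_measurable)
  have 1: "distr (noise n \<sigma>) (Rn n) (obs n \<theta>) = Pi\<^sub>M {1..n} (\<lambda>i. D (\<theta> i))"
  proof (rule P.PiM_eqI)
    fix A assume A: "\<And>i. i \<in> {1..n} \<Longrightarrow> A i \<in> sets (D (\<theta> i))"
    have "obs n \<theta> -` Pi\<^sub>E {1..n} A \<inter> space (noise n \<sigma>) = Pi\<^sub>E {1..n} (\<lambda>i. (\<lambda>x. \<theta> i + x) -` A i)"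
      unfolding space_noise Rn_def space_PiM by (auto simp: obs_def PiE_iff)
    then have "emeasure (distr (noise n \<sigma>) (Rn n) (obs n \<theta>)) (Pi\<^sub>E {1..n} A) = emeasure (noise n \<sigma>) (Pi\<^sub>E {1..n} (\<lambda>i. (\<lambda>x. \<theta> i + x) -` A i))"
      using obsm Asets[OF A] by (simp add: emeasure_distr)
    also have "\<dots> = (\<Prod>i=1..n. emeasure (D 0) ((\<lambda>x. \<theta> i + x) -` A i))"
      unfolding noise
    proof (rule P0.emeasure_PiM)
      fix i assume "i \<in> {1..n}"
      then show "(\<lambda>x. \<theta> i + x) -` A i \<in> sets (D 0)"
        using measurable_sets[of "\<lambda>x. \<theta> i + x" borel borel "A i"] A by (simp add: setsD)
    qed simp
    also have "\<dots> = (\<Prod>i=1..n. emeasure (D (\<theta> i)) (A i))"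
      unfolding D_def by (intro prod.cong refl normal_shift) (use A setsD in auto)
    finally show "emeasure (distr (noise n \<sigma>) (Rn n) (obs n \<theta>)) (Pi\<^sub>E {1..n} A) = (\<Prod>i=1..n. emeasure (D (\<theta> i)) (A i))" .
  qed (simp_all add: sets del: One_nat_def)
  have Lm: "(\<lambda>y. ennreal (lik n \<sigma> \<theta> y)) \<in> borel_measurable (noise n \<sigma>)"
    unfolding measurable_noise by (rule lik_measurable)
  have 2: "density (noise n \<sigma>) (\<lambda>y. ennreal (lik n \<sigma> \<theta> y)) = Pi\<^sub>M {1..n} (\<lambda>i. D (\<theta> i))"
  proof (rule P.PiM_eqI)
    fix A assume A: "\<And>i. i \<in> {1..n} \<Longrightarrow> A i \<in> sets (D (\<theta> i))"
    have AS: "Pi\<^sub>E {1..n} A \<in> sets (noise n \<sigma>)" using Asets[OF A] by (simp add: sets_noise)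
    define g where "g i x = (if i \<in> {1..n} then ennreal (exp (\<theta> i / \<sigma>\<^sup>2 * x - (\<theta> i)\<^sup>2 / (2 * \<sigma>\<^sup>2))) * indicator (A i) x else 0)" for i x
    have "emeasure (density (noise n \<sigma>) (\<lambda>y. ennreal (lik n \<sigma> \<theta> y))) (Pi\<^sub>E {1..n} A)
      = (\<integral>\<^sup>+y. ennreal (lik n \<sigma> \<theta> y) * indicator (Pi\<^sub>E {1..n} A) y \<partial>noise n \<sigma>)"
      by (rule emeasure_density[OF Lm AS])
    also have "\<dots> = (\<integral>\<^sup>+y. (\<Prod>i=1..n. g i (y i)) \<partial>noise n \<sigma>)"
    proof (rule nn_integral_cong)
      fix y assume "y \<in> space (noise n \<sigma>)"
      then have y: "y \<in> extensional {1..n}" by (auto simp: space_noise Rn_def space_PiM PiE_def)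
      have "lik n \<sigma> \<theta> y = (\<Prod>i=1..n. exp (\<theta> i / \<sigma>\<^sup>2 * y i - (\<theta> i)\<^sup>2 / (2 * \<sigma>\<^sup>2)))"
        by (simp add: lik_def exp_sum[symmetric] sum_subtractf sum_divide_distrib)
      moreover have "indicator (Pi\<^sub>E {1..n} A) y = (\<Prod>i=1..n. indicator (A i) (y i) :: ennreal)"
      proof (cases "y \<in> Pi\<^sub>E {1..n} A")
        case True then show ?thesis by (auto simp: PiE_iff intro!: prod.neutral[symmetric])
      next
        case False
        then obtain i where "i \<in> {1..n}" "y i \<notin> A i" using y by (auto simp: PiE_iff)
        then have "(\<Prod>i=1..n. indicator (A i) (y i) :: ennreal) = 0"
          by (intro prod_zero) (auto intro!: bexI[of _ i])
        then show ?thesis using False by simp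
      qed
      ultimately show "ennreal (lik n \<sigma> \<theta> y) * indicator (Pi\<^sub>E {1..n} A) y = (\<Prod>i=1..n. g i (y i))"
        by (simp add: g_def prod.distrib prod_ennreal)
    qed
    also have "\<dots> = (\<Prod>i=1..n. \<integral>\<^sup>+x. g i x \<partial>D 0)"
      unfolding noise
    proof (rule P0.product_nn_integral_prod)
      fix i :: nat
      show "g i \<in> borel_measurable (D 0)"
      proof (cases "i \<in> {1..n}")
        case True
        then have [measurable]: "A i \<in> sets borel" using A setsD by auto
        show ?thesis using True unfolding g_def D_def by simp
      next
        case False
        then have "g i = (\<lambda>x. 0)" by (auto simp: g_def)
        then show ?thesis by simp
      qed
    qed simp
    also have "\<dots> = (\<Prod>i=1..n. emeasure (D (\<theta> i)) (A i))"
    proof (intro prod.cong refl)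
      fix i assume i: "i \<in> {1..n}"
      show "(\<integral>\<^sup>+x. g i x \<partial>D 0) = emeasure (D (\<theta> i)) (A i)"
        using normal_tilt[OF s, of "A i" "\<theta> i"] A[OF i] i setsD by (simp add: g_def D_def)
    qed
    finally show "emeasure (density (noise n \<sigma>) (\<lambda>y. ennreal (lik n \<sigma> \<theta> y))) (Pi\<^sub>E {1..n} A) = (\<Prod>i=1..n. emeasure (D (\<theta> i)) (A i))" .
  qed (simp_all add: sets sets_noise del: One_nat_def)
  have "(\<integral>\<^sup>+\<epsilon>. F (obs n \<theta> \<epsilon>) \<partial>noise n \<sigma>) = integral\<^sup>N (distr (noise n \<sigma>) (Rn n) (obs n \<theta>)) F"
    using obsm F by (simp add: nn_integral_distr)
  also have "\<dots> = integral\<^sup>N (density (noise n \<sigma>) (\<lambda>y. ennreal (lik n \<sigma> \<theta> y))) F" by (simp only: 1 2)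
  also have "\<dots> = (\<integral>\<^sup>+y. ennreal (lik n \<sigma> \<theta> y) * F y \<partial>noise n \<sigma>)"
    using F Lm by (intro nn_integral_density) (auto simp: measurable_noise)
  finally show ?thesis .
qed

text \<open>One plus the chi-square divergence of the law of the data from pure noise. The
  exponential with coefficients \<open>2 \<theta> i / \<sigma>^2\<close> contributes
  \<open>2 N / \<sigma>^2\<close> to the exponent, and the normalisation takes away half of
  it.\<close>

lemma lik_second_moment:
  assumes "\<sigma> > 0"
  shows "(\<integral>\<^sup>+y. ennreal ((lik n \<sigma> \<theta> y)\<^sup>2) \<partial>noise n \<sigma>) = ennreal (exp ((\<Sum>i=1..n. (\<theta> i)\<^sup>2) / \<sigma>\<^sup>2))"
proof -
  define N where "N = (\<Sum>i=1..n. (\<theta> i)\<^sup>2)"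
  have e: "(lik n \<sigma> \<theta> y)\<^sup>2 = exp (- N / \<sigma>\<^sup>2) * exp (\<Sum>i=1..n. (2 * \<theta> i / \<sigma>\<^sup>2) * y i)" for y
  proof -
    have "(lik n \<sigma> \<theta> y)\<^sup>2 = exp (2 * ((\<Sum>i=1..n. \<theta> i / \<sigma>\<^sup>2 * y i) - N / (2 * \<sigma>\<^sup>2)))"
      unfolding lik_def N_def by (simp add: power2_eq_square flip: exp_add)
    also have "2 * ((\<Sum>i=1..n. \<theta> i / \<sigma>\<^sup>2 * y i) - N / (2 * \<sigma>\<^sup>2)) = - N / \<sigma>\<^sup>2 + (\<Sum>i=1..n. (2 * \<theta> i / \<sigma>\<^sup>2) * y i)"
      by (simp add: sum_distrib_left algebra_simps)
    finally show ?thesis by (simp only: exp_add)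
  qed
  have "(\<integral>\<^sup>+y. ennreal ((lik n \<sigma> \<theta> y)\<^sup>2) \<partial>noise n \<sigma>) = ennreal (exp (- N / \<sigma>\<^sup>2)) * (\<integral>\<^sup>+y. ennreal (exp (\<Sum>i=1..n. (2 * \<theta> i / \<sigma>\<^sup>2) * y i)) \<partial>noise n \<sigma>)"
    unfolding e ennreal_mult'[OF exp_ge_zero]
    by (rule nn_integral_cmult) (use Rn_linear[where n = n and c = "\<lambda>i. 2 * \<theta> i / \<sigma>\<^sup>2"] in \<open>auto simp: measurable_noise\<close>)
  also have "\<dots> = ennreal (exp (- N / \<sigma>\<^sup>2) * exp (\<sigma>\<^sup>2 * (\<Sum>i=1..n. (2 * \<theta> i / \<sigma>\<^sup>2)\<^sup>2) / 2))"
    unfolding noise_mgf[OF assms] by (rule ennreal_mult'[symmetric]) simp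
  also have "\<sigma>\<^sup>2 * (\<Sum>i=1..n. (2 * \<theta> i / \<sigma>\<^sup>2)\<^sup>2) / 2 = 2 * N / \<sigma>\<^sup>2"
  proof -
    have "(\<Sum>i=1..n. (2 * \<theta> i / \<sigma>\<^sup>2)\<^sup>2) = (4 / (\<sigma>\<^sup>2)\<^sup>2) * N"
      unfolding N_def sum_distrib_left by (intro sum.cong refl) (simp add: power_divide power_mult_distrib)
    then show ?thesis using assms by (simp add: power2_eq_square)
  qed
  also have "exp (- N / \<sigma>\<^sup>2) * exp (2 * N / \<sigma>\<^sup>2) = exp (N / \<sigma>\<^sup>2)"
    by (simp flip: exp_add)
  finally show ?thesis unfolding N_def .
qed

section \<open>Reduction to many separated hypotheses\<close>

lemma edist_triangle: "edist n x z \<le> edist n x y + edist n y z"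
  unfolding edist_def using L2_set_triangle_ineq[of "\<lambda>i. x i - y i" "\<lambda>i. y i - z i" "{1..n}"] by simp

lemma edist_commute: "edist n x y = edist n y x"
  unfolding edist_def L2_set_def by (simp add: power2_commute)

text \<open>The events with indicators \<open>I j\<close>, that the estimator is within
  \<open>r / 2\<close> of \<open>\<theta> j\<close>, are disjoint, and off them the loss is at least
  \<open>r^2 / 4\<close>. On such an event \<open>L <= L^2 / M + M / 4\<close>. Summed over
  \<open>j\<close>, the first terms have mean at most \<open>M / 4\<close> by the second moments,
  and the second terms at most \<open>M / 4\<close> by disjointness. So at most half of the total
  likelihood mass \<open>M\<close> lies on the events, which leaves an average risk of at least
  \<open>r^2 / 8\<close>.\<close>

lemma multiple_hypotheses_lower_bound:
  fixes \<theta> :: "nat \<Rightarrow> nat \<Rightarrow> real"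
  assumes s: "\<sigma> > 0" and M: "finite J" "card J = M" "M > 0"
    and nrm: "\<And>j. j \<in> J \<Longrightarrow> (\<Sum>i=1..n. (\<theta> j i)\<^sup>2) \<le> \<sigma>\<^sup>2 * ln (real M / 4)"
    and sep: "\<And>i j. i \<in> J \<Longrightarrow> j \<in> J \<Longrightarrow> i \<noteq> j \<Longrightarrow> r \<le> edist n (\<theta> i) (\<theta> j)" and r: "r > 0"
    and T: "T \<in> Rn n \<rightarrow>\<^sub>M Rn n"
  shows "\<exists>j\<in>J. ennreal (r\<^sup>2 / 8) \<le> risk n \<sigma> (\<theta> j) T"
proof -
  interpret prob_space "noise n \<sigma>" by (rule prob_space_noise[OF s])
  define D where "D j y = (edist n (T y) (\<theta> j))\<^sup>2" for j y
  define I :: "nat \<Rightarrow> (nat \<Rightarrow> real) \<Rightarrow> real" where "I j y = (if edist n (T y) (\<theta> j) < r / 2 then 1 else 0)" for j y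
  define L where "L j y = lik n \<sigma> (\<theta> j) y" for j y
  have Tc: "(\<lambda>y. T y i) \<in> borel_measurable (Rn n)" if "i \<in> {1..n}" for i
    using measurable_compose[OF T Rn_component[OF that]] .
  have em: "(\<lambda>y. edist n (T y) (\<theta> j)) \<in> borel_measurable (Rn n)" for j
  proof -
    have "(\<lambda>y. \<Sum>i=1..n. (T y i - \<theta> j i)\<^sup>2) \<in> borel_measurable (Rn n)"
      by (intro borel_measurable_sum borel_measurable_power borel_measurable_diff borel_measurable_const Tc)
    then show ?thesis unfolding edist_def L2_set_def by measurable
  qed
  have Dm: "(\<lambda>y. ennreal (D j y)) \<in> borel_measurable (Rn n)" for j unfolding D_def using em[of j] by measurable
  have Lm: "(\<lambda>y. ennreal (L j y)) \<in> borel_measurable (Rn n)" for j unfolding L_def by (rule lik_measurable)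
  have L2m: "(\<lambda>y. ennreal ((L j y)\<^sup>2)) \<in> borel_measurable (Rn n)" for j
    unfolding L_def lik_def using Rn_linear[where n = n and c = "\<lambda>i. \<theta> j i / \<sigma>\<^sup>2"] by measurable
  have L0: "L j y \<ge> 0" for j y by (simp add: L_def lik_def)
  have I1: "(\<Sum>j\<in>J. I j y) \<le> 1" for y
  proof (cases "\<exists>j\<in>J. edist n (T y) (\<theta> j) < r / 2")
    case True
    then obtain j where j: "j \<in> J" "edist n (T y) (\<theta> j) < r / 2" by blast
    have "I i y = 0" if "i \<in> J - {j}" for i
    proof (rule ccontr)
      assume "I i y \<noteq> 0"
      then have "edist n (T y) (\<theta> i) < r / 2" by (simp add: I_def split: if_splits)
      then have "edist n (\<theta> i) (\<theta> j) < r"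
        using edist_triangle[of n "\<theta> i" "\<theta> j" "T y"] edist_commute[of n "\<theta> i" "T y"] j(2) by linarith
      then show False using sep[of i j] that j(1) by auto
    qed
    then have "(\<Sum>j\<in>J. I j y) = I j y" using j M(1) by (simp add: sum.remove)
    then show ?thesis by (simp add: I_def)
  next
    case False
    then have "(\<Sum>j\<in>J. I j y) = 0" by (intro sum.neutral) (auto simp: I_def)
    then show ?thesis by simp
  qed
  have pt: "r\<^sup>2 / 4 * (\<Sum>j\<in>J. L j y) \<le> (\<Sum>j\<in>J. L j y * D j y) + (r\<^sup>2 / (4 * real M) * (\<Sum>j\<in>J. (L j y)\<^sup>2) + r\<^sup>2 * real M / 16)" for y
  proof -
    have "r\<^sup>2 / 4 * L j y \<le> L j y * D j y + (r\<^sup>2 / (4 * real M) * (L j y)\<^sup>2 + r\<^sup>2 * real M / 16 * I j y)" for j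
    proof (cases "edist n (T y) (\<theta> j) < r / 2")
      case True
      \<comment> \<open>Nonnegativity of the square is the inequality
        \<open>L <= L^2 / M + M / 4\<close>, which balances the two error terms.\<close>
      have "0 \<le> r\<^sup>2 / 4 * ((L j y / real M - 1 / 2)\<^sup>2 * real M)" by simp
      also have "\<dots> = r\<^sup>2 / (4 * real M) * (L j y)\<^sup>2 + r\<^sup>2 * real M / 16 - r\<^sup>2 / 4 * L j y"
        using M(3) by (simp add: power2_eq_square field_simps)
      finally show ?thesis using True L0[of j y] by (simp add: I_def D_def add_increasing)
    next
      case False
      then have "(r / 2)\<^sup>2 \<le> D j y" unfolding D_def using r by (intro power_mono) auto
      then have "L j y * (r\<^sup>2 / 4) \<le> L j y * D j y" using L0 by (intro mult_left_mono) (auto simp: power_divide)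
      then show ?thesis using False by (simp add: I_def mult.commute add_increasing2)
    qed
    then have "(\<Sum>j\<in>J. r\<^sup>2 / 4 * L j y) \<le> (\<Sum>j\<in>J. L j y * D j y + (r\<^sup>2 / (4 * real M) * (L j y)\<^sup>2 + r\<^sup>2 * real M / 16 * I j y))"
      by (rule sum_mono)
    also have "\<dots> = (\<Sum>j\<in>J. L j y * D j y) + (r\<^sup>2 / (4 * real M) * (\<Sum>j\<in>J. (L j y)\<^sup>2) + r\<^sup>2 * real M / 16 * (\<Sum>j\<in>J. I j y))"
      by (simp only: sum.distrib sum_distrib_left)
    finally show ?thesis using mult_left_mono[OF I1[of y], of "r\<^sup>2 * real M / 16"] by (simp add: sum_distrib_left)
  qed
  have "ennreal (r\<^sup>2 / 4) * (\<Sum>j\<in>J. \<integral>\<^sup>+y. ennreal (L j y) \<partial>noise n \<sigma>) =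
      (\<integral>\<^sup>+y. ennreal (r\<^sup>2 / 4) * (\<Sum>j\<in>J. ennreal (L j y)) \<partial>noise n \<sigma>)"
    by (subst nn_integral_cmult, simp only: measurable_noise, intro borel_measurable_sum Lm,
        subst nn_integral_sum) (simp_all only: measurable_noise Lm)
  also have "\<dots> \<le> (\<integral>\<^sup>+y. (\<Sum>j\<in>J. ennreal (L j y) * ennreal (D j y)) + (ennreal (r\<^sup>2 / (4 * real M)) * (\<Sum>j\<in>J. ennreal ((L j y)\<^sup>2)) + ennreal (r\<^sup>2 * real M / 16)) \<partial>noise n \<sigma>)"
  proof (rule nn_integral_mono)
    fix y
    have "ennreal (r\<^sup>2 / 4 * (\<Sum>j\<in>J. L j y)) = ennreal (r\<^sup>2 / 4) * (\<Sum>j\<in>J. ennreal (L j y))"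
      "ennreal (r\<^sup>2 / (4 * real M) * (\<Sum>j\<in>J. (L j y)\<^sup>2)) = ennreal (r\<^sup>2 / (4 * real M)) * (\<Sum>j\<in>J. ennreal ((L j y)\<^sup>2))"
      using L0 by (simp_all only: sum_ennreal zero_le_power2) (rule ennreal_mult', simp)+
    moreover have "ennreal (\<Sum>j\<in>J. L j y * D j y) = (\<Sum>j\<in>J. ennreal (L j y) * ennreal (D j y))"
      using L0 by (subst sum_ennreal[symmetric]) (auto simp: D_def ennreal_mult)
    moreover have "0 \<le> (\<Sum>j\<in>J. L j y * D j y)" "0 \<le> r\<^sup>2 / (4 * real M) * (\<Sum>j\<in>J. (L j y)\<^sup>2)"
      using L0 by (auto simp: D_def intro!: sum_nonneg mult_nonneg_nonneg divide_nonneg_nonneg)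
    ultimately show "ennreal (r\<^sup>2 / 4) * (\<Sum>j\<in>J. ennreal (L j y)) \<le> (\<Sum>j\<in>J. ennreal (L j y) * ennreal (D j y)) + (ennreal (r\<^sup>2 / (4 * real M)) * (\<Sum>j\<in>J. ennreal ((L j y)\<^sup>2)) + ennreal (r\<^sup>2 * real M / 16))"
      using ennreal_leI[OF pt[of y]] by (simp add: ennreal_plus del: sum_ennreal)
  qed
  also have "\<dots> = (\<Sum>j\<in>J. \<integral>\<^sup>+y. ennreal (L j y) * ennreal (D j y) \<partial>noise n \<sigma>) +
      (ennreal (r\<^sup>2 / (4 * real M)) * (\<Sum>j\<in>J. \<integral>\<^sup>+y. ennreal ((L j y)\<^sup>2) \<partial>noise n \<sigma>) + ennreal (r\<^sup>2 * real M / 16))"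
  proof -
    have m: "(\<lambda>y. \<Sum>j\<in>J. ennreal (L j y) * ennreal (D j y)) \<in> borel_measurable (noise n \<sigma>)"
      "(\<lambda>y. \<Sum>j\<in>J. ennreal ((L j y)\<^sup>2)) \<in> borel_measurable (noise n \<sigma>)"
      unfolding measurable_noise by (intro borel_measurable_sum borel_measurable_times_ennreal Lm Dm L2m)+
    have i: "(\<integral>\<^sup>+y. (\<Sum>j\<in>J. ennreal (L j y) * ennreal (D j y)) \<partial>noise n \<sigma>) = (\<Sum>j\<in>J. \<integral>\<^sup>+y. ennreal (L j y) * ennreal (D j y) \<partial>noise n \<sigma>)"
      "(\<integral>\<^sup>+y. (\<Sum>j\<in>J. ennreal ((L j y)\<^sup>2)) \<partial>noise n \<sigma>) = (\<Sum>j\<in>J. \<integral>\<^sup>+y. ennreal ((L j y)\<^sup>2) \<partial>noise n \<sigma>)"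
      by (rule nn_integral_sum, simp only: measurable_noise, intro borel_measurable_times_ennreal Lm Dm L2m)+
    show ?thesis
      by (subst nn_integral_add, rule m(1), intro borel_measurable_add borel_measurable_times_ennreal borel_measurable_const m(2),
          subst nn_integral_add, intro borel_measurable_times_ennreal borel_measurable_const m(2), rule borel_measurable_const,
          subst nn_integral_cmult, rule m(2))
        (simp only: i emeasure_space_1 nn_integral_const mult_1_right)
  qed
  also have "\<dots> \<le> (\<Sum>j\<in>J. risk n \<sigma> (\<theta> j) T) + (ennreal (r\<^sup>2 / (4 * real M)) * (\<Sum>j\<in>J. ennreal (real M / 4)) + ennreal (r\<^sup>2 * real M / 16))"
  proof (intro add_mono mult_left_mono sum_mono order_refl)
    fix j assume j: "j \<in> J"
    show "(\<integral>\<^sup>+y. ennreal (L j y) * ennreal (D j y) \<partial>noise n \<sigma>) \<le> risk n \<sigma> (\<theta> j) T"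
      unfolding risk_def using noise_change_of_measure[OF s Dm[of j], of "\<theta> j"] by (simp add: D_def L_def)
    have "(\<Sum>i=1..n. (\<theta> j i)\<^sup>2) / \<sigma>\<^sup>2 \<le> ln (real M / 4)" using nrm[OF j] s by (simp add: field_simps)
    then have "exp ((\<Sum>i=1..n. (\<theta> j i)\<^sup>2) / \<sigma>\<^sup>2) \<le> exp (ln (real M / 4))" by simp
    also have "\<dots> = real M / 4" using M(3) by simp
    finally show "(\<integral>\<^sup>+y. ennreal ((L j y)\<^sup>2) \<partial>noise n \<sigma>) \<le> ennreal (real M / 4)"
      unfolding L_def lik_second_moment[OF s] by (rule ennreal_leI)
  qed simp
  also have "(\<Sum>j\<in>J. ennreal (real M / 4)) = ennreal (real M * (real M / 4))"
    by (subst sum_ennreal) (use M(2) in simp_all)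
  also have "ennreal (r\<^sup>2 / (4 * real M)) * ennreal (real M * (real M / 4)) + ennreal (r\<^sup>2 * real M / 16) = ennreal (r\<^sup>2 * real M / 8)"
    by (subst ennreal_mult'[symmetric], simp, subst ennreal_plus[symmetric]) (use M(3) in \<open>auto simp: field_simps\<close>)
  \<comment> \<open>Each likelihood integrates to 1: the change of measure applied to the constant
    function 1.\<close>
  also have "(\<Sum>j\<in>J. \<integral>\<^sup>+y. ennreal (L j y) \<partial>noise n \<sigma>) = (\<Sum>j\<in>J. ennreal 1)"
    using noise_change_of_measure[OF s, of "\<lambda>_. 1" n] by (simp add: L_def emeasure_space_1)
  also have "ennreal (r\<^sup>2 / 4) * (\<Sum>j\<in>J. ennreal 1) = ennreal (r\<^sup>2 / 4 * real M)"
    by (subst sum_ennreal, simp, subst ennreal_mult'[symmetric]) (use M(2) in simp_all)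
  finally have tot: "ennreal (r\<^sup>2 / 4 * real M) \<le> (\<Sum>j\<in>J. risk n \<sigma> (\<theta> j) T) + ennreal (r\<^sup>2 * real M / 8)" .
  show ?thesis
  proof (rule ccontr)
    assume "\<not> ?thesis"
    then have lt: "risk n \<sigma> (\<theta> j) T < ennreal (r\<^sup>2 / 8)" if "j \<in> J" for j using that by (meson not_le)
    define \<rho> where "\<rho> j = enn2real (risk n \<sigma> (\<theta> j) T)" for j
    have \<rho>: "risk n \<sigma> (\<theta> j) T = ennreal (\<rho> j)" "\<rho> j \<ge> 0" "\<rho> j < r\<^sup>2 / 8" if "j \<in> J" for j
    proof -
      have "risk n \<sigma> (\<theta> j) T < \<top>" using lt[OF that] by (meson ennreal_less_top less_trans)
      then show 1: "risk n \<sigma> (\<theta> j) T = ennreal (\<rho> j)" by (simp add: \<rho>_def)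
      show 2: "\<rho> j \<ge> 0" by (simp add: \<rho>_def)
      show "\<rho> j < r\<^sup>2 / 8" using lt[OF that] 1 2 by (simp add: ennreal_less_iff)
    qed
    have "(\<Sum>j\<in>J. risk n \<sigma> (\<theta> j) T) = ennreal (\<Sum>j\<in>J. \<rho> j)"
      using \<rho> by (simp add: sum_ennreal)
    then have "ennreal (r\<^sup>2 / 4 * real M) \<le> ennreal ((\<Sum>j\<in>J. \<rho> j) + r\<^sup>2 * real M / 8)"
      using tot \<rho>(2) by (simp add: sum_nonneg ennreal_plus)
    then have le: "r\<^sup>2 / 4 * real M \<le> (\<Sum>j\<in>J. \<rho> j) + r\<^sup>2 * real M / 8"
      using \<rho>(2) by (subst (asm) ennreal_le_iff) (auto intro!: add_nonneg_nonneg sum_nonneg)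
    have "(\<Sum>j\<in>J. \<rho> j) < (\<Sum>j\<in>J. r\<^sup>2 / 8)"
    proof (rule sum_strict_mono)
      show "J \<noteq> {}" using M by auto
    qed (use M \<rho> in auto)
    then show False using le M(2) by (simp add: mult.commute)
  qed
qed

text \<open>The value at \<open>\<tau>\<close> is 0 also for \<open>d = 0\<close>, so the jump comes
  just after \<open>\<tau>\<close>, as the left-open intervals of \<open>mono_step\<close> demand.
  The division by \<open>fact d\<close> lets integration raise \<open>d\<close> by one and keep
  \<open>a\<close>.\<close>

definition trunc_power :: "nat \<Rightarrow> real \<Rightarrow> real \<Rightarrow> real \<Rightarrow> real" where
  "trunc_power d a \<tau> x = (if x \<le> \<tau> then 0 else a * (x - \<tau>) ^ d / fact d)"

lemma trunc_power_has_integral: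
  assumes "0 \<le> \<tau>" "0 \<le> x"
  shows "(trunc_power d a \<tau> has_integral trunc_power (Suc d) a \<tau> x) {0..x}"
proof -
  have zero: "(trunc_power d a \<tau> has_integral 0) {0..y}" if "y \<le> \<tau>" for y
    by (rule has_integral_is_0) (use that in \<open>auto simp: trunc_power_def\<close>)
  show ?thesis
  proof (cases "x \<le> \<tau>")
    case True then show ?thesis using zero[OF True] by (simp add: trunc_power_def)
  next
    case False
    define G where "G y = a * (y - \<tau>) ^ Suc d / fact (Suc d)" for y
    have "((\<lambda>y. a * (y - \<tau>) ^ d / fact d) has_integral (G x - G \<tau>)) {\<tau>..x}"
    proof (rule fundamental_theorem_of_calculus)
      fix y
      have "(G has_real_derivative a * (real (Suc d) * (y - \<tau>) ^ d) / fact (Suc d)) (at y within {\<tau>..x})"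
        unfolding G_def by (auto intro!: derivative_eq_intros simp del: fact_Suc power_Suc of_nat_Suc)
      moreover have "a * (real (Suc d) * (y - \<tau>) ^ d) / fact (Suc d) = a * (y - \<tau>) ^ d / fact d"
        by (simp add: divide_simps del: of_nat_Suc)
      ultimately show "(G has_vector_derivative a * (y - \<tau>) ^ d / fact d) (at y within {\<tau>..x})"
        by (simp add: has_real_derivative_iff_has_vector_derivative)
    qed (use False in simp)
    \<comment> \<open>For \<open>d = 0\<close> the polynomial has the value \<open>a\<close> at
      \<open>\<tau>\<close> and the truncated power the value 0; a single point does not affect the
      integral.\<close>
    then have "(trunc_power d a \<tau> has_integral (G x - G \<tau>)) {\<tau>..x}"
      by (rule has_integral_spike_finite[where S = "{\<tau>}", rotated 2]) (auto simp: trunc_power_def)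
    then have "(trunc_power d a \<tau> has_integral (0 + (G x - G \<tau>))) {0..x}"
      using False assms zero[of \<tau>] by (intro has_integral_combine[of 0 \<tau> x]) auto
    then show ?thesis using False by (simp add: G_def trunc_power_def)
  qed
qed

lemma iter_prim_trunc_power:
  assumes "0 \<le> \<tau>" "a \<ge> 0" "x \<in> {0..1}"
  shows "iter_prim (replicate d 0) 0 (\<lambda>x\<in>{0..1}. trunc_power 0 a \<tau> x) x = trunc_power d a \<tau> x"
  using assms(3)
proof (induction d arbitrary: x)
  case 0 then show ?case by simp
next
  case (Suc d)
  define g where "g = iter_prim (replicate d 0) 0 (\<lambda>x\<in>{0..1}. trunc_power 0 a \<tau> x)"
  have "mono_on {0..1} (\<lambda>x\<in>{0..1}. trunc_power 0 a \<tau> x)"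
    using assms(2) by (intro mono_onI) (auto simp: trunc_power_def)
  then have "set_integrable lborel {0..1} g" unfolding g_def by (rule iter_prim_set_integrable)
  then have "prim 0 0 g x = integral {0..x} g + 0" using Suc.prems by (rule prim_eq_integral)
  also have "integral {0..x} g = integral {0..x} (trunc_power d a \<tau>)"
  proof (rule Henstock_Kurzweil_Integration.integral_cong)
    fix y assume "y \<in> {0..x}"
    then have "y \<in> {0..1}" using Suc.prems by simp
    then show "g y = trunc_power d a \<tau> y" unfolding g_def by (rule Suc.IH)
  qed
  also have "\<dots> = trunc_power (Suc d) a \<tau> x"
    using trunc_power_has_integral[OF assms(1)] Suc.prems by (intro integral_unique) auto
  finally show ?case unfolding replicate_Suc iter_prim.simps g_def by (simp only: add_0_right)
qed

lemma trunc_power_mono_step: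
  assumes "a \<ge> 0" "k \<ge> 2" "n > 0" "t \<le> n"
  shows "(\<lambda>x\<in>{0..1}. trunc_power 0 a (real t / real n) x) \<in> mono_step n k"
proof -
  define \<tau> where "\<tau> = real t / real n"
  define f where "f = (\<lambda>x\<in>{0..1::real}. trunc_power 0 a \<tau> x)"
  \<comment> \<open>One jump uses two blocks; for \<open>k > 2\<close> the blocks in between are
    empty.\<close>
  define \<mu> where "\<mu> i = (if i = 0 then 0 else if i < k then t else n)" for i :: nat
  have \<tau>: "0 \<le> \<tau>" "\<tau> \<le> 1" using assms by (auto simp: \<tau>_def)
  have "mono_on {0..1} f" unfolding f_def using assms(1) by (intro mono_onI) (auto simp: trunc_power_def)
  moreover have "\<mu> (i - 1) \<le> \<mu> i \<and> f constant_on {real (\<mu> (i - 1)) / real n <.. real (\<mu> i) / real n}" if i: "i \<in> {1..k}" for i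
  proof -
    consider "i = 1" | "1 < i" "i < k" | "1 < i" "i = k" using i by force
    then show ?thesis
    proof cases
      case 1
      then have "f x = 0" if "0 < x" "x \<le> \<tau>" for x using that \<tau> by (simp add: f_def trunc_power_def)
      then have "f constant_on {0<..\<tau>}" unfolding constant_on_def by auto
      then show ?thesis using 1 assms by (simp add: \<mu>_def \<tau>_def)
    next
      case 2
      then have "\<mu> (i - 1) = t" "\<mu> i = t" by (auto simp: \<mu>_def)
      then show ?thesis by (simp add: constant_on_def)
    next
      case 3
      then have "f x = a" if "\<tau> < x" "x \<le> 1" for x using that \<tau> by (simp add: f_def trunc_power_def)
      then have "f constant_on {\<tau><..1}" unfolding constant_on_def by auto
      then show ?thesis using 3 assms by (simp add: \<mu>_def \<tau>_def)
    qed
  qed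
  moreover have "\<mu> 0 = 0" "\<mu> k = n" using assms by (auto simp: \<mu>_def)
  moreover have "f \<in> extensional {0..1}" by (simp add: f_def)
  ultimately have "f \<in> mono_step n k" unfolding mono_step_def by blast
  then show ?thesis unfolding f_def \<tau>_def .
qed

lemma trunc_power_Theta:
  assumes "c \<ge> 0" "k \<ge> 2" "n > 0" "t \<le> n"
  shows "(\<lambda>i\<in>{1..n}. if i \<le> t then 0 else c * real (i - t) ^ d) \<in> Theta n d k"
proof -
  \<comment> \<open>The factors \<open>n ^ d\<close> and \<open>fact d\<close> undo the grid spacing
    and the normalisation, so that the sampled values are \<open>c (i - t) ^ d\<close>.\<close>
  define a \<tau> where "a = c * real n ^ d * fact d" and "\<tau> = real t / real n"
  define f where "f = (\<lambda>x\<in>{0..1::real}. trunc_power 0 a \<tau> x)"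
  have a: "a \<ge> 0" using assms by (simp add: a_def)
  have "f \<in> mono_step n k" unfolding f_def \<tau>_def using a assms by (intro trunc_power_mono_step)
  then have "iter_prim (replicate d 0) 0 f \<in> mono_spline n d k"
    unfolding mono_spline_def by (intro CollectI exI conjI refl) auto
  moreover have "(if i \<le> t then 0 else c * real (i - t) ^ d) = iter_prim (replicate d 0) 0 f (real i / real n)"
    if i: "i \<in> {1..n}" for i
  proof -
    have "iter_prim (replicate d 0) 0 f (real i / real n) = trunc_power d a \<tau> (real i / real n)"
      unfolding f_def using a i by (intro iter_prim_trunc_power) (auto simp: \<tau>_def)
    also have "\<dots> = (if i \<le> t then 0 else c * real (i - t) ^ d)"
    proof (cases "i \<le> t")
      case True then show ?thesis by (simp add: trunc_power_def \<tau>_def divide_right_mono)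
    next
      case False
      have "real i / real n - \<tau> = real (i - t) / real n" using False by (simp add: \<tau>_def diff_divide_distrib of_nat_diff)
      moreover have "\<not> real i / real n \<le> \<tau>" using False assms(3) by (simp add: \<tau>_def divide_le_cancel)
      ultimately show ?thesis using False assms(3) by (simp add: trunc_power_def a_def power_divide)
    qed
    finally show ?thesis by simp
  qed
  ultimately show ?thesis unfolding Theta_def Rn_def space_PiM by (auto intro!: bexI[of _ "iter_prim (replicate d 0) 0 f"])
qed

section \<open>Norms and separation of the truncated powers\<close>

definition power_sum :: "nat \<Rightarrow> nat \<Rightarrow> real" where
  "power_sum d x = (\<Sum>u=1..x. real u ^ (2 * d))"

lemma power_sum_mono: "x \<le> y \<Longrightarrow> power_sum d x \<le> power_sum d y"
  unfolding power_sum_def by (intro sum_mono2) auto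

lemma power_sum_pos: "x > 0 \<Longrightarrow> power_sum d x > 0"
  unfolding power_sum_def by (intro sum_pos) auto

text \<open>The terms \<open>2 u - 1\<close> and \<open>2 u\<close> are each at most
  \<open>4 ^ d\<close> times the term \<open>u\<close>. This doubling property is what separates the
  hypotheses.\<close>

lemma power_sum_double: "power_sum d (2 * x) \<le> 2 * 4 ^ d * power_sum d x"
proof (induction x)
  case 0 then show ?case by (simp add: power_sum_def)
next
  case (Suc x)
  have "power_sum d (2 * Suc x) = power_sum d (2 * x) + real (2 * x + 1) ^ (2 * d) + real (2 * x + 2) ^ (2 * d)"
    by (simp add: power_sum_def)
  also have "real (2 * x + 1) ^ (2 * d) \<le> real (2 * x + 2) ^ (2 * d)" by (intro power_mono) auto
  also have "real (2 * x + 2) ^ (2 * d) = 4 ^ d * real (Suc x) ^ (2 * d)"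
  proof -
    have "real (2 * x + 2) = 2 * real (Suc x)" by simp
    then have "real (2 * x + 2) ^ (2 * d) = 2 ^ (2 * d) * real (Suc x) ^ (2 * d)" by (simp only: power_mult_distrib)
    also have "(2::real) ^ (2 * d) = 4 ^ d" by (simp add: power_mult)
    finally show ?thesis .
  qed
  finally have "power_sum d (2 * Suc x) \<le> power_sum d (2 * x) + 2 * 4 ^ d * real (Suc x) ^ (2 * d)" by simp
  also have "\<dots> \<le> 2 * 4 ^ d * power_sum d x + 2 * 4 ^ d * real (Suc x) ^ (2 * d)" using Suc.IH by simp
  also have "\<dots> = 2 * 4 ^ d * power_sum d (Suc x)" by (simp add: power_sum_def distrib_left)
  finally show ?case .
qed

lemma trunc_power_sum_sq:
  assumes "m \<le> n"
  shows "(\<Sum>i=n - m + 1..n - m + l. (c * real (i - (n - m)) ^ d)\<^sup>2) = c\<^sup>2 * power_sum d l"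
proof -
  have "(\<Sum>i=n - m + 1..n - m + l. (c * real (i - (n - m)) ^ d)\<^sup>2) = (\<Sum>u=1..l. (c * real u ^ d)\<^sup>2)"
    by (rule sum.reindex_bij_witness[of _ "\<lambda>u. n - m + u" "\<lambda>i. i - (n - m)"]) auto
  also have "\<dots> = c\<^sup>2 * power_sum d l"
    unfolding power_sum_def sum_distrib_left
    by (intro sum.cong refl) (simp add: power_mult_distrib power_mult[symmetric] mult.commute)
  finally show ?thesis .
qed

text \<open>The hypothesis \<open>\<theta> j\<close> is supported in the last \<open>2 ^ j\<close>
  positions. For \<open>j < l\<close> it vanishes on the left half of the last \<open>2 ^ l\<close>
  positions, and by doubling \<open>\<theta> l\<close> has at least the fraction
  \<open>1 / (2 * 4 ^ d)\<close> of its squared norm there, although its values are smallest on that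
  half. The same fraction therefore bounds all squared distances from below.\<close>

lemma minimax_lower_bound_log:
  assumes s: "\<sigma> > 0" and k: "k \<ge> 2" and M: "M > 0" "2 ^ M \<le> n" "4 \<le> M"
    and T: "T \<in> Rn n \<rightarrow>\<^sub>M Rn n"
  shows "\<exists>\<theta>\<in>Theta n d k. ennreal (\<sigma>\<^sup>2 * ln (real M / 4) / (16 * 4 ^ d)) \<le> risk n \<sigma> \<theta> T"
proof (cases "M = 4")
  case True
  \<comment> \<open>For \<open>M = 4\<close> the bound is 0 and the separation radius used below
    would vanish; the zero vector is a witness.\<close>
  define \<theta> where "\<theta> = (\<lambda>i\<in>{1..n}. if i \<le> 0 then 0 else 0 * real (i - 0) ^ d :: real)"
  have "n > 0" using M by (metis gr_zeroI not_less power_eq_0_iff le_zero_eq zero_neq_numeral)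
  then have "\<theta> \<in> Theta n d k" unfolding \<theta>_def using k by (intro trunc_power_Theta) auto
  then show ?thesis using True by auto
next
  case False
  define A where "A = ln (real M / 4)"
  have A: "A > 0" using False M by (simp add: A_def)
  have n: "n > 0" using M by (metis gr_zeroI not_less power_eq_0_iff le_zero_eq zero_neq_numeral)
  \<comment> \<open>Scaled so that the squared norm is \<open>\<sigma>^2 A\<close>, exactly the
    amount that \<open>multiple_hypotheses_lower_bound\<close> allows.\<close>
  define c where "c j = \<sigma> * sqrt (A / power_sum d (2 ^ j))" for j :: nat
  have c0: "c j \<ge> 0" for j using s A power_sum_pos[of "2 ^ j" d] by (simp add: c_def)
  have c2: "(c j)\<^sup>2 = \<sigma>\<^sup>2 * A / power_sum d (2 ^ j)" for j
    using A power_sum_pos[of "2 ^ j" d] by (simp add: c_def power_mult_distrib)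
  define \<theta> where "\<theta> j = (\<lambda>i\<in>{1..n}. if i \<le> n - 2 ^ j then 0 else c j * real (i - (n - 2 ^ j)) ^ d)" for j
  have le: "2 ^ j \<le> n" if "j \<in> {1..M}" for j :: nat
  proof -
    have "(2::nat) ^ j \<le> 2 ^ M" using that by (intro power_increasing) auto
    then show ?thesis using M by linarith
  qed
  define r where "r = sqrt (\<sigma>\<^sup>2 * A / (2 * 4 ^ d))"
  have r0: "r > 0" using s A by (simp add: r_def)
  have r2: "r\<^sup>2 = \<sigma>\<^sup>2 * A / (2 * 4 ^ d)" using A by (simp add: r_def)
  have sep: "r \<le> edist n (\<theta> l) (\<theta> j)" if jl: "j \<in> {1..M}" "l \<in> {1..M}" "j < l" for j l
  proof -
    have p1: "2 * 2 ^ j \<le> (2::nat) ^ l"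
      using power_increasing[of "Suc j" l "2::nat"] jl(3) by simp
    obtain l' where l': "l = Suc l'" using jl by (cases l) auto
    have half: "(2::nat) ^ l' \<le> 2 ^ l - 2 ^ j" using p1 unfolding l' power_Suc by linarith
    have "power_sum d (2 ^ l) \<le> 2 * 4 ^ d * power_sum d (2 ^ l')"
      using power_sum_double[of d "2 ^ l'"] l' by simp
    also have "\<dots> \<le> 2 * 4 ^ d * power_sum d (2 ^ l - 2 ^ j)" using half by (intro mult_left_mono power_sum_mono) auto
    finally have ps: "power_sum d (2 ^ l) \<le> 2 * 4 ^ d * power_sum d (2 ^ l - 2 ^ j)" .
    have "r\<^sup>2 \<le> (c l)\<^sup>2 * power_sum d (2 ^ l - 2 ^ j)"
    proof -
      have "(\<sigma>\<^sup>2 * A) * power_sum d (2 ^ l) \<le> (\<sigma>\<^sup>2 * A) * (2 * 4 ^ d * power_sum d (2 ^ l - 2 ^ j))"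
        using ps A by (intro mult_left_mono) auto
      then show ?thesis unfolding r2 c2 using power_sum_pos[of "2 ^ l" d] by (simp add: field_simps)
    qed
    also have "\<dots> = (\<Sum>i=n - 2 ^ l + 1..n - 2 ^ l + (2 ^ l - 2 ^ j). (c l * real (i - (n - 2 ^ l)) ^ d)\<^sup>2)"
      by (rule trunc_power_sum_sq[OF le[OF jl(2)], symmetric])
    also have "\<dots> = (\<Sum>i=n - 2 ^ l + 1..n - 2 ^ l + (2 ^ l - 2 ^ j). (\<theta> l i - \<theta> j i)\<^sup>2)"
    proof (intro sum.cong refl)
      fix i assume i: "i \<in> {n - 2 ^ l + 1..n - 2 ^ l + (2 ^ l - 2 ^ j)}"
      have "n - 2 ^ l + (2 ^ l - 2 ^ j) = n - 2 ^ j" using le[OF jl(2)] p1 by simp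
      then have "n - 2 ^ l < i" "i \<le> n - 2 ^ j" "1 \<le> i" "i \<le> n" using i by auto
      then show "(c l * real (i - (n - 2 ^ l)) ^ d)\<^sup>2 = (\<theta> l i - \<theta> j i)\<^sup>2" by (simp add: \<theta>_def)
    qed
    also have "\<dots> \<le> (\<Sum>i=1..n. (\<theta> l i - \<theta> j i)\<^sup>2)"
      using le[OF jl(2)] p1 by (intro sum_mono2) auto
    also have "\<dots> = (edist n (\<theta> l) (\<theta> j))\<^sup>2" unfolding edist_def L2_set_def by (simp add: sum_nonneg)
    finally show ?thesis by (rule power2_le_imp_le) (simp add: edist_def)
  qed
  have "\<exists>j\<in>{1..M}. ennreal (r\<^sup>2 / 8) \<le> risk n \<sigma> (\<theta> j) T"
  proof (rule multiple_hypotheses_lower_bound[OF s _ _ M(1) _ _ r0 T])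
    fix j assume j: "j \<in> {1..M}"
    have "(\<Sum>i=1..n. (\<theta> j i)\<^sup>2) = (\<Sum>i=n - 2 ^ j + 1..n - 2 ^ j + 2 ^ j. (c j * real (i - (n - 2 ^ j)) ^ d)\<^sup>2)"
      using le[OF j] by (intro sum.mono_neutral_cong_right) (auto simp: \<theta>_def)
    also have "\<dots> = (c j)\<^sup>2 * power_sum d (2 ^ j)" by (rule trunc_power_sum_sq[OF le[OF j]])
    also have "\<dots> = \<sigma>\<^sup>2 * A" using power_sum_pos[of "2 ^ j" d] by (simp add: c2)
    finally show "(\<Sum>i=1..n. (\<theta> j i)\<^sup>2) \<le> \<sigma>\<^sup>2 * ln (real M / 4)" by (simp add: A_def)
  next
    fix i j assume "i \<in> {1..M}" "j \<in> {1..M}" "i \<noteq> j"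
    then show "r \<le> edist n (\<theta> i) (\<theta> j)" using sep[of i j] sep[of j i] edist_commute[of n "\<theta> i" "\<theta> j"] by (cases "i < j") auto
  qed auto
  then obtain j where j: "ennreal (r\<^sup>2 / 8) \<le> risk n \<sigma> (\<theta> j) T" by blast
  have "\<theta> j \<in> Theta n d k" unfolding \<theta>_def using c0 k n by (intro trunc_power_Theta) auto
  moreover have "r\<^sup>2 / 8 = \<sigma>\<^sup>2 * ln (real M / 4) / (16 * 4 ^ d)" by (simp add: r2 A_def)
  ultimately show ?thesis using j by metis
qed

text \<open>With \<open>M = floor_log n\<close> one has \<open>ln (16 n) <= M + 5\<close>, and
  \<open>M >= 24\<close> makes \<open>(M / 4)^2 >= 3 M / 2 >= M + 12\<close>. Squaring inside the
  logarithm costs only the factor 2.\<close>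

lemma loglog_le_log_floor_log:
  assumes "n \<ge> 2 ^ 24"
  shows "ln (ln (16 * real n)) \<le> 2 * ln (real (floor_log n) / 4)" "floor_log n \<ge> 24"
proof -
  have "floor_log (2 ^ 24) \<le> floor_log n" using assms by (rule floor_log_le_iff)
  then show M: "floor_log n \<ge> 24" by (simp only: floor_log_power)
  have n0: "n > 0" using assms by (rule less_le_trans[rotated]) simp
  have "n < 2 ^ (floor_log n + 1)" using floor_log_bounds(2)[OF n0] by simp
  then have "real n < 2 ^ (floor_log n + 1)" by (metis of_nat_less_iff of_nat_numeral of_nat_power)
  then have "16 * real n \<le> 2 ^ (floor_log n + 5)" by (simp add: power_add)
  then have "ln (16 * real n) \<le> ln (2 ^ (floor_log n + 5))" using n0 by (subst ln_le_cancel_iff) auto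
  also have "\<dots> = (real (floor_log n) + 5) * ln 2" by (simp add: ln_realpow)
  also have "\<dots> \<le> (real (floor_log n) + 5) * 1" using ln_le_minus_one[of "2::real"] by (intro mult_left_mono) auto
  finally have 1: "ln (16 * real n) \<le> real (floor_log n) + 5" by simp
  have M': "real (floor_log n) \<ge> 24" using M by simp
  have "24 * real (floor_log n) \<le> real (floor_log n) * real (floor_log n)" using M' by (intro mult_right_mono) auto
  moreover have "(real (floor_log n) / 4)\<^sup>2 = real (floor_log n) * real (floor_log n) / 16" by (simp add: power2_eq_square)
  ultimately have "real (floor_log n) + 5 \<le> (real (floor_log n) / 4)\<^sup>2" using M' by linarith
  then have "ln (16 * real n) \<le> (real (floor_log n) / 4)\<^sup>2" using 1 by linarith
  moreover have "ln (16 * real n) > 0" using n0 by simp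
  ultimately have "ln (ln (16 * real n)) \<le> ln ((real (floor_log n) / 4)\<^sup>2)" using M' by (subst ln_le_cancel_iff) auto
  also have "\<dots> = 2 * ln (real (floor_log n) / 4)" using M' by (simp add: ln_realpow)
  finally show "ln (ln (16 * real n)) \<le> 2 * ln (real (floor_log n) / 4)" .
qed

lemma minimax_lower_bound:
  assumes s: "\<sigma> > 0" and k: "k \<ge> 2" and n: "n \<ge> 2 ^ 24"
  shows "ennreal (1 / (32 * 4 ^ d) * \<sigma>\<^sup>2 * ln (ln (16 * real n))) \<le> (INF T\<in>Rn n \<rightarrow>\<^sub>M Rn n. SUP \<theta>\<in>Theta n d k. risk n \<sigma> \<theta> T)"
proof (rule INF_greatest)
  fix T assume T: "T \<in> Rn n \<rightarrow>\<^sub>M Rn n"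
  define M where "M = floor_log n"
  have M: "M \<ge> 24" "ln (ln (16 * real n)) \<le> 2 * ln (real M / 4)"
    unfolding M_def using loglog_le_log_floor_log[OF n] by auto
  have n0: "n > 0" using n by (rule less_le_trans[rotated]) simp
  have "2 ^ M \<le> n" unfolding M_def using floor_log_bounds(1)[OF n0] .
  then obtain \<theta> where \<theta>: "\<theta> \<in> Theta n d k" "ennreal (\<sigma>\<^sup>2 * ln (real M / 4) / (16 * 4 ^ d)) \<le> risk n \<sigma> \<theta> T"
    using minimax_lower_bound_log[OF s k _ _ _ T, of M d] M(1) by auto
  have "1 / (32 * 4 ^ d) * \<sigma>\<^sup>2 * ln (ln (16 * real n)) \<le> 1 / (32 * 4 ^ d) * \<sigma>\<^sup>2 * (2 * ln (real M / 4))"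
    using M(2) by (intro mult_left_mono) auto
  also have "\<dots> = \<sigma>\<^sup>2 * ln (real M / 4) / (16 * 4 ^ d)" by (simp add: field_simps)
  finally have "ennreal (1 / (32 * 4 ^ d) * \<sigma>\<^sup>2 * ln (ln (16 * real n))) \<le> ennreal (\<sigma>\<^sup>2 * ln (real M / 4) / (16 * 4 ^ d))"
    by (rule ennreal_leI)
  also have "\<dots> \<le> risk n \<sigma> \<theta> T" by (rule \<theta>(2))
  also have "\<dots> \<le> (SUP \<theta>\<in>Theta n d k. risk n \<sigma> \<theta> T)" using \<theta>(1) by (rule SUP_upper)
  finally show "ennreal (1 / (32 * 4 ^ d) * \<sigma>\<^sup>2 * ln (ln (16 * real n))) \<le> (SUP \<theta>\<in>Theta n d k. risk n \<sigma> \<theta> T)" .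
qed

theorem theorem3p4:
  fixes d :: nat
  shows "\<exists>n0 :: nat. \<exists>c :: real. c > 0 \<and> (\<forall>\<delta> :: real. \<delta> > 0 \<longrightarrow> (\<exists>C :: real. C > 0 \<and>
    (\<forall>n k :: nat. \<forall>\<sigma> :: real. n \<ge> n0 \<longrightarrow> 2 \<le> k \<longrightarrow> k \<le> n \<longrightarrow> \<sigma> > 0 \<longrightarrow>
      (\<forall>\<theta>\<^sub>0 T. \<theta>\<^sub>0 \<in> space (Rn n) \<longrightarrow> is_LSE n d k T \<longrightarrow>
        risk n \<sigma> \<theta>\<^sub>0 T \<le>
          ennreal ((1 + \<delta>) * (INF \<theta>\<in>Theta n d k. (edist n \<theta> \<theta>\<^sub>0)\<^sup>2)
                   + C * \<sigma>\<^sup>2 * real k * ln (ln (16 * real n / real k)))) \<and>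
      (INF T\<in>Rn n \<rightarrow>\<^sub>M Rn n. SUP \<theta>\<in>Theta n d k. risk n \<sigma> \<theta> T)
        \<ge> ennreal (c * \<sigma>\<^sup>2 * ln (ln (16 * real n))))))"
  \<comment> \<open>Both witnesses come from the lower bound. They are fixed before
    \<open>\<delta>\<close>; of the constants only \<open>C\<close> depends on it.\<close>
  apply (rule exI[of _ "2 ^ 24"], rule exI[of _ "1 / (32 * 4 ^ d)"], intro conjI allI impI)
  subgoal by simp
  subgoal for \<delta>
    by (rule ex_forward[OF LSE_oracle_inequality[of \<delta> d]], assumption, elim conjE, intro conjI allI impI)
      (assumption, simp, (rule minimax_lower_bound; assumption))
  done

end
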